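(* Let $\delta$ be a matrix of free polynomials in $d$ variables with $\delta(0)=0$, and let $h:B_\delta\to\mathbb{M}$ be a graded function. Then $h\in\mathrm{RHA}(B_\delta)$ if and only if there exists a sequence of free polynomials $\{p_n\}_{n=1}^\infty$ in $d$ variables such that $p_n|_{B_\delta}\in\mathrm{RHA}(B_\delta)$ for every $n$, and $p_n$ converges to $h$ uniformly (in operator norm) on $K_{\delta,r}$ for every $0<r<1$.
   Context: Let $\mathbb{M}_n$ be the $n\times n$ complex matrices, $\mathbb{M}_n^d$ the $d$-tuples of $n\times n$ complex matrices, $\mathbb{M}^d=\coprod_{n\ge1}\mathbb{M}_n^d$ and $\mathbb{M}=\mathbb{M}^1$. A free polynomial in $d$ variables is an element of $\mathbb{C}\langle x_1,\dots,x_d\rangle$; it is evaluated on $x\in\mathbb{M}_n^d$ in the usual way to give an element of $\mathbb{M}_n$ (a constant $c$ evaluates to $cI_n$). If $\delta$ is an $s\times r$ matrix of free polynomials and $x\in\mathbb{M}_n^d$, then $\delta(x)$ is the $s\times r$ block matrix with $n\times n$ blocks obtained by entrywise evaluation, and $\|\delta(x)\|$ is its operator norm. Define $B_\delta=\{x\in\mathbb{M}^d: \|\delta(x)\|<1\}$, and for $0<r<1$ define $K_{\delta,r}=\{x\in B_\delta:\|\delta(x)\|\le r\}$. Here $0$ denotes the zero tuple in any $\mathbb{M}_n^d$. For $\Omega\subset\mathbb{M}^d$ write $\Omega_n=\Omega\cap\mathbb{M}_n^d$. A function $f:\Omega\to\mathbb{M}$ is graded if $f(x)\in\mathbb{M}_n$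 whenever $x\in\Omega_n$. For $\Omega$ closed under direct sums, $f:\Omega\to\mathbb{M}$ is an nc function if it is graded and, whenever $x\in\Omega_n$, $y\in\Omega_m$ and an $m\times n$ matrix $\alpha$ satisfy $\alpha x=y\alpha$ (componentwise), then $\alpha f(x)=f(y)\alpha$. The regular free Herglotz-Agler class $\mathrm{RHA}(B_\delta)$ is the set of nc functions $h:B_\delta\to\mathbb{M}$ with $\Re h(x)=\frac{h(x)+h(x)^*}{2}\ge0$ for all $x\in B_\delta$ and $h(0)=I$. *)

theory Defs
  imports
    "Jordan_Normal_Form.Schur_Decomposition"
    "HOL-Analysis.L2_Norm"
    "HOL-Library.Poly_Mapping"
begin

text \<open>Words form the free monoid under concatenation. With this instance the library's convolution
  product on finitely supported functions makes \<open>'d list \<Rightarrow>\<^sub>0 complex\<close> the monoid algebra of the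
  free monoid, that is, the free algebra in the variables indexed by \<open>'d\<close>.\<close>

instantiation list :: (type) monoid_add
begin

definition zero_list :: "'a list" where "zero_list = []"
definition plus_list :: "'a list \<Rightarrow> 'a list \<Rightarrow> 'a list" where "plus_list u v = u @ v"

instance by standard (simp_all add: zero_list_def plus_list_def)

end

type_synonym 'd free_poly = "'d list \<Rightarrow>\<^sub>0 complex"

text \<open>A \<open>d\<close>-tuple of matrices is indexed by a finite type \<open>'d\<close> with \<open>d\<close> elements. As \<open>'d\<close> is
  nonempty, tuples of different sizes are distinct and the disjoint union is an ordinary union.\<close>

type_synonym 'd mat_tuple = "'d \<Rightarrow> complex mat"

definition mat_tuples :: "nat \<Rightarrow> 'd mat_tuple set" where
  "mat_tuples n = {x. \<forall>i. x i \<in> carrier_mat n n}"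

definition nc_universe :: "'d mat_tuple set" where
  "nc_universe = (\<Union>n\<in>{1..}. mat_tuples n)"

definition level :: "'d mat_tuple \<Rightarrow> nat" where
  "level x = (THE n. x \<in> mat_tuples n)"

definition zero_tuple :: "nat \<Rightarrow> 'd mat_tuple" where
  "zero_tuple n = (\<lambda>i. 0\<^sub>m n n)"

definition word_eval :: "nat \<Rightarrow> 'd mat_tuple \<Rightarrow> 'd list \<Rightarrow> complex mat" where
  "word_eval n x w = foldr (\<lambda>i A. x i * A) w (1\<^sub>m n)"

text \<open>The sum over the monomials of \<open>p\<close> is taken entrywise, since matrices of varying dimension
  are not an additive monoid.\<close>

definition free_eval :: "'d free_poly \<Rightarrow> 'd mat_tuple \<Rightarrow> complex mat" where
  "free_eval p x = (let n = level x in
     mat n n (\<lambda>(a, b). \<Sum>w\<in>Poly_Mapping.keys p. Poly_Mapping.lookup p w * word_eval n x w $$ (a, b)))"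

definition free_mat_eval :: "'d free_poly mat \<Rightarrow> 'd mat_tuple \<Rightarrow> complex mat" where
  "free_mat_eval \<delta> x = (let n = level x in
     mat (dim_row \<delta> * n) (dim_col \<delta> * n)
       (\<lambda>(a, b). free_eval (\<delta> $$ (a div n, b div n)) x $$ (a mod n, b mod n)))"

definition vec_norm2 :: "complex vec \<Rightarrow> real" where
  "vec_norm2 v = L2_set (\<lambda>i. cmod (v $ i)) {..<dim_vec v}"

definition op_norm :: "complex mat \<Rightarrow> real" where
  "op_norm A = (SUP v \<in> {v \<in> carrier_vec (dim_col A). vec_norm2 v \<le> 1}. vec_norm2 (A *\<^sub>v v))"

definition nc_ball :: "'d free_poly mat \<Rightarrow> 'd mat_tuple set" where
  "nc_ball \<delta> = {x \<in> nc_universe. op_norm (free_mat_eval \<delta> x) < 1}"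

definition nc_subball :: "'d free_poly mat \<Rightarrow> real \<Rightarrow> 'd mat_tuple set" where
  "nc_subball \<delta> r = {x \<in> nc_ball \<delta>. op_norm (free_mat_eval \<delta> x) \<le> r}"

text \<open>A function on \<open>\<Omega>\<close> is represented by a total function of which only the values on \<open>\<Omega>\<close>
  matter; every predicate below inspects only those values.\<close>

definition graded_on :: "'d mat_tuple set \<Rightarrow> ('d mat_tuple \<Rightarrow> complex mat) \<Rightarrow> bool" where
  "graded_on \<Omega> f \<longleftrightarrow> (\<forall>n\<ge>1. \<forall>x\<in>\<Omega> \<inter> mat_tuples n. f x \<in> carrier_mat n n)"

text \<open>Intended for \<open>\<Omega>\<close> closed under direct sums, as \<^const>\<open>nc_ball\<close> always is.\<close>

definition nc_function_on :: "'d mat_tuple set \<Rightarrow> ('d mat_tuple \<Rightarrow> complex mat) \<Rightarrow> bool" where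
  "nc_function_on \<Omega> f \<longleftrightarrow> graded_on \<Omega> f \<and>
     (\<forall>n\<ge>1. \<forall>m\<ge>1. \<forall>x\<in>\<Omega> \<inter> mat_tuples n. \<forall>y\<in>\<Omega> \<inter> mat_tuples m. \<forall>\<alpha>\<in>carrier_mat m n.
        (\<forall>i. \<alpha> * x i = y i * \<alpha>) \<longrightarrow> \<alpha> * f x = f y * \<alpha>)"

definition mat_Re :: "complex mat \<Rightarrow> complex mat" where
  "mat_Re A = (1 / 2) \<cdot>\<^sub>m (A + mat_adjoint A)"

text \<open>The order on the complex numbers is the one whose nonnegative elements are the nonnegative
  reals, so that positivity includes self-adjointness.\<close>

definition mat_psd :: "complex mat \<Rightarrow> bool" where
  "mat_psd A \<longleftrightarrow> square_mat A \<and> (\<forall>v\<in>carrier_vec (dim_row A). 0 \<le> (A *\<^sub>v v) \<bullet>c v)"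

definition RHA :: "'d mat_tuple set \<Rightarrow> ('d mat_tuple \<Rightarrow> complex mat) set" where
  "RHA \<Omega> = {h. nc_function_on \<Omega> h \<and> (\<forall>x\<in>\<Omega>. mat_psd (mat_Re (h x)))
     \<and> (\<forall>n\<ge>1. h (zero_tuple n) = 1\<^sub>m n)}"

end

theory Submission
  imports Defs "HOL-Analysis.Function_Topology" "HOL-Analysis.Topology_Euclidean_Space"
begin

text \<open>
  Let \<open>h\<close> be in the regular Herglotz-Agler class, \<open>z\<close> a point of the ball, \<open>e\<close> a vector and
  \<open>g = h(z) e\<close>. If \<open>(g e\<^sup>* + e g\<^sup>*)/2\<close> were not in the closed cone of the matrices
  \<open>\<Sum>\<^sub>k \<Sum>\<^sub>j u\<^sub>k\<^sub>j u\<^sub>k\<^sub>j\<^sup>* - \<Sum>\<^sub>k \<Sum>\<^sub>i (\<delta>(z) u\<^sub>k)\<^sub>i (\<delta>(z) u\<^sub>k)\<^sub>i\<^sup>*\<close>, a separating functional would be an inner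
  product for which \<open>\<delta>(z)\<close> is a strict contraction, hence \<open>z\<close> would be similar to a point of the ball
  at which \<open>h\<close> has a real part that is not positive. A lurking isometry argument
  turns membership in the cone into a contraction \<open>W\<close> and a unit vector \<open>\<nu>\<close> with
  \<open>h(z) e = \<nu>\<^sup>* (1 + W \<delta>(z)) (1 - W \<delta>(z))\<^sup>-\<^sup>1 \<nu> e\<close>, that is, into a power series in the entries of
  \<open>\<delta>\<close> with coefficients of modulus at most 2 that agrees with \<open>h\<close> at \<open>z\<close>. Direct sums and Tychonoff's
  theorem for the coefficients give one series that agrees with \<open>h\<close> on the whole ball. Its Fejer
  means are the required polynomials: they have positive real part because \<open>W \<delta>(x)\<close> is a
  contraction.
\<close>

unbundle no vec_syntax

section \<open>Square-summable functions on finite index sets\<close>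

text \<open>Working with one vector \<open>e\<close> rather than with all of \<open>h(z)\<close>
  loses nothing: finitely many pairs of a point and a vector are gathered into one pair by direct
  sums, and what is proved there is carried back by intertwiners. The normalisation of
  \<open>h\<close> enters by keeping the origin among the summands. The strict bound
  \<open>q < 1\<close> makes the cone closed: the trace of a cone element bounds the matrix that
  produces it, so a nearest point exists. The series need not be determined by \<open>h\<close>, so
  coefficients found for different finite sets may disagree and compactness has to select them.
  Every requirement must therefore be closed under coefficientwise convergence. Hence agreement with
  \<open>h\<close> is recorded as an error bound \<open>2 r^(M+1) / (1 - r)\<close> for every
  partial sum, depending on the point only through \<open>r\<close>, and positivity is recorded for
  each Fejer mean. Means are used because partial sums of \<open>(1 + Z) / (1 - Z)\<close> can have
  a real part that is not positive. The same rate makes the Fejer error \<open>O(1/N)\<close>,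
  uniformly where the norm of \<open>\<delta>(x)\<close> is at most \<open>r\<close>.\<close>

definition inner_on :: "'i set \<Rightarrow> ('i \<Rightarrow> complex) \<Rightarrow> ('i \<Rightarrow> complex) \<Rightarrow> complex" where
  "inner_on I f g = (\<Sum>i\<in>I. f i * cnj (g i))"

text \<open>Kept squared so that orthogonal parts and blocks of an index set add up; roots are taken
  only for estimates such as the triangle inequality.\<close>

definition norm2_on :: "'i set \<Rightarrow> ('i \<Rightarrow> complex) \<Rightarrow> real" where
  "norm2_on I f = (\<Sum>i\<in>I. (cmod (f i))\<^sup>2)"

text \<open>Only the column index set is an argument: the result is defined at every row index, and
  the norm or inner product taken afterwards selects the rows.\<close>

definition kapply :: "'j set \<Rightarrow> ('i \<Rightarrow> 'j \<Rightarrow> complex) \<Rightarrow> ('j \<Rightarrow> complex) \<Rightarrow> 'i \<Rightarrow> complex" where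
  "kapply J A f i = (\<Sum>j\<in>J. A i j * f j)"

lemma norm2_on_nonneg: "0 \<le> norm2_on I f"
  by (simp add: norm2_on_def sum_nonneg)

lemma norm2_on_cong: "(\<And>i. i \<in> I \<Longrightarrow> f i = g i) \<Longrightarrow> norm2_on I f = norm2_on I g"
  by (simp add: norm2_on_def)

lemma inner_on_cong:
  "(\<And>i. i \<in> I \<Longrightarrow> f i = f' i) \<Longrightarrow> (\<And>i. i \<in> I \<Longrightarrow> g i = g' i) \<Longrightarrow> inner_on I f g = inner_on I f' g'"
  by (simp add: inner_on_def)

lemma kapply_cong: "(\<And>j. j \<in> J \<Longrightarrow> f j = g j) \<Longrightarrow> kapply J A f i = kapply J A g i"
  by (simp add: kapply_def)

lemma inner_on_self: "inner_on I f f = of_real (norm2_on I f)"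
  by (simp add: inner_on_def norm2_on_def complex_norm_square[symmetric] del: of_real_power)

lemma norm2_on_eq_Re_inner: "norm2_on I f = Re (inner_on I f f)"
  by (simp add: inner_on_self)

lemma inner_on_commute: "inner_on I g f = cnj (inner_on I f g)"
  by (simp add: inner_on_def mult.commute)

lemma norm2_on_eq_0_iff: "finite I \<Longrightarrow> norm2_on I f = 0 \<longleftrightarrow> (\<forall>i\<in>I. f i = 0)"
  by (simp add: norm2_on_def sum_nonneg_eq_0_iff)

lemma inner_on_add_left: "inner_on I (\<lambda>i. f i + g i) h = inner_on I f h + inner_on I g h"
  by (simp add: inner_on_def sum.distrib algebra_simps)

lemma inner_on_add_right: "inner_on I h (\<lambda>i. f i + g i) = inner_on I h f + inner_on I h g"
  by (simp add: inner_on_def sum.distrib algebra_simps)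

lemma inner_on_diff_left: "inner_on I (\<lambda>i. f i - g i) h = inner_on I f h - inner_on I g h"
  by (simp add: inner_on_def sum_subtractf algebra_simps)

lemma inner_on_diff_right: "inner_on I h (\<lambda>i. f i - g i) = inner_on I h f - inner_on I h g"
  by (simp add: inner_on_def sum_subtractf algebra_simps)

lemma inner_on_scale_left: "inner_on I (\<lambda>i. c * f i) h = c * inner_on I f h"
  by (simp add: inner_on_def sum_distrib_left algebra_simps)

lemma inner_on_scale_right: "inner_on I h (\<lambda>i. c * f i) = cnj c * inner_on I h f"
  by (simp add: inner_on_def sum_distrib_left algebra_simps)

lemma inner_on_sum_left: "inner_on I (\<lambda>i. \<Sum>k\<in>K. f k i) h = (\<Sum>k\<in>K. inner_on I (f k) h)"
  unfolding inner_on_def sum_distrib_right by (rule sum.swap)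

lemma inner_on_sum_right: "inner_on I h (\<lambda>i. \<Sum>k\<in>K. f k i) = (\<Sum>k\<in>K. inner_on I h (f k))"
  unfolding inner_on_def cnj_sum sum_distrib_left by (rule sum.swap)

lemmas inner_on_linear = inner_on_add_left inner_on_add_right inner_on_diff_left inner_on_diff_right
  inner_on_scale_left inner_on_scale_right inner_on_sum_left inner_on_sum_right

lemma norm2_on_scale: "norm2_on I (\<lambda>i. c * f i) = (cmod c)\<^sup>2 * norm2_on I f"
  by (simp add: norm2_on_def norm_mult power_mult_distrib sum_distrib_left)

lemma norm2_on_add:
  "norm2_on I (\<lambda>i. f i + g i) = norm2_on I f + 2 * Re (inner_on I f g) + norm2_on I g"
proof -
  have "inner_on I g f = cnj (inner_on I f g)" by (rule inner_on_commute)
  then show ?thesis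
    by (simp add: norm2_on_eq_Re_inner inner_on_linear)
qed

lemma sqrt_norm2_on: "sqrt (norm2_on I f) = L2_set (\<lambda>i. cmod (f i)) I"
  by (simp add: norm2_on_def L2_set_def)

lemma inner_on_Cauchy_Schwarz: "cmod (inner_on I f g) \<le> sqrt (norm2_on I f) * sqrt (norm2_on I g)"
proof -
  have "cmod (inner_on I f g) \<le> (\<Sum>i\<in>I. \<bar>cmod (f i)\<bar> * \<bar>cmod (g i)\<bar>)"
    unfolding inner_on_def by (rule order_trans[OF norm_sum]) (simp add: norm_mult)
  also have "\<dots> \<le> L2_set (\<lambda>i. cmod (f i)) I * L2_set (\<lambda>i. cmod (g i)) I"
    by (rule L2_set_mult_ineq)
  finally show ?thesis by (simp add: sqrt_norm2_on)
qed

lemma sqrt_norm2_on_triangle: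
  "sqrt (norm2_on I (\<lambda>i. f i + g i)) \<le> sqrt (norm2_on I f) + sqrt (norm2_on I g)"
proof -
  have "L2_set (\<lambda>i. cmod (f i + g i)) I \<le> L2_set (\<lambda>i. cmod (f i) + cmod (g i)) I"
    by (rule L2_set_mono) (auto intro: norm_triangle_ineq)
  also have "\<dots> \<le> L2_set (\<lambda>i. cmod (f i)) I + L2_set (\<lambda>i. cmod (g i)) I"
    by (rule L2_set_triangle_ineq)
  finally show ?thesis by (simp add: sqrt_norm2_on)
qed

lemma cmod_le_sqrt_norm2_on: "finite I \<Longrightarrow> i \<in> I \<Longrightarrow> cmod (f i) \<le> sqrt (norm2_on I f)"
  unfolding norm2_on_def by (rule real_le_rsqrt) (auto intro: member_le_sum)

lemma kapply_add: "kapply J A (\<lambda>j. f j + g j) i = kapply J A f i + kapply J A g i"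
  by (simp add: kapply_def sum.distrib algebra_simps)

lemma kapply_diff: "kapply J A (\<lambda>j. f j - g j) i = kapply J A f i - kapply J A g i"
  by (simp add: kapply_def sum_subtractf algebra_simps)

lemma kapply_scale: "kapply J A (\<lambda>j. c * f j) i = c * kapply J A f i"
  by (simp add: kapply_def sum_distrib_left algebra_simps)

lemma kapply_sum: "kapply J A (\<lambda>j. \<Sum>k\<in>K. f k j) i = (\<Sum>k\<in>K. kapply J A (f k) i)"
  unfolding kapply_def sum_distrib_left by (rule sum.swap)

text \<open>One Gram-Schmidt step per index: the residual of \<open>a\<close> is corrected along the
  residual \<open>b\<close> of the new \<open>r x\<close>. The \<open>r i\<close> may be linearly
  dependent, so \<open>l\<close> is only claimed to exist.\<close>

lemma orthogonal_projection_on: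
  assumes "finite I" "finite P"
  shows "\<exists>l. \<forall>j\<in>I. inner_on P (\<lambda>p. a p - (\<Sum>i\<in>I. l i * r i p)) (r j) = 0"
  using assms(1)
proof (induction I arbitrary: a rule: finite_induct)
  case empty
  then show ?case by simp
next
  case (insert x I)
  obtain l where l: "\<And>j. j \<in> I \<Longrightarrow> inner_on P (\<lambda>p. a p - (\<Sum>i\<in>I. l i * r i p)) (r j) = 0"
    using insert.IH[of a] by blast
  obtain m where m: "\<And>j. j \<in> I \<Longrightarrow> inner_on P (\<lambda>p. r x p - (\<Sum>i\<in>I. m i * r i p)) (r j) = 0"
    using insert.IH[of "r x"] by blast
  define a' where "a' = (\<lambda>p. a p - (\<Sum>i\<in>I. l i * r i p))"
  define b where "b = (\<lambda>p. r x p - (\<Sum>i\<in>I. m i * r i p))"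
  have a': "\<And>j. j \<in> I \<Longrightarrow> inner_on P a' (r j) = 0" using l by (simp add: a'_def)
  have b: "\<And>j. j \<in> I \<Longrightarrow> inner_on P b (r j) = 0" using m by (simp add: b_def)
  define t where "t = inner_on P a' b / of_real (norm2_on P b)"
  \<comment> \<open>If \<open>b\<close> vanishes on \<open>P\<close>, then \<open>r x\<close>
    already lies in the span of the others there, and both sides are 0.\<close>
  have t: "inner_on P a' b = t * of_real (norm2_on P b)"
  proof (cases "norm2_on P b = 0")
    case True
    then have "\<forall>p\<in>P. b p = 0" using assms(2) norm2_on_eq_0_iff by blast
    then have "inner_on P a' b = 0" by (simp add: inner_on_def)
    then show ?thesis using True by simp
  qed (simp add: t_def)
  define a'' where "a'' = (\<lambda>p. a' p - t * b p)"
  have a''I: "inner_on P a'' (r j) = 0" if "j \<in> I" for j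
    using a'[OF that] b[OF that] by (simp add: a''_def inner_on_linear)
  have "inner_on P a'' b = 0"
    by (simp add: a''_def inner_on_linear t inner_on_self)
  moreover have "r x = (\<lambda>p. b p + (\<Sum>i\<in>I. m i * r i p))" by (simp add: b_def)
  then have "inner_on P a'' (r x) = inner_on P a'' b + (\<Sum>i\<in>I. cnj (m i) * inner_on P a'' (r i))"
    by (simp add: inner_on_add_right inner_on_sum_right inner_on_scale_right)
  ultimately have a''x: "inner_on P a'' (r x) = 0" using a''I by simp
  define l' where "l' = (\<lambda>i. if i = x then t else l i - t * m i)"
  have "a p - (\<Sum>i\<in>insert x I. l' i * r i p) = a'' p" for p
  proof -
    have "(\<Sum>i\<in>insert x I. l' i * r i p) = t * r x p + (\<Sum>i\<in>I. l' i * r i p)"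
      using insert.hyps by (simp add: l'_def)
    also have "(\<Sum>i\<in>I. l' i * r i p) = (\<Sum>i\<in>I. (l i - t * m i) * r i p)"
      by (rule sum.cong) (use insert.hyps in \<open>auto simp: l'_def\<close>)
    finally show ?thesis
      by (simp add: a''_def a'_def b_def sum_subtractf sum_distrib_left algebra_simps)
  qed
  then have "(\<lambda>p. a p - (\<Sum>i\<in>insert x I. l' i * r i p)) = a''" by (rule ext)
  then show ?case using a''x a''I by (intro exI[of _ l']) auto
qed

text \<open>The added kernel has rank one: with \<open>c\<close> the nonzero squared norm of
  \<open>a\<close> it sends \<open>a\<close> to \<open>b\<close> and annihilates what is orthogonal
  to \<open>a\<close>.\<close>

lemma kapply_rank_one_update:
  "kapply P (\<lambda>q p. W q p + b q * (cnj (a p) / c)) f q = kapply P W f q + b q * (inner_on P f a / c)"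
  by (simp add: kapply_def inner_on_def sum.distrib sum_distrib_left sum_divide_distrib algebra_simps)

text \<open>The kernel \<open>W\<close> is built by Gram-Schmidt as a partial isometry: the induction keeps track of its
  kernel, the orthogonal complement of the \<open>r i\<close>, and of its range, the span of the \<open>s i\<close>.\<close>

lemma equal_Gram_contraction_aux:
  fixes r :: "'i \<Rightarrow> 'p \<Rightarrow> complex" and s :: "'i \<Rightarrow> 'q \<Rightarrow> complex"
  assumes "finite I" "finite P" "finite Q"
    and "\<forall>i\<in>I. \<forall>j\<in>I. inner_on P (r i) (r j) = inner_on Q (s i) (s j)"
  shows "\<exists>W. (\<forall>i\<in>I. \<forall>q\<in>Q. kapply P W (r i) q = s i q)
      \<and> (\<forall>f. (\<forall>i\<in>I. inner_on P f (r i) = 0) \<longrightarrow> (\<forall>q\<in>Q. kapply P W f q = 0))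
      \<and> (\<forall>f g. (\<forall>i\<in>I. inner_on Q g (s i) = 0) \<longrightarrow> inner_on Q g (kapply P W f) = 0)
      \<and> (\<forall>f. norm2_on Q (kapply P W f) \<le> norm2_on P f)"
  using assms(1) assms(4)
proof (induction I rule: finite_induct)
  case empty
  show ?case
    by (rule exI[of _ "\<lambda>q p. 0"]) (simp add: kapply_def inner_on_def norm2_on_def sum_nonneg)
next
  case (insert x I)
  then obtain W where W1: "\<And>i q. i \<in> I \<Longrightarrow> q \<in> Q \<Longrightarrow> kapply P W (r i) q = s i q"
    and W2: "\<And>f q. (\<forall>i\<in>I. inner_on P f (r i) = 0) \<Longrightarrow> q \<in> Q \<Longrightarrow> kapply P W f q = 0"
    and W3: "\<And>f g. (\<forall>i\<in>I. inner_on Q g (s i) = 0) \<Longrightarrow> inner_on Q g (kapply P W f) = 0"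
    and W4: "\<And>f. norm2_on Q (kapply P W f) \<le> norm2_on P f"
    by (metis (no_types, lifting) insert_iff)
  have Gram: "\<And>i j. i \<in> insert x I \<Longrightarrow> j \<in> insert x I \<Longrightarrow>
      inner_on P (r i) (r j) = inner_on Q (s i) (s j)" using insert.prems by blast
  obtain l where l: "\<And>j. j \<in> I \<Longrightarrow> inner_on P (\<lambda>p. r x p - (\<Sum>i\<in>I. l i * r i p)) (r j) = 0"
    using orthogonal_projection_on[OF insert.hyps(1) assms(2), of "r x" r] by blast
  \<comment> \<open>The same coefficients \<open>l\<close> are used for both families, so equality
    of the Gram matrices makes \<open>b\<close> orthogonal to the earlier \<open>s i\<close> and
    gives \<open>a\<close> and \<open>b\<close> equal norms.\<close>
  define a where "a = (\<lambda>p. r x p - (\<Sum>i\<in>I. l i * r i p))"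
  define b where "b = (\<lambda>q. s x q - (\<Sum>i\<in>I. l i * s i q))"
  have a: "\<And>j. j \<in> I \<Longrightarrow> inner_on P a (r j) = 0" using l by (simp add: a_def)
  have ab: "inner_on P a (r j) = inner_on Q b (s j)" if "j \<in> insert x I" for j
    using Gram that by (simp add: a_def b_def inner_on_linear)
  have b: "\<And>j. j \<in> I \<Longrightarrow> inner_on Q b (s j) = 0" using a ab by simp
  have rx: "r x = (\<lambda>p. a p + (\<Sum>i\<in>I. l i * r i p))" and sx: "s x = (\<lambda>q. b q + (\<Sum>i\<in>I. l i * s i q))"
    by (simp_all add: a_def b_def)
  have arx: "inner_on P a (r x) = of_real (norm2_on P a)"
    using a by (subst rx) (simp add: inner_on_linear inner_on_self)
  have bsx: "inner_on Q b (s x) = of_real (norm2_on Q b)"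
    using b by (subst sx) (simp add: inner_on_linear inner_on_self)
  have nab: "norm2_on P a = norm2_on Q b" using ab[of x] arx bsx by simp
  have aW: "kapply P W a q = 0" if "q \<in> Q" for q using W2 a that by blast
  have Wrx: "kapply P W (r x) q = s x q - b q" if "q \<in> Q" for q
  proof -
    have "kapply P W (r x) q = kapply P W a q + (\<Sum>i\<in>I. l i * kapply P W (r i) q)"
      by (subst rx) (simp add: kapply_add kapply_sum kapply_scale)
    then show ?thesis using aW W1 that by (simp add: sx)
  qed
  \<comment> \<open>\<open>W\<close> annihilates \<open>a\<close>, so the update only redirects
    \<open>a\<close> to \<open>b\<close>. If \<open>a\<close> vanishes on \<open>P\<close>, division
    by 0 leaves \<open>W\<close> unchanged, which is right because \<open>b\<close> vanishes
    too.\<close>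
  define W' where "W' = (\<lambda>q p. W q p + b q * (cnj (a p) / of_real (norm2_on P a)))"
  have W': "kapply P W' f q = kapply P W f q + b q * (inner_on P f a / of_real (norm2_on P a))" for f q
    unfolding W'_def by (rule kapply_rank_one_update)
  have b0: "b q = 0" if "norm2_on P a = 0" "q \<in> Q" for q
    using that nab norm2_on_eq_0_iff[OF assms(3)] by metis
  have ra: "inner_on P (r j) a = 0" if "j \<in> I" for j
    using a[OF that] inner_on_commute[of P "r j" a] by simp
  show ?case
  proof (intro exI[of _ W'] conjI allI impI ballI)
    fix i q assume "i \<in> insert x I" and q: "q \<in> Q"
    then consider "i = x" | "i \<in> I" by blast
    then show "kapply P W' (r i) q = s i q"
    proof cases
      case 1
      have "inner_on P (r x) a = of_real (norm2_on P a)"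
        using arx inner_on_commute[of P "r x" a] by simp
      then show ?thesis using 1 b0[OF _ q] by (cases "norm2_on P a = 0") (simp_all add: W' Wrx[OF q])
    next
      case 2
      then show ?thesis using ra q W1 by (simp add: W')
    qed
  next
    fix f q assume f: "\<forall>i\<in>insert x I. inner_on P f (r i) = 0" and q: "q \<in> Q"
    have "inner_on P f a = 0" using f by (simp add: a_def inner_on_linear)
    then show "kapply P W' f q = 0" using f q W2 by (simp add: W')
  next
    fix f g assume g: "\<forall>i\<in>insert x I. inner_on Q g (s i) = 0"
    have "inner_on Q g b = 0" using g by (simp add: b_def inner_on_linear)
    moreover define c where "c = inner_on P f a / of_real (norm2_on P a)"
    have "kapply P W' f = (\<lambda>q. kapply P W f q + c * b q)"
      by (rule ext) (simp add: W' c_def mult.commute)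
    ultimately show "inner_on Q g (kapply P W' f) = 0" using g W3 by (simp add: inner_on_linear)
  next
    fix f
    define t where "t = inner_on P f a / of_real (norm2_on P a)"
    have t: "inner_on P f a = t * of_real (norm2_on P a)"
    proof (cases "norm2_on P a = 0")
      case True
      then have "\<forall>p\<in>P. a p = 0" using assms(2) norm2_on_eq_0_iff by blast
      then have "inner_on P f a = 0" by (simp add: inner_on_def)
      then show ?thesis using True by simp
    qed (simp add: t_def)
    \<comment> \<open>\<open>f'\<close> is the part of \<open>f\<close> orthogonal to
      \<open>a\<close>, and \<open>b\<close> is orthogonal to the range of \<open>W\<close>, so
      Pythagoras applies on both sides.\<close>
    define f' where "f' = (\<lambda>p. f p - t * a p)"
    have "inner_on P f' a = 0" by (simp add: f'_def inner_on_linear t inner_on_self)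
    then have f'a: "inner_on P f' (\<lambda>p. t * a p) = 0" by (simp add: inner_on_linear)
    have "norm2_on P f = norm2_on P (\<lambda>p. f' p + t * a p)" by (simp add: f'_def)
    also have "\<dots> = norm2_on P f' + (cmod t)\<^sup>2 * norm2_on P a"
      by (simp add: norm2_on_add norm2_on_scale f'a)
    finally have nf: "norm2_on P f = norm2_on P f' + (cmod t)\<^sup>2 * norm2_on P a" .
    have "norm2_on Q (kapply P W' f) = norm2_on Q (\<lambda>q. kapply P W f' q + t * b q)"
      by (rule norm2_on_cong) (simp add: W' t_def[symmetric] f'_def kapply_diff kapply_scale aW)
    also have "\<dots> = norm2_on Q (kapply P W f') + 2 * Re (inner_on Q (kapply P W f') (\<lambda>q. t * b q))
        + (cmod t)\<^sup>2 * norm2_on Q b"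
      by (simp add: norm2_on_add norm2_on_scale)
    also have "inner_on Q (kapply P W f') b = 0"
      using W3[of b f'] b inner_on_commute[of Q "kapply P W f'" b] by simp
    then have "inner_on Q (kapply P W f') (\<lambda>q. t * b q) = 0" by (simp add: inner_on_linear)
    finally show "norm2_on Q (kapply P W' f) \<le> norm2_on P f"
      using W4[of f'] nf nab by simp
  qed
qed

text \<open>This is the lurking isometry: equal Gram matrices define an isometry between the spans,
  and extending it by 0 on the orthogonal complement gives a contraction on all functions.\<close>

lemma equal_Gram_contraction:
  fixes r :: "'i \<Rightarrow> 'p \<Rightarrow> complex" and s :: "'i \<Rightarrow> 'q \<Rightarrow> complex"
  assumes "finite I" "finite P" "finite Q"
    and "\<And>i j. i \<in> I \<Longrightarrow> j \<in> I \<Longrightarrow> inner_on P (r i) (r j) = inner_on Q (s i) (s j)"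
  obtains W where "\<And>i q. i \<in> I \<Longrightarrow> q \<in> Q \<Longrightarrow> kapply P W (r i) q = s i q"
    and "\<And>f. norm2_on Q (kapply P W f) \<le> norm2_on P f"
proof -
  have "\<forall>i\<in>I. \<forall>j\<in>I. inner_on P (r i) (r j) = inner_on Q (s i) (s j)" using assms(4) by blast
  from equal_Gram_contraction_aux[OF assms(1-3) this] show thesis
    by (elim exE conjE) (rule that, auto)
qed

section \<open>Positive semidefinite kernels\<close>

definition hermitian_on :: "'i set \<Rightarrow> ('i \<Rightarrow> 'i \<Rightarrow> complex) \<Rightarrow> bool" where
  "hermitian_on I A \<longleftrightarrow> (\<forall>i\<in>I. \<forall>j\<in>I. A j i = cnj (A i j))"

definition qform :: "'i set \<Rightarrow> ('i \<Rightarrow> 'i \<Rightarrow> complex) \<Rightarrow> ('i \<Rightarrow> complex) \<Rightarrow> real" where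
  "qform I A f = Re (inner_on I (kapply I A f) f)"

lemma qform_eq: "qform I A f = Re (\<Sum>i\<in>I. \<Sum>j\<in>I. A i j * f j * cnj (f i))"
  by (simp add: qform_def inner_on_def kapply_def sum_distrib_right)

lemma qform_cong: "(\<And>i. i \<in> I \<Longrightarrow> f i = g i) \<Longrightarrow> qform I A f = qform I A g"
  by (simp add: qform_eq)

text \<open>The value at \<open>x\<close> is split off as in a two by two block matrix; symmetry
  merges the off-diagonal terms into twice a real part.\<close>

lemma qform_insert:
  assumes "finite I" "x \<notin> I" and herm: "hermitian_on (insert x I) A"
  shows "qform (insert x I) A f =
    Re (A x x) * (cmod (f x))\<^sup>2 + 2 * Re (cnj (f x) * (\<Sum>j\<in>I. A x j * f j)) + qform I A f"
proof -
  have *: "(\<Sum>i\<in>I. A i x * f x * cnj (f i)) = cnj (cnj (f x) * (\<Sum>j\<in>I. A x j * f j))"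
  proof -
    have "A i x = cnj (A x i)" if "i \<in> I" for i using herm that unfolding hermitian_on_def by blast
    then show ?thesis
      unfolding complex_cnj_mult cnj_sum sum_distrib_left by (simp add: mult_ac)
  qed
  have "A x x = cnj (A x x)" using herm unfolding hermitian_on_def by blast
  then have "Im (A x x) = - Im (A x x)" by (metis cnj.sel(2))
  then have "Im (A x x) = 0" by simp
  then have **: "Re (A x x * f x * cnj (f x)) = Re (A x x) * (cmod (f x))\<^sup>2"
    by (subst cmod_power2) (simp add: power2_eq_square algebra_simps)
  have "qform (insert x I) A f = Re (A x x * f x * cnj (f x) + (\<Sum>j\<in>I. A x j * f j * cnj (f x))
      + (\<Sum>i\<in>I. A i x * f x * cnj (f i)) + (\<Sum>i\<in>I. \<Sum>j\<in>I. A i j * f j * cnj (f i)))"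
    using assms(1,2) by (simp add: qform_eq sum.distrib algebra_simps)
  also have "(\<Sum>j\<in>I. A x j * f j * cnj (f x)) = cnj (f x) * (\<Sum>j\<in>I. A x j * f j)"
    by (simp add: sum_distrib_left algebra_simps)
  finally show ?thesis
    unfolding * by (simp only: plus_complex.sel cnj.sel ** qform_eq mult_2 add.assoc)
qed

text \<open>Cholesky factorisation; the induction step passes to the Schur complement of the new index.\<close>

lemma psd_factorization:
  assumes "finite I" "hermitian_on I A" "\<And>f. 0 \<le> qform I A f"
  shows "\<exists>B. \<forall>i\<in>I. \<forall>j\<in>I. A i j = (\<Sum>k\<in>I. B i k * cnj (B j k))"
  using assms
proof (induction I arbitrary: A rule: finite_induct)
  case empty
  then show ?case by simp
next
  case (insert x I)
  note q = qform_insert[OF insert.hyps(1,2) insert.prems(1)]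
  have herm: "A j i = cnj (A i j)" if "i \<in> insert x I" "j \<in> insert x I" for i j
    using insert.prems(1) that unfolding hermitian_on_def by blast
  have Axx: "A x x = of_real (Re (A x x))" using herm[of x x] by (metis Reals_cnj_iff insertI1 of_real_Re)
  have Axx0: "0 \<le> Re (A x x)"
  proof -
    have "qform I A (\<lambda>i. if i = x then 1 else 0) = 0"
      unfolding qform_eq by (rule trans[OF arg_cong[where f = Re, of _ 0]])
        (auto intro!: sum.neutral simp: insert.hyps)
    moreover have "(\<Sum>j\<in>I. A x j * (if j = x then 1 else 0)) = 0"
      by (rule sum.neutral) (use insert.hyps in auto)
    ultimately show ?thesis using insert.prems(2)[of "\<lambda>i. if i = x then 1 else 0"] by (simp add: q)
  qed
  \<comment> \<open>Positivity for a function with prescribed value \<open>t\<close> at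
    \<open>x\<close>; both cases below work by choosing \<open>t\<close>.\<close>
  have shift: "0 \<le> Re (A x x) * (cmod t)\<^sup>2 + 2 * Re (cnj t * (\<Sum>j\<in>I. A x j * f j)) + qform I A f" for t f
  proof -
    have "qform I A (f(x := t)) = qform I A f" by (rule qform_cong) (use insert.hyps in auto)
    moreover have "(\<Sum>j\<in>I. A x j * (f(x := t)) j) = (\<Sum>j\<in>I. A x j * f j)"
      by (rule sum.cong) (use insert.hyps in auto)
    moreover have "0 \<le> Re (A x x) * (cmod ((f(x := t)) x))\<^sup>2
        + 2 * Re (cnj ((f(x := t)) x) * (\<Sum>j\<in>I. A x j * (f(x := t)) j)) + qform I A (f(x := t))"
      using insert.prems(2)[of "f(x := t)"] by (simp only: q)
    ultimately show ?thesis by (simp only: fun_upd_same)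
  qed
  show ?case
  proof (cases "Re (A x x) = 0")
    case True
    have Axj: "A x j = 0" if j: "j \<in> I" for j
    proof (rule ccontr)
      assume nz: "A x j \<noteq> 0"
      define f where "f = (\<lambda>i. if i = j then 1 else 0 :: complex)"
      have s: "(\<Sum>i\<in>I. A x i * f i) = A x j"
        using j insert.hyps by (simp add: f_def if_distrib[of "\<lambda>z. A x _ * z"] cong: if_cong)
      \<comment> \<open>Chosen so that the expression in \<open>shift\<close> becomes -1: without a
        diagonal term, a nonzero row entry makes it unbounded below.\<close>
      define r where "r = (qform I A f + 1) / (2 * (cmod (A x j))\<^sup>2)"
      have "Re (cnj (- of_real r * A x j) * A x j) = - r * (cmod (A x j))\<^sup>2"
        by (subst cmod_power2) (simp add: power2_eq_square algebra_simps)
      moreover have "2 * (r * (cmod (A x j))\<^sup>2) = qform I A f + 1" using nz by (simp add: r_def)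
      ultimately show False using shift[of "- of_real r * A x j" f] True by (simp add: s)
    qed
    have "\<And>f. 0 \<le> qform I A f" using shift[of 0] by simp
    moreover have "hermitian_on I A" using insert.prems(1) unfolding hermitian_on_def by blast
    ultimately obtain B where B: "\<And>i j. i \<in> I \<Longrightarrow> j \<in> I \<Longrightarrow> A i j = (\<Sum>k\<in>I. B i k * cnj (B j k))"
      using insert.IH by blast
    define B' where "B' = (\<lambda>i k. if i = x \<or> k = x then 0 else B i k)"
    have "A i j = (\<Sum>k\<in>insert x I. B' i k * cnj (B' j k))" if "i \<in> insert x I" "j \<in> insert x I" for i j
    proof (cases "i = x \<or> j = x")
      case True
      have "A i j = 0" using True Axj that herm Axx \<open>Re (A x x) = 0\<close>
        by (metis complex_cnj_zero_iff insert_iff of_real_0)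
      moreover have "(\<Sum>k\<in>insert x I. B' i k * cnj (B' j k)) = 0"
        using True by (intro sum.neutral) (auto simp: B'_def)
      ultimately show ?thesis by simp
    next
      case False
      then have "(\<Sum>k\<in>insert x I. B' i k * cnj (B' j k)) = (\<Sum>k\<in>I. B' i k * cnj (B' j k))"
        using insert.hyps by (simp add: B'_def)
      also have "\<dots> = (\<Sum>k\<in>I. B i k * cnj (B j k))"
        by (rule sum.cong) (use False insert.hyps in \<open>auto simp: B'_def\<close>)
      finally show ?thesis using B False that by auto
    qed
    then show ?thesis by blast
  next
    case False
    then have pos: "Re (A x x) > 0" using Axx0 by simp
    define c where "c = Re (A x x)"
    have c: "c > 0" using pos by (simp add: c_def)
    define A' where "A' = (\<lambda>i j. A i j - A i x * A x j / of_real c)"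
    have "A' j i = cnj (A' i j)" if "i \<in> I" "j \<in> I" for i j
      using herm[of i j] herm[of i x] herm[of x j] that by (simp add: A'_def mult.commute)
    then have "hermitian_on I A'" unfolding hermitian_on_def by blast
    moreover have "0 \<le> qform I A' f" for f
    proof -
      define s where "s = (\<Sum>j\<in>I. A x j * f j)"
      have cs: "(\<Sum>i\<in>I. A i x * cnj (f i)) = cnj s"
        unfolding s_def cnj_sum by (rule sum.cong) (simp_all add: herm[of x])
      have "(\<Sum>i\<in>I. \<Sum>j\<in>I. A' i j * f j * cnj (f i)) =
        (\<Sum>i\<in>I. \<Sum>j\<in>I. A i j * f j * cnj (f i)) - (\<Sum>i\<in>I. \<Sum>j\<in>I. (A i x * cnj (f i)) * (A x j * f j) / of_real c)"
        by (simp add: A'_def sum_subtractf[symmetric] algebra_simps)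
      also have "(\<Sum>i\<in>I. \<Sum>j\<in>I. (A i x * cnj (f i)) * (A x j * f j) / of_real c) = cnj s * s / of_real c"
        by (subst cs[symmetric], subst s_def) (simp add: sum_product sum_divide_distrib)
      finally have "qform I A' f = qform I A f - Re (cnj s * s / of_real c)" by (simp add: qform_eq)
      also have cnjs: "Re (cnj s * s / of_real c) = (cmod s)\<^sup>2 / c"
        by (subst cmod_power2) (simp add: power2_eq_square)
      finally have e: "qform I A' f = qform I A f - (cmod s)\<^sup>2 / c" .
      \<comment> \<open>\<open>t = - s / c\<close> minimises the quadratic in \<open>t\<close>, and
        the minimum is exactly the form of the Schur complement.\<close>
      have "0 \<le> c * (cmod (- s / of_real c))\<^sup>2 + 2 * Re (cnj (- s / of_real c) * s) + qform I A f"
        using shift[of "- s / of_real c" f] by (simp add: s_def c_def)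
      also have "Re (cnj (- s / of_real c) * s) = - ((cmod s)\<^sup>2 / c)"
        using cnjs by simp
      also have "c * (cmod (- s / of_real c))\<^sup>2 = (cmod s)\<^sup>2 / c"
        using c by (simp add: norm_divide power2_eq_square)
      finally show ?thesis using e by simp
    qed
    ultimately obtain B where B: "\<And>i j. i \<in> I \<Longrightarrow> j \<in> I \<Longrightarrow> A' i j = (\<Sum>k\<in>I. B i k * cnj (B j k))"
      using insert.IH[of A'] by blast
    \<comment> \<open>Column \<open>x\<close> reproduces the rank one part
      \<open>A i x * A x j / c\<close>; row \<open>x\<close> is zero outside it because the Schur
      complement has no such row.\<close>
    define B' where "B' = (\<lambda>i k. if k = x then A i x / of_real (sqrt c) else if i = x then 0 else B i k)"
    have "A i j = (\<Sum>k\<in>insert x I. B' i k * cnj (B' j k))" if ij: "i \<in> insert x I" "j \<in> insert x I" for i j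
    proof -
      have "cnj (A j x) = A x j" using herm[of j x] ij by simp
      then have "B' i x * cnj (B' j x) = A i x * A x j / of_real c"
        using c by (simp add: B'_def flip: of_real_mult)
      then have 1: "(\<Sum>k\<in>insert x I. B' i k * cnj (B' j k)) =
          A i x * A x j / of_real c + (\<Sum>k\<in>I. B' i k * cnj (B' j k))"
        using insert.hyps by simp
      show ?thesis
      proof (cases "i = x \<or> j = x")
        case True
        then have "(\<Sum>k\<in>I. B' i k * cnj (B' j k)) = 0"
          using insert.hyps by (intro sum.neutral) (auto simp: B'_def)
        moreover have "A i x * A x j / of_real c = A i j"
          using True c Axx by (auto simp: c_def)
        ultimately show ?thesis using 1 by simp
      next
        case False
        have "(\<Sum>k\<in>I. B' i k * cnj (B' j k)) = (\<Sum>k\<in>I. B i k * cnj (B j k))"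
          by (rule sum.cong) (use False insert.hyps in \<open>auto simp: B'_def\<close>)
        also have "\<dots> = A' i j" using B False ij by auto
        finally show ?thesis using 1 by (simp add: A'_def)
      qed
    qed
    then show ?thesis by blast
  qed
qed

text \<open>Tychonoff's theorem for a product of discs, as function types carry the product
  topology. It serves both for factors of kernels and for the coefficients of all words.\<close>

lemma compact_bounded_functions: "compact {f :: 'a \<Rightarrow> complex. \<forall>i. cmod (f i) \<le> b i}"
proof -
  have "compactin (product_topology (\<lambda>i::'a. euclidean) UNIV) (PiE UNIV (\<lambda>i. cball (0::complex) (b i)))"
    by (subst compactin_PiE) auto
  moreover have "PiE UNIV (\<lambda>i. cball (0::complex) (b i)) = {f :: 'a \<Rightarrow> complex. \<forall>i. cmod (f i) \<le> b i}"
    by (auto simp: PiE_def)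
  ultimately show ?thesis by (simp add: euclidean_product_topology)
qed

section \<open>The separation argument\<close>

definition psd_on :: "'i set \<Rightarrow> ('i \<Rightarrow> 'i \<Rightarrow> complex) \<Rightarrow> bool" where
  "psd_on I Q \<longleftrightarrow> hermitian_on I Q \<and> (\<forall>f. 0 \<le> qform I Q f)"

definition gram :: "'k set \<Rightarrow> ('i \<Rightarrow> 'k \<Rightarrow> complex) \<Rightarrow> 'i \<Rightarrow> 'i \<Rightarrow> complex" where
  "gram K B i j = (\<Sum>k\<in>K. B i k * cnj (B j k))"

lemma qform_gram: "qform I (gram K B) f = (\<Sum>k\<in>K. (cmod (\<Sum>i\<in>I. B i k * cnj (f i)))\<^sup>2)"
proof -
  have "(\<Sum>i\<in>I. \<Sum>j\<in>I. gram K B i j * f j * cnj (f i)) =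
      (\<Sum>k\<in>K. \<Sum>i\<in>I. \<Sum>j\<in>I. (B i k * cnj (f i)) * cnj (B j k * cnj (f j)))"
    unfolding gram_def sum_distrib_right
    by (subst sum.swap[of _ _ K], intro sum.cong[OF refl], subst sum.swap[of _ _ K]) (simp add: mult_ac)
  also have "\<dots> = (\<Sum>k\<in>K. of_real ((cmod (\<Sum>i\<in>I. B i k * cnj (f i)))\<^sup>2))"
    by (intro sum.cong refl) (simp only: complex_norm_square cnj_sum sum_product)
  finally show ?thesis by (simp add: qform_eq flip: of_real_sum)
qed

lemma psd_on_gram: "psd_on I (gram K B)"
proof -
  have "gram K B j i = cnj (gram K B i j)" for i j
    by (simp add: gram_def mult.commute)
  then show ?thesis unfolding psd_on_def hermitian_on_def by (blast intro: sum_nonneg ord_le_eq_trans[OF _ qform_gram[symmetric]] zero_le_power2)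
qed

lemma psd_on_imp_gram:
  assumes "finite I" "psd_on I Q"
  shows "\<exists>B. \<forall>i\<in>I. \<forall>j\<in>I. Q i j = gram I B i j"
  using psd_factorization[of I Q] assms by (simp add: psd_on_def gram_def)

lemma qform_add_scaled:
  "qform I (\<lambda>i j. Q i j + of_real t * Q' i j) f = qform I Q f + t * qform I Q' f"
proof -
  have "(\<Sum>i\<in>I. \<Sum>j\<in>I. (Q i j + of_real t * Q' i j) * f j * cnj (f i)) =
    (\<Sum>i\<in>I. \<Sum>j\<in>I. Q i j * f j * cnj (f i)) + of_real t * (\<Sum>i\<in>I. \<Sum>j\<in>I. Q' i j * f j * cnj (f i))"
    by (simp add: sum.distrib sum_distrib_left algebra_simps)
  then show ?thesis by (simp only: qform_eq plus_complex.sel Re_complex_of_real times_complex.sel Im_complex_of_real mult_zero_left diff_0_right)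
qed

lemma hermitian_on_add_scaled:
  "hermitian_on I Q \<Longrightarrow> hermitian_on I Q' \<Longrightarrow> hermitian_on I (\<lambda>i j. Q i j + of_real t * Q' i j)"
  unfolding hermitian_on_def by (metis complex_cnj_add complex_cnj_complex_of_real complex_cnj_mult)

lemma psd_on_add_scaled:
  "psd_on I Q \<Longrightarrow> psd_on I Q' \<Longrightarrow> 0 \<le> t \<Longrightarrow> psd_on I (\<lambda>i j. Q i j + of_real t * Q' i j)"
  by (simp add: psd_on_def hermitian_on_add_scaled qform_add_scaled)

text \<open>A pair \<open>(j, a)\<close> indexes coordinate \<open>a\<close> of block \<open>j\<close>. In terms of partial traces over the blocks,
  \<open>cone_map\<close> sends \<open>Q\<close> to \<open>tr Q - tr (D Q D\<^sup>*)\<close>; \<open>block_form\<close> is the form of \<open>1 \<otimes> G - D\<^sup>* (1 \<otimes> G) D\<close>,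
  to which \<open>G\<close> is sent by the adjoint map.\<close>

definition cone_map ::
  "nat \<Rightarrow> nat \<Rightarrow> (nat \<times> nat \<Rightarrow> nat \<times> nat \<Rightarrow> complex) \<Rightarrow> (nat \<times> nat \<Rightarrow> nat \<times> nat \<Rightarrow> complex) \<Rightarrow> nat \<times> nat \<Rightarrow> complex"
  where "cone_map S m D Q ab = (\<Sum>j<S. Q (j, fst ab) (j, snd ab)) -
    (\<Sum>i<S. \<Sum>p\<in>{..<S} \<times> {..<m}. \<Sum>p'\<in>{..<S} \<times> {..<m}. D (i, fst ab) p * Q p p' * cnj (D (i, snd ab) p'))"

definition block_form ::
  "nat \<Rightarrow> nat \<Rightarrow> (nat \<times> nat \<Rightarrow> nat \<times> nat \<Rightarrow> complex) \<Rightarrow> (nat \<Rightarrow> nat \<Rightarrow> complex) \<Rightarrow> (nat \<times> nat \<Rightarrow> complex) \<Rightarrow> real"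
  where "block_form S m D G u = (\<Sum>j<S. qform {..<m} G (\<lambda>a. u (j, a))) -
    (\<Sum>i<S. qform {..<m} G (\<lambda>a. kapply ({..<S} \<times> {..<m}) D u (i, a)))"

lemma cone_map_cong:
  assumes "\<And>p p'. p \<in> {..<S} \<times> {..<m} \<Longrightarrow> p' \<in> {..<S} \<times> {..<m} \<Longrightarrow> Q p p' = Q' p p'"
    and "ab \<in> {..<m} \<times> {..<m}"
  shows "cone_map S m D Q ab = cone_map S m D Q' ab"
proof -
  have "(\<Sum>j<S. Q (j, fst ab) (j, snd ab)) = (\<Sum>j<S. Q' (j, fst ab) (j, snd ab))"
    by (rule sum.cong) (use assms in auto)
  moreover have "(\<Sum>i<S. \<Sum>p\<in>{..<S} \<times> {..<m}. \<Sum>p'\<in>{..<S} \<times> {..<m}. D (i, fst ab) p * Q p p' * cnj (D (i, snd ab) p'))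
      = (\<Sum>i<S. \<Sum>p\<in>{..<S} \<times> {..<m}. \<Sum>p'\<in>{..<S} \<times> {..<m}. D (i, fst ab) p * Q' p p' * cnj (D (i, snd ab) p'))"
    by (intro sum.cong refl) (simp add: assms(1))
  ultimately show ?thesis by (simp add: cone_map_def)
qed

lemma cone_map_add_scaled:
  "cone_map S m D (\<lambda>p p'. Q p p' + c * Q' p p') ab = cone_map S m D Q ab + c * cone_map S m D Q' ab"
  by (simp add: cone_map_def sum.distrib sum_distrib_left algebra_simps)

lemma cone_map_sum:
  "cone_map S m D (\<lambda>p p'. \<Sum>k\<in>K. Q k p p') ab = (\<Sum>k\<in>K. cone_map S m D (Q k) ab)"
proof -
  have "(\<Sum>i<S. \<Sum>p\<in>{..<S} \<times> {..<m}. \<Sum>p'\<in>{..<S} \<times> {..<m}. D (i, fst ab) p * (\<Sum>k\<in>K. Q k p p') * cnj (D (i, snd ab) p'))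
    = (\<Sum>k\<in>K. \<Sum>i<S. \<Sum>p\<in>{..<S} \<times> {..<m}. \<Sum>p'\<in>{..<S} \<times> {..<m}. D (i, fst ab) p * Q k p p' * cnj (D (i, snd ab) p'))"
    unfolding sum_distrib_left sum_distrib_right
    by (subst sum.swap[of _ _ K], intro sum.cong[OF refl], subst sum.swap[of _ _ K], intro sum.cong[OF refl],
        subst sum.swap[of _ _ K]) (rule refl)
  moreover have "(\<Sum>j<S. \<Sum>k\<in>K. Q k (j, fst ab) (j, snd ab)) = (\<Sum>k\<in>K. \<Sum>j<S. Q k (j, fst ab) (j, snd ab))"
    by (rule sum.swap)
  ultimately show ?thesis by (simp add: cone_map_def sum_subtractf)
qed

lemma cone_map_rank_one:
  "cone_map S m D (\<lambda>p p'. u p * cnj (u p')) (a, b) = (\<Sum>j<S. u (j, a) * cnj (u (j, b))) -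
    (\<Sum>i<S. kapply ({..<S} \<times> {..<m}) D u (i, a) * cnj (kapply ({..<S} \<times> {..<m}) D u (i, b)))"
  unfolding cone_map_def kapply_def cnj_sum sum_product by (simp add: mult_ac)

lemma sum_norm2_on_rows: "(\<Sum>j<S. norm2_on {..<m} (\<lambda>a. u (j, a))) = norm2_on ({..<S} \<times> {..<m}) u"
  by (simp add: norm2_on_def sum.cartesian_product)

lemma inner_on_rank_one: "Re (inner_on ({..<m} \<times> {..<m}) G (\<lambda>ab. f (fst ab) * cnj (f (snd ab)))) = qform {..<m} (curry G) f"
  unfolding qform_eq inner_on_def sum.cartesian_product
  by (rule arg_cong[where f = Re], rule sum.cong) (auto simp: mult_ac)

text \<open>The adjoint relation between \<open>cone_map\<close> and \<open>block_form\<close>, on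
  the rank one kernels where the separation argument tests it.\<close>

lemma inner_on_cone_map_rank_one:
  "Re (inner_on ({..<m} \<times> {..<m}) G (cone_map S m D (\<lambda>p p'. u p * cnj (u p')))) = block_form S m D (curry G) u"
proof -
  have "cone_map S m D (\<lambda>p p'. u p * cnj (u p')) = (\<lambda>ab. (\<Sum>j<S. u (j, fst ab) * cnj (u (j, snd ab))) -
      (\<Sum>i<S. kapply ({..<S} \<times> {..<m}) D u (i, fst ab) * cnj (kapply ({..<S} \<times> {..<m}) D u (i, snd ab))))"
    using cone_map_rank_one[of S m D u] by (auto simp: fun_eq_iff)
  then have "inner_on ({..<m} \<times> {..<m}) G (cone_map S m D (\<lambda>p p'. u p * cnj (u p'))) =
     (\<Sum>j<S. inner_on ({..<m} \<times> {..<m}) G (\<lambda>ab. u (j, fst ab) * cnj (u (j, snd ab)))) -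
     (\<Sum>i<S. inner_on ({..<m} \<times> {..<m}) G (\<lambda>ab. kapply ({..<S} \<times> {..<m}) D u (i, fst ab) * cnj (kapply ({..<S} \<times> {..<m}) D u (i, snd ab))))"
    by (simp only: inner_on_diff_right inner_on_sum_right)
  then show ?thesis
    by (simp add: block_form_def inner_on_rank_one[where f = "\<lambda>a. u (_, a)"]
        inner_on_rank_one[where f = "\<lambda>a. kapply ({..<S} \<times> {..<m}) D u (_, a)"])
qed

text \<open>First-order condition: the one-sided derivative of the squared norm at
  \<open>t = 0\<close> is twice this real part. Only \<open>t\<close> in \<open>(0, 1]\<close> is
  used, since the segment has to stay in a cone.\<close>

lemma Re_inner_on_nonneg_of_minimal:
  assumes "\<And>t. 0 < t \<Longrightarrow> t \<le> 1 \<Longrightarrow> norm2_on I G \<le> norm2_on I (\<lambda>i. G i + of_real t * X i)"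
  shows "0 \<le> Re (inner_on I G X)"
proof (rule ccontr)
  define r where "r = Re (inner_on I G X)"
  define n where "n = norm2_on I X"
  assume "\<not> ?thesis"
  then have r: "r < 0" by (simp add: r_def)
  have n: "0 \<le> n" by (simp add: n_def norm2_on_nonneg)
  \<comment> \<open>Small enough that the quadratic term is at most \<open>- r\<close>, half the
    size of the linear term \<open>2 * r\<close>.\<close>
  define t where "t = min 1 (- r / (n + 1))"
  have t: "0 < t" "t \<le> 1" using r n by (auto simp: t_def divide_neg_pos)
  have "norm2_on I (\<lambda>i. G i + of_real t * X i) = norm2_on I G + 2 * t * r + t\<^sup>2 * n"
    using t by (simp add: norm2_on_add norm2_on_scale inner_on_scale_right r_def n_def)
  then have "0 \<le> t * (2 * r + t * n)" using assms[OF t] by (simp add: power2_eq_square algebra_simps)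
  then have 1: "0 \<le> 2 * r + t * n" using t by (simp add: zero_le_mult_iff)
  have "t * n \<le> - r / (n + 1) * n" using n by (intro mult_right_mono) (auto simp: t_def)
  also have "\<dots> = - r * (n / (n + 1))" by simp
  also have "\<dots> \<le> - r * 1" using r n by (intro mult_left_mono) auto
  finally show False using 1 r by simp
qed

text \<open>The trace completes the partial traces, so each column \<open>u\<close> of
  \<open>B\<close> contributes its squared norm minus that of \<open>D u\<close>. This bounds
  \<open>B\<close> by its image under the cone map, the coercivity behind closedness of the
  cone.\<close>

lemma trace_cone_map_gram:
  assumes contr: "\<And>u. norm2_on ({..<S} \<times> {..<m}) (kapply ({..<S} \<times> {..<m}) D u) \<le> q\<^sup>2 * norm2_on ({..<S} \<times> {..<m}) u"
  shows "(1 - q\<^sup>2) * (\<Sum>k\<in>K. norm2_on ({..<S} \<times> {..<m}) (\<lambda>p. B p k)) \<le> Re (\<Sum>a<m. cone_map S m D (gram K B) (a, a))"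
proof -
  let ?I = "{..<S} \<times> {..<m}"
  have sw: "(\<Sum>a<m. \<Sum>j<S. v (j, a) * cnj (v (j, a))) = of_real (norm2_on ?I v)" for v
    by (subst sum.swap) (simp add: norm2_on_def complex_norm_square[symmetric] sum.cartesian_product del: of_real_power)
  have "(\<Sum>a<m. cone_map S m D (gram K B) (a, a))
      = (\<Sum>k\<in>K. \<Sum>a<m. cone_map S m D (\<lambda>p p'. B p k * cnj (B p' k)) (a, a))"
    unfolding gram_def[abs_def] cone_map_sum by (rule sum.swap)
  also have "\<dots> = (\<Sum>k\<in>K. of_real (norm2_on ?I (\<lambda>p. B p k) - norm2_on ?I (kapply ?I D (\<lambda>p. B p k))))"
    by (rule sum.cong[OF refl])
      (simp only: cone_map_rank_one sum_subtractf of_real_diff sw[of "\<lambda>p. B p _"] sw[of "kapply ?I D _"])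
  finally have "Re (\<Sum>a<m. cone_map S m D (gram K B) (a, a)) =
      (\<Sum>k\<in>K. norm2_on ?I (\<lambda>p. B p k) - norm2_on ?I (kapply ?I D (\<lambda>p. B p k)))"
    by (simp flip: of_real_sum)
  also have "\<dots> \<ge> (\<Sum>k\<in>K. (1 - q\<^sup>2) * norm2_on ?I (\<lambda>p. B p k))"
    by (rule sum_mono) (use contr in \<open>simp add: left_diff_distrib\<close>)
  finally show ?thesis by (simp add: sum_distrib_left)
qed

text \<open>Minimising over factors \<open>B\<close> instead of kernels makes positivity automatic
  and leaves a continuous function; coercivity confines the search to a compact set.\<close>

lemma cone_map_nearest_point:
  assumes q: "0 \<le> q" "q < 1"
    and contr: "\<And>u. norm2_on ({..<S} \<times> {..<m}) (kapply ({..<S} \<times> {..<m}) D u) \<le> q\<^sup>2 * norm2_on ({..<S} \<times> {..<m}) u"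
  shows "\<exists>B. \<forall>Q. psd_on ({..<S} \<times> {..<m}) Q \<longrightarrow>
    norm2_on ({..<m} \<times> {..<m}) (\<lambda>ab. cone_map S m D (gram ({..<S} \<times> {..<m}) B) ab - R ab)
    \<le> norm2_on ({..<m} \<times> {..<m}) (\<lambda>ab. cone_map S m D Q ab - R ab)"
proof -
  let ?I = "{..<S} \<times> {..<m}" and ?M = "{..<m} \<times> {..<m}"
  define F where "F = (\<lambda>b. norm2_on ?M (\<lambda>ab. cone_map S m D (gram ?I (\<lambda>p k. b (p, k))) ab - R ab))"
  have cont: "continuous_on UNIV F"
    unfolding F_def norm2_on_def cone_map_def gram_def
    by (intro continuous_intros continuous_on_product_coordinates)
  define \<rho> where "\<rho> = sqrt (norm2_on ?M R)"
  \<comment> \<open>If \<open>b\<close> does no worse than 0, its image is within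
    \<open>\<rho>\<close> of \<open>R\<close>, so the image has norm at most
    \<open>2 * \<rho>\<close> and trace at most \<open>m\<close> times that; dividing by
    \<open>1 - q\<^sup>2\<close> bounds the entries of \<open>b\<close>.\<close>
  define Rad where "Rad = sqrt (real m * (2 * \<rho>) / (1 - q\<^sup>2))"
  have q2: "0 < 1 - q\<^sup>2" using q by (simp add: power2_eq_square) (metis mult_strict_mono' mult.left_neutral)
  have zero: "F (\<lambda>_. 0) = norm2_on ?M R"
    by (simp add: F_def norm2_on_def cone_map_def gram_def)
  have bound: "cmod (b (p, k)) \<le> Rad" if Fb: "F b \<le> F (\<lambda>_. 0)" and pk: "p \<in> ?I" "k \<in> ?I" for b p k
  proof -
    let ?B = "\<lambda>p k. b (p, k)" and ?L = "cone_map S m D (gram ?I (\<lambda>p k. b (p, k)))"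
    have "sqrt (norm2_on ?M ?L) = sqrt (norm2_on ?M (\<lambda>ab. (?L ab - R ab) + R ab))" by simp
    also have "\<dots> \<le> sqrt (F b) + \<rho>" unfolding F_def \<rho>_def by (rule sqrt_norm2_on_triangle)
    also have "sqrt (F b) \<le> \<rho>" using Fb by (simp add: zero \<rho>_def)
    finally have L: "sqrt (norm2_on ?M ?L) \<le> 2 * \<rho>" by simp
    have "(1 - q\<^sup>2) * (\<Sum>k\<in>?I. norm2_on ?I (\<lambda>p. ?B p k)) \<le> Re (\<Sum>a<m. ?L (a, a))"
      by (rule trace_cone_map_gram[OF contr])
    also have "\<dots> \<le> (\<Sum>a<m. cmod (?L (a, a)))"
      by (rule order_trans[OF complex_Re_le_cmod norm_sum])
    also have "\<dots> \<le> (\<Sum>a<m. 2 * \<rho>)"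
      by (rule sum_mono) (rule order_trans[OF cmod_le_sqrt_norm2_on L], auto)
    finally have "(\<Sum>k\<in>?I. norm2_on ?I (\<lambda>p. ?B p k)) \<le> real m * (2 * \<rho>) / (1 - q\<^sup>2)"
      using q2 by (simp add: field_simps)
    moreover have "norm2_on ?I (\<lambda>p. ?B p k) \<le> (\<Sum>k\<in>?I. norm2_on ?I (\<lambda>p. ?B p k))"
      by (rule member_le_sum) (use pk in \<open>auto simp: norm2_on_nonneg\<close>)
    moreover have "cmod (b (p, k)) \<le> sqrt (norm2_on ?I (\<lambda>p. ?B p k))"
      by (rule cmod_le_sqrt_norm2_on) (use pk in auto)
    ultimately show ?thesis unfolding Rad_def by (meson order_trans real_sqrt_le_mono)
  qed
  have "0 \<le> Rad" using q2 by (simp add: Rad_def \<rho>_def norm2_on_nonneg)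
  let ?K = "{b :: (nat \<times> nat) \<times> (nat \<times> nat) \<Rightarrow> complex. \<forall>i. cmod (b i) \<le> Rad}"
  have "compact ?K" by (rule compact_bounded_functions)
  moreover have 0: "(\<lambda>_. 0) \<in> ?K" using \<open>0 \<le> Rad\<close> by simp
  then have "?K \<noteq> {}" by (metis empty_iff)
  ultimately obtain b0 where b0: "b0 \<in> ?K" "\<And>b. b \<in> ?K \<Longrightarrow> F b0 \<le> F b"
    using continuous_attains_inf[of ?K F] continuous_on_subset[OF cont] by blast
  have min: "F b0 \<le> F b" for b
  proof (cases "F b \<le> F (\<lambda>_. 0)")
    case True
    \<comment> \<open>\<open>F\<close> does not see the entries outside the finite index set, so
      they are replaced by 0 to enter the compact set.\<close>
    define b' where "b' = (\<lambda>i. if i \<in> ?I \<times> ?I then b i else 0)"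
    have g: "gram ?I (\<lambda>p k. b' (p, k)) p p' = gram ?I (\<lambda>p k. b (p, k)) p p'" if "p \<in> ?I" "p' \<in> ?I" for p p'
      unfolding gram_def by (rule sum.cong) (use that in \<open>auto simp: b'_def\<close>)
    have "F b' = F b"
      unfolding F_def by (rule norm2_on_cong) (simp only: cone_map_cong[OF g])
    moreover have "b' \<in> ?K" using bound[OF True] \<open>0 \<le> Rad\<close> by (auto simp: b'_def)
    ultimately show ?thesis using b0(2) by metis
  next
    case False
    then show ?thesis using b0(2)[OF 0] by simp
  qed
  show ?thesis
  proof (intro exI allI impI)
    fix Q assume Q: "psd_on ?I Q"
    have "finite ?I" by simp
    from psd_on_imp_gram[OF this Q] obtain B where B: "\<forall>i\<in>?I. \<forall>j\<in>?I. Q i j = gram ?I B i j" ..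
    have "cone_map S m D Q ab = cone_map S m D (gram ?I B) ab" if "ab \<in> ?M" for ab
      by (rule cone_map_cong[OF _ that]) (use B in blast)
    then have "norm2_on ?M (\<lambda>ab. cone_map S m D Q ab - R ab) = F (\<lambda>(p, k). B p k)"
      unfolding F_def by (intro norm2_on_cong) (simp only: split_conv)
    then show "norm2_on ?M (\<lambda>ab. cone_map S m D (gram ?I (\<lambda>p k. b0 (p, k))) ab - R ab)
        \<le> norm2_on ?M (\<lambda>ab. cone_map S m D Q ab - R ab)"
      using min[of "\<lambda>(p, k). B p k"] by (simp add: F_def)
  qed
qed

text \<open>The residual of the nearest point of the cone is a separating functional; adding a small multiple
  of the identity makes its block form strictly positive.\<close>

lemma cone_map_onto:
  assumes q: "0 \<le> q" "q < 1"
    and contr: "\<And>u. norm2_on ({..<S} \<times> {..<m}) (kapply ({..<S} \<times> {..<m}) D u) \<le> q\<^sup>2 * norm2_on ({..<S} \<times> {..<m}) u"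
    and R: "hermitian_on {..<m} (curry R)"
    and dual: "\<And>G \<kappa>. hermitian_on {..<m} (curry G) \<Longrightarrow> 0 < \<kappa> \<Longrightarrow>
      (\<And>u. \<kappa> * norm2_on ({..<S} \<times> {..<m}) u \<le> block_form S m D (curry G) u) \<Longrightarrow>
      0 \<le> Re (inner_on ({..<m} \<times> {..<m}) G R)"
  shows "\<exists>B. \<forall>ab\<in>{..<m} \<times> {..<m}. cone_map S m D (gram ({..<S} \<times> {..<m}) B) ab = R ab"
proof -
  let ?I = "{..<S} \<times> {..<m}" and ?M = "{..<m} \<times> {..<m}"
  have q2: "0 < 1 - q\<^sup>2" using q by (simp add: power2_eq_square) (metis mult_strict_mono' mult.left_neutral)
  obtain B where B: "\<And>Q. psd_on ?I Q \<Longrightarrow>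
    norm2_on ?M (\<lambda>ab. cone_map S m D (gram ?I B) ab - R ab) \<le> norm2_on ?M (\<lambda>ab. cone_map S m D Q ab - R ab)"
    using cone_map_nearest_point[OF q contr] by blast
  define L where "L = cone_map S m D (gram ?I B)"
  define G where "G = (\<lambda>ab. L ab - R ab)"
  have posG: "0 \<le> Re (inner_on ?M G (cone_map S m D Q))" if Q: "psd_on ?I Q" for Q
  proof (rule Re_inner_on_nonneg_of_minimal)
    fix t :: real assume t: "0 < t"
    then have "psd_on ?I (\<lambda>p p'. gram ?I B p p' + of_real t * Q p p')"
      by (intro psd_on_add_scaled psd_on_gram Q) simp
    from B[OF this] show "norm2_on ?M G \<le> norm2_on ?M (\<lambda>ab. G ab + of_real t * cone_map S m D Q ab)"
      unfolding cone_map_add_scaled by (simp add: G_def L_def algebra_simps)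
  qed
  \<comment> \<open>For \<open>t \<le> 1\<close> the multiple \<open>1 - t\<close> of the nearest
    point stays in the cone, so moving from \<open>L\<close> towards 0 is admissible too.\<close>
  have negL: "0 \<le> Re (inner_on ?M G (\<lambda>ab. (-1) * L ab))"
  proof (rule Re_inner_on_nonneg_of_minimal)
    fix t :: real assume t: "0 < t" "t \<le> 1"
    have "psd_on ?I (\<lambda>_ _. of_real 0)"
      by (simp add: psd_on_def hermitian_on_def qform_eq)
    then have "psd_on ?I (\<lambda>p p'. of_real 0 + of_real (1 - t) * gram ?I B p p')"
      by (rule psd_on_add_scaled[OF _ psd_on_gram]) (use t in simp)
    moreover have "(\<lambda>p p'. of_real 0 + of_real (1 - t) * gram ?I B p p')
      = (\<lambda>p p'. gram ?I B p p' + of_real (- t) * gram ?I B p p')" by (simp add: algebra_simps)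
    ultimately have "psd_on ?I (\<lambda>p p'. gram ?I B p p' + of_real (- t) * gram ?I B p p')" by simp
    from B[OF this] show "norm2_on ?M G \<le> norm2_on ?M (\<lambda>ab. G ab + of_real t * ((-1) * L ab))"
      unfolding cone_map_add_scaled by (simp add: G_def L_def algebra_simps)
  qed
  have LR: "Re (inner_on ?M G R) \<le> - norm2_on ?M G"
  proof -
    have "inner_on ?M G R = inner_on ?M G (\<lambda>ab. L ab - G ab)" by (simp add: G_def)
    moreover have "Re (inner_on ?M G L) \<le> 0"
      using negL by (simp only: inner_on_scale_right) simp
    ultimately show ?thesis by (simp add: inner_on_linear inner_on_self)
  qed
  have "hermitian_on {..<m} (curry G)"
  proof -
    have "cone_map S m D (gram ?I B) (b, a) = cnj (cone_map S m D (gram ?I B) (a, b))" for a b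
      unfolding gram_def[abs_def] cone_map_sum cone_map_rank_one by (simp add: mult.commute)
    moreover have "R (b, a) = cnj (R (a, b))" if "a < m" "b < m" for a b
      using R that unfolding hermitian_on_def curry_def by (metis lessThan_iff)
    ultimately show ?thesis unfolding hermitian_on_def curry_def G_def L_def
      by (metis complex_cnj_diff lessThan_iff)
  qed
  have "norm2_on ?M G = 0"
  proof (rule ccontr)
    assume "norm2_on ?M G \<noteq> 0"
    then have n: "0 < norm2_on ?M G" using norm2_on_nonneg[of ?M G] by linarith
    define E where "E = (\<lambda>ab :: nat \<times> nat. if fst ab = snd ab then 1 else 0 :: complex)"
    define c where "c = cmod (inner_on ?M E R)"
    \<comment> \<open>Makes the perturbation \<open>\<epsilon> * c\<close> at most half of
      \<open>norm2_on ?M G\<close>, so the perturbed functional is still negative on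
      \<open>R\<close>.\<close>
    define \<epsilon> where "\<epsilon> = norm2_on ?M G / (2 * (c + 1))"
    have c: "0 \<le> c" by (simp add: c_def)
    then have \<epsilon>: "0 < \<epsilon>" using n by (simp add: \<epsilon>_def)
    define G' where "G' = (\<lambda>ab. G ab + of_real \<epsilon> * E ab)"
    have G': "curry G' = (\<lambda>a b. curry G a b + of_real \<epsilon> * curry E a b)" by (simp add: G'_def fun_eq_iff)
    have herm: "hermitian_on {..<m} (curry G')"
      unfolding G' by (rule hermitian_on_add_scaled) (fact, simp add: hermitian_on_def E_def)
    have qE: "qform {..<m} (curry E) f = norm2_on {..<m} f" for f
    proof -
      have "kapply {..<m} (curry E) f a = f a" if "a < m" for a
        using that by (simp add: kapply_def E_def if_distrib[of "\<lambda>z. z * _"] cong: if_cong)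
      then show ?thesis unfolding qform_def norm2_on_eq_Re_inner
        by (intro arg_cong[where f = Re] inner_on_cong) auto
    qed
    have "\<epsilon> * (1 - q\<^sup>2) * norm2_on ?I u \<le> block_form S m D (curry G') u" for u
    proof -
      have "psd_on ?I (\<lambda>p p'. u p * cnj (u p'))"
        using psd_on_gram[of ?I "{()}" "\<lambda>p _. u p"] by (simp add: gram_def[abs_def])
      then have 1: "0 \<le> block_form S m D (curry G) u"
        using posG by (simp flip: inner_on_cone_map_rank_one)
      have "block_form S m D (curry G') u = block_form S m D (curry G) u
          + \<epsilon> * (norm2_on ?I u - norm2_on ?I (kapply ?I D u))"
        unfolding G' block_form_def qform_add_scaled qE sum_norm2_on_rows[symmetric]
        by (simp add: curry_def sum.distrib sum_distrib_left algebra_simps)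
      also have "\<dots> \<ge> 0 + \<epsilon> * ((1 - q\<^sup>2) * norm2_on ?I u)"
        using 1 \<epsilon> contr[of u] by (intro add_mono mult_left_mono) (auto simp: left_diff_distrib)
      finally show ?thesis by simp
    qed
    then have "0 \<le> Re (inner_on ?M G' R)" using dual[OF herm, of "\<epsilon> * (1 - q\<^sup>2)"] \<epsilon> q2 by simp
    also have "\<dots> = Re (inner_on ?M G R) + \<epsilon> * Re (inner_on ?M E R)"
      by (simp add: G'_def inner_on_linear)
    also have "\<dots> \<le> - norm2_on ?M G + \<epsilon> * c"
      using LR \<epsilon> complex_Re_le_cmod[of "inner_on ?M E R"] by (intro add_mono mult_left_mono) (auto simp: c_def)
    also have "\<epsilon> * c = norm2_on ?M G * (c / (2 * (c + 1)))" by (simp add: \<epsilon>_def)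
    also have "\<dots> \<le> norm2_on ?M G * (1 / 2)" using n c by (intro mult_left_mono) (auto simp: field_simps)
    finally show False using n by simp
  qed
  then have "\<forall>ab\<in>?M. G ab = 0" by (subst (asm) norm2_on_eq_0_iff) auto
  then show ?thesis by (auto simp: G_def L_def)
qed

section \<open>Evaluation of free polynomials and operator norms\<close>

lemma level_eq: "x \<in> mat_tuples n \<Longrightarrow> level x = n"
  unfolding level_def mat_tuples_def by (rule the_equality) (auto, metis carrier_matD(1))

lemma mat_tuples_carrier: "x \<in> mat_tuples n \<Longrightarrow> x i \<in> carrier_mat n n"
  by (simp add: mat_tuples_def)

lemma word_eval_simps [simp]:
  "word_eval n x [] = 1\<^sub>m n" "word_eval n x (i # w) = x i * word_eval n x w"
  by (simp_all add: word_eval_def)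

lemma word_eval_carrier: "x \<in> mat_tuples n \<Longrightarrow> word_eval n x w \<in> carrier_mat n n"
  by (induction w) (auto intro: mult_carrier_mat mat_tuples_carrier)

lemma word_eval_append:
  assumes "x \<in> mat_tuples n"
  shows "word_eval n x (u @ v) = word_eval n x u * word_eval n x v"
proof (induction u)
  case Nil
  then show ?case using word_eval_carrier[OF assms, of v] by simp
next
  case (Cons i u)
  then show ?case
    using assoc_mult_mat[OF mat_tuples_carrier[OF assms, of i] word_eval_carrier[OF assms, of u] word_eval_carrier[OF assms, of v]]
    by simp
qed

lemma word_eval_intertwine:
  assumes x: "x \<in> mat_tuples n" and y: "y \<in> mat_tuples m" and \<alpha>: "\<alpha> \<in> carrier_mat m n"
    and int: "\<And>i. \<alpha> * x i = y i * \<alpha>"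
  shows "\<alpha> * word_eval n x w = word_eval m y w * \<alpha>"
proof (induction w)
  case Nil
  then show ?case using \<alpha> by simp
next
  case (Cons i w)
  note c = mat_tuples_carrier[OF x, of i] mat_tuples_carrier[OF y, of i] word_eval_carrier[OF x, of w]
    word_eval_carrier[OF y, of w]
  have "\<alpha> * (x i * word_eval n x w) = \<alpha> * x i * word_eval n x w"
    using \<alpha> c by (simp add: assoc_mult_mat[of _ m n _ n _ n])
  also have "\<dots> = y i * (\<alpha> * word_eval n x w)"
    unfolding int using \<alpha> c by (simp add: assoc_mult_mat[of _ m m _ n _ n])
  also have "\<dots> = y i * word_eval m y w * \<alpha>"
    unfolding Cons.IH using \<alpha> c by (simp add: assoc_mult_mat[of _ m m _ m _ n])
  finally show ?case by simp
qed

lemma free_eval_carrier: "x \<in> mat_tuples n \<Longrightarrow> free_eval p x \<in> carrier_mat n n"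
  by (simp add: free_eval_def level_eq Let_def)

lemma free_eval_index:
  assumes "x \<in> mat_tuples n" "a < n" "b < n"
  shows "free_eval p x $$ (a, b) = (\<Sum>w\<in>Poly_Mapping.keys p. Poly_Mapping.lookup p w * word_eval n x w $$ (a, b))"
  using assms by (simp add: free_eval_def level_eq Let_def)

lemma free_eval_index_superset:
  assumes "x \<in> mat_tuples n" "a < n" "b < n" "finite K" "Poly_Mapping.keys p \<subseteq> K"
  shows "free_eval p x $$ (a, b) = (\<Sum>w\<in>K. Poly_Mapping.lookup p w * word_eval n x w $$ (a, b))"
  unfolding free_eval_index[OF assms(1-3)]
  by (rule sum.mono_neutral_left) (use assms in \<open>auto simp: in_keys_iff\<close>)

lemma free_eval_zero_index:
  "x \<in> mat_tuples n \<Longrightarrow> a < n \<Longrightarrow> b < n \<Longrightarrow> free_eval 0 x $$ (a, b) = 0"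
  by (simp add: free_eval_index)

lemma free_eval_single_index:
  "x \<in> mat_tuples n \<Longrightarrow> a < n \<Longrightarrow> b < n \<Longrightarrow>
    free_eval (Poly_Mapping.single w c) x $$ (a, b) = c * word_eval n x w $$ (a, b)"
  by (subst free_eval_index_superset[where K = "{w}"]) auto

lemma free_eval_add_index:
  assumes "x \<in> mat_tuples n" "a < n" "b < n"
  shows "free_eval (p + q) x $$ (a, b) = free_eval p x $$ (a, b) + free_eval q x $$ (a, b)"
proof -
  let ?K = "Poly_Mapping.keys p \<union> Poly_Mapping.keys q"
  have "Poly_Mapping.keys (p + q) \<subseteq> ?K" by (rule keys_add)
  then show ?thesis
    using assms by (simp add: free_eval_index_superset[where K = ?K] lookup_add sum.distrib distrib_right)
qed

lemma free_eval_sum_index: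
  assumes "x \<in> mat_tuples n" "a < n" "b < n"
  shows "free_eval (\<Sum>k\<in>K. p k) x $$ (a, b) = (\<Sum>k\<in>K. free_eval (p k) x $$ (a, b))"
  by (induction K rule: infinite_finite_induct)
    (use assms in \<open>simp_all add: free_eval_zero_index free_eval_add_index\<close>)

lemma free_poly_induct [case_names zero single add]:
  assumes "P 0" "\<And>w c. P (Poly_Mapping.single w c)" "\<And>p q. P p \<Longrightarrow> P q \<Longrightarrow> P (p + q)"
  shows "P (p :: 'd free_poly)"
proof -
  have "P (\<Sum>w\<in>K. Poly_Mapping.single w (Poly_Mapping.lookup p w))" if "finite K" for K
    using that by induction (auto intro: assms)
  moreover have "(\<Sum>w\<in>Poly_Mapping.keys p. Poly_Mapping.single w (Poly_Mapping.lookup p w)) = p"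
    by (rule poly_mapping_eqI)
      (auto simp: lookup_sum lookup_single when_def in_keys_iff if_distrib cong: if_cong)
  ultimately show ?thesis by (metis finite_keys)
qed

text \<open>Both sides are additive in \<open>p\<close> and in \<open>q\<close>, so it is enough to
  compare monomials, whose product is concatenation of words.\<close>

lemma free_eval_mult_index:
  assumes x: "x \<in> mat_tuples n" and ab: "a < n" "b < n"
  shows "free_eval (p * q) x $$ (a, b) = (\<Sum>c<n. free_eval p x $$ (a, c) * free_eval q x $$ (c, b))"
proof (induction p rule: free_poly_induct)
  case zero
  then show ?case using x ab by (simp add: free_eval_zero_index)
next
  case (add p p')
  then show ?case using x ab by (simp add: distrib_right free_eval_add_index sum.distrib)
next
  case (single u k)
  show ?case
  proof (induction q rule: free_poly_induct)
    case zero
    then show ?case using x ab by (simp add: free_eval_zero_index)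
  next
    case (add p p')
    then show ?case using x ab by (simp add: distrib_left free_eval_add_index sum.distrib)
  next
    case (single v l)
    have "word_eval n x (u @ v) $$ (a, b) = (\<Sum>c<n. word_eval n x u $$ (a, c) * word_eval n x v $$ (c, b))"
      using word_eval_carrier[OF x, of u] word_eval_carrier[OF x, of v] ab
      by (simp add: word_eval_append[OF x] scalar_prod_def lessThan_atLeast0)
    then show ?case
      using x ab by (simp add: mult_single plus_list_def free_eval_single_index sum_distrib_left mult_ac)
  qed
qed

lemma free_eval_intertwine:
  assumes x: "x \<in> mat_tuples n" and y: "y \<in> mat_tuples m" and \<alpha>: "\<alpha> \<in> carrier_mat m n"
    and int: "\<And>i. \<alpha> * x i = y i * \<alpha>"
  shows "\<alpha> * free_eval p x = free_eval p y * \<alpha>"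
proof (rule eq_matI)
  note c = free_eval_carrier[OF x, of p] free_eval_carrier[OF y, of p]
  fix a b assume "a < dim_row (free_eval p y * \<alpha>)" "b < dim_col (free_eval p y * \<alpha>)"
  then have ab: "a < m" "b < n" using c \<alpha> by auto
  have w: "(\<Sum>k<n. \<alpha> $$ (a, k) * word_eval n x w $$ (k, b)) = (\<Sum>k<m. word_eval m y w $$ (a, k) * \<alpha> $$ (k, b))" for w
    using arg_cong[OF word_eval_intertwine[OF x y \<alpha> int, of w], of "\<lambda>A. A $$ (a, b)"]
      word_eval_carrier[OF x, of w] word_eval_carrier[OF y, of w] \<alpha> ab
    by (simp add: scalar_prod_def lessThan_atLeast0)
  let ?K = "Poly_Mapping.keys p"
  have "(\<alpha> * free_eval p x) $$ (a, b) = (\<Sum>k<n. \<alpha> $$ (a, k) * free_eval p x $$ (k, b))"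
    using c \<alpha> ab by (simp add: scalar_prod_def lessThan_atLeast0)
  also have "\<dots> = (\<Sum>w\<in>?K. Poly_Mapping.lookup p w * (\<Sum>k<n. \<alpha> $$ (a, k) * word_eval n x w $$ (k, b)))"
    using ab by (subst sum_distrib_left, subst sum.swap) (simp add: free_eval_index[OF x] sum_distrib_left mult_ac)
  also have "\<dots> = (\<Sum>k<m. free_eval p y $$ (a, k) * \<alpha> $$ (k, b))"
    unfolding w using ab
    by (subst sum_distrib_left, subst sum.swap) (simp add: free_eval_index[OF y] sum_distrib_right sum_distrib_left mult_ac)
  also have "\<dots> = (free_eval p y * \<alpha>) $$ (a, b)"
    using c \<alpha> ab by (simp add: scalar_prod_def lessThan_atLeast0)
  finally show "(\<alpha> * free_eval p x) $$ (a, b) = (free_eval p y * \<alpha>) $$ (a, b)" .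
qed (use free_eval_carrier[OF x, of p] free_eval_carrier[OF y, of p] \<alpha> in auto)

lemma nc_function_on_free_eval: "nc_function_on \<Omega> (free_eval p)"
  unfolding nc_function_on_def graded_on_def
  by (auto intro!: free_eval_intertwine free_eval_carrier)

section \<open>Vector and operator norms\<close>

lemma vec_norm2_eq: "vec_norm2 v = sqrt (norm2_on {..<dim_vec v} (\<lambda>i. v $ i))"
  by (simp add: vec_norm2_def sqrt_norm2_on)

lemma mult_mat_vec_index:
  assumes "A \<in> carrier_mat n m" "v \<in> carrier_vec m" "i < n"
  shows "(A *\<^sub>v v) $ i = kapply {..<m} (\<lambda>i j. A $$ (i, j)) (\<lambda>j. v $ j) i"
  using assms by (simp add: kapply_def scalar_prod_def lessThan_atLeast0)

text \<open>The supremum of reals is meaningful only for a bounded set; coordinates of a vector in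
  the unit ball are at most 1, so the sum of the moduli of all entries is a bound.\<close>

lemma bdd_above_op_norm:
  "bdd_above ((\<lambda>v. vec_norm2 (A *\<^sub>v v)) ` {v \<in> carrier_vec (dim_col A). vec_norm2 v \<le> 1})"
proof (rule bdd_aboveI2)
  fix v assume v: "v \<in> {v \<in> carrier_vec (dim_col A). vec_norm2 v \<le> 1}"
  have A: "A \<in> carrier_mat (dim_row A) (dim_col A)" by simp
  have vj: "cmod (v $ j) \<le> 1" if "j < dim_col A" for j
    using cmod_le_sqrt_norm2_on[of "{..<dim_vec v}" j "\<lambda>i. v $ i"] that v
    by (auto simp: vec_norm2_eq intro: order_trans)
  have "vec_norm2 (A *\<^sub>v v) \<le> (\<Sum>i<dim_row A. cmod ((A *\<^sub>v v) $ i))"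
    unfolding vec_norm2_def by (rule order_trans[OF L2_set_le_sum]) auto
  also have "\<dots> \<le> (\<Sum>i<dim_row A. \<Sum>j<dim_col A. cmod (A $$ (i, j)))"
  proof (rule sum_mono)
    fix i assume i: "i \<in> {..<dim_row A}"
    have "cmod ((A *\<^sub>v v) $ i) = cmod (\<Sum>j<dim_col A. A $$ (i, j) * v $ j)"
      using mult_mat_vec_index[OF A, of v i] v i by (simp add: kapply_def)
    also have "\<dots> \<le> (\<Sum>j<dim_col A. cmod (A $$ (i, j)) * 1)"
      by (rule order_trans[OF norm_sum], rule sum_mono) (auto simp: norm_mult intro!: mult_left_le vj)
    finally show "cmod ((A *\<^sub>v v) $ i) \<le> (\<Sum>j<dim_col A. cmod (A $$ (i, j)))" by simp
  qed
  finally show "vec_norm2 (A *\<^sub>v v) \<le> (\<Sum>i<dim_row A. \<Sum>j<dim_col A. cmod (A $$ (i, j)))" .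
qed

lemma vec_norm2_zero [simp]: "vec_norm2 (0\<^sub>v n) = 0"
  by (simp add: vec_norm2_eq norm2_on_def)

lemma vec_norm2_nonneg: "0 \<le> vec_norm2 v"
  by (simp add: vec_norm2_def)

lemma vec_norm2_smult: "vec_norm2 (c \<cdot>\<^sub>v v) = cmod c * vec_norm2 v"
  by (subst (1 2) vec_norm2_def, subst L2_set_right_distrib) (auto simp: norm_mult intro!: L2_set_cong)

lemma op_norm_nonneg: "0 \<le> op_norm A"
  unfolding op_norm_def
  by (rule cSUP_upper2[OF bdd_above_op_norm, of "0\<^sub>v (dim_col A)"]) (auto simp: vec_norm2_nonneg)

lemma vec_norm2_mult_le:
  assumes "v \<in> carrier_vec (dim_col A)"
  shows "vec_norm2 (A *\<^sub>v v) \<le> op_norm A * vec_norm2 v"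
proof (cases "vec_norm2 v = 0")
  case True
  then have "\<forall>i<dim_vec v. v $ i = 0"
    by (simp add: vec_norm2_eq norm2_on_eq_0_iff)
  then have "v = 0\<^sub>v (dim_col A)" using assms by (intro eq_vecI) auto
  then have "A *\<^sub>v v = 0\<^sub>v (dim_row A)" by (intro eq_vecI) (auto simp: scalar_prod_def)
  then show ?thesis using True by simp
next
  case False
  then have pos: "0 < vec_norm2 v" using vec_norm2_nonneg[of v] by simp
  define w where "w = of_real (1 / vec_norm2 v) \<cdot>\<^sub>v v"
  have w: "w \<in> carrier_vec (dim_col A)" "vec_norm2 w = 1"
    using assms pos by (auto simp: w_def vec_norm2_smult norm_divide)
  have "A *\<^sub>v w = of_real (1 / vec_norm2 v) \<cdot>\<^sub>v (A *\<^sub>v v)"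
    unfolding w_def by (rule mult_mat_vec[of _ "dim_row A" "dim_col A"]) (use assms in auto)
  then have "vec_norm2 (A *\<^sub>v v) / vec_norm2 v = vec_norm2 (A *\<^sub>v w)"
    using pos by (simp add: vec_norm2_smult norm_divide)
  also have "\<dots> \<le> op_norm A"
    unfolding op_norm_def by (rule cSUP_upper[OF _ bdd_above_op_norm]) (use w in auto)
  finally show ?thesis using pos by (simp add: field_simps)
qed

lemma op_norm_le:
  assumes "\<And>v. v \<in> carrier_vec (dim_col A) \<Longrightarrow> vec_norm2 (A *\<^sub>v v) \<le> c * vec_norm2 v" "0 \<le> c"
  shows "op_norm A \<le> c"
  unfolding op_norm_def
proof (rule cSUP_least)
  show "{v \<in> carrier_vec (dim_col A). vec_norm2 v \<le> 1} \<noteq> {}"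
    by (auto intro!: exI[of _ "0\<^sub>v (dim_col A)"])
  fix v assume v: "v \<in> {v \<in> carrier_vec (dim_col A). vec_norm2 v \<le> 1}"
  have "vec_norm2 (A *\<^sub>v v) \<le> c * vec_norm2 v" using assms(1) v by blast
  also have "\<dots> \<le> c * 1" using v assms(2) by (intro mult_left_mono) auto
  finally show "vec_norm2 (A *\<^sub>v v) \<le> c" by simp
qed

text \<open>Passage from the norm of the statement to squared norms of kernels acting on functions,
  the form used in the later estimates.\<close>

lemma op_norm_le_iff:
  assumes A: "A \<in> carrier_mat n m" and c: "0 \<le> c"
  shows "op_norm A \<le> c \<longleftrightarrow>
    (\<forall>f. norm2_on {..<n} (kapply {..<m} (\<lambda>i j. A $$ (i, j)) f) \<le> c\<^sup>2 * norm2_on {..<m} f)"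
proof -
  have v: "vec_norm2 (A *\<^sub>v v) \<le> c * vec_norm2 v \<longleftrightarrow>
      norm2_on {..<n} (kapply {..<m} (\<lambda>i j. A $$ (i, j)) (\<lambda>j. v $ j)) \<le> c\<^sup>2 * norm2_on {..<m} (\<lambda>j. v $ j)"
    if "v \<in> carrier_vec m" for v
  proof -
    have "vec_norm2 (A *\<^sub>v v) = sqrt (norm2_on {..<n} (kapply {..<m} (\<lambda>i j. A $$ (i, j)) (\<lambda>j. v $ j)))"
      unfolding vec_norm2_eq
      by (rule arg_cong[where f = sqrt]) (use A that mult_mat_vec_index[OF A that] in \<open>auto intro!: norm2_on_cong\<close>)
    moreover have "c * vec_norm2 v = sqrt (c\<^sup>2 * norm2_on {..<m} (\<lambda>j. v $ j))"
      using c that by (simp add: vec_norm2_eq real_sqrt_mult)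
    ultimately show ?thesis by simp
  qed
  show ?thesis
  proof
    assume le: "op_norm A \<le> c"
    show "\<forall>f. norm2_on {..<n} (kapply {..<m} (\<lambda>i j. A $$ (i, j)) f) \<le> c\<^sup>2 * norm2_on {..<m} f"
    proof
      fix f
      have "vec_norm2 (A *\<^sub>v Matrix.vec m f) \<le> op_norm A * vec_norm2 (Matrix.vec m f)"
        by (rule vec_norm2_mult_le) (use A in auto)
      also have "\<dots> \<le> c * vec_norm2 (Matrix.vec m f)" using le by (intro mult_right_mono vec_norm2_nonneg)
      finally have "norm2_on {..<n} (kapply {..<m} (\<lambda>i j. A $$ (i, j)) (\<lambda>j. Matrix.vec m f $ j))
          \<le> c\<^sup>2 * norm2_on {..<m} (\<lambda>j. Matrix.vec m f $ j)" by (subst (asm) v) auto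
      moreover have "norm2_on {..<m} (\<lambda>j. Matrix.vec m f $ j) = norm2_on {..<m} f" by (rule norm2_on_cong) auto
      moreover have "kapply {..<m} (\<lambda>i j. A $$ (i, j)) (\<lambda>j. Matrix.vec m f $ j) = kapply {..<m} (\<lambda>i j. A $$ (i, j)) f"
        by (rule ext, rule kapply_cong) auto
      ultimately show "norm2_on {..<n} (kapply {..<m} (\<lambda>i j. A $$ (i, j)) f) \<le> c\<^sup>2 * norm2_on {..<m} f" by simp
    qed
  next
    assume "\<forall>f. norm2_on {..<n} (kapply {..<m} (\<lambda>i j. A $$ (i, j)) f) \<le> c\<^sup>2 * norm2_on {..<m} f"
    then show "op_norm A \<le> c" using A v by (intro op_norm_le c) auto
  qed
qed

text \<open>Used to extract entrywise convergence from convergence in operator norm.\<close>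

lemma cmod_index_le_op_norm:
  assumes "A \<in> carrier_mat n m" "i < n" "j < m"
  shows "cmod (A $$ (i, j)) \<le> op_norm A"
proof -
  have "kapply {..<m} (\<lambda>i j. A $$ (i, j)) (\<lambda>k. if k = j then 1 else 0) i = A $$ (i, j)"
    using assms by (simp add: kapply_def if_distrib[of "\<lambda>z. _ * z"] cong: if_cong)
  then have "(cmod (A $$ (i, j)))\<^sup>2 \<le> norm2_on {..<n} (kapply {..<m} (\<lambda>i j. A $$ (i, j)) (\<lambda>k. if k = j then 1 else 0))"
    unfolding norm2_on_def by (metis (no_types, lifting) member_le_sum finite_lessThan lessThan_iff assms(2) zero_le_power2)
  also have "\<dots> \<le> (op_norm A)\<^sup>2 * norm2_on {..<m} (\<lambda>k. if k = j then 1 else 0)"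
    using op_norm_le_iff[OF assms(1) op_norm_nonneg[of A]] by blast
  also have "norm2_on {..<m} (\<lambda>k. if k = j then 1 else 0) = 1"
    using assms by (simp add: norm2_on_def if_distrib[of "\<lambda>z. (cmod z)\<^sup>2"] cong: if_cong)
  finally show ?thesis using op_norm_nonneg[of A] by (simp add: power2_le_iff_abs_le)
qed

text \<open>Block and coordinate are kept as a pair instead of the flat index of
  \<open>free_mat_eval\<close>, so that partial traces and direct sums act on one component
  only.\<close>

definition block_kernel :: "(nat \<Rightarrow> nat \<Rightarrow> 'd free_poly) \<Rightarrow> 'd mat_tuple \<Rightarrow> nat \<times> nat \<Rightarrow> nat \<times> nat \<Rightarrow> complex" where
  "block_kernel d x p p' = free_eval (d (fst p) (fst p')) x $$ (snd p, snd p')"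

definition block_contraction :: "nat \<Rightarrow> (nat \<Rightarrow> nat \<Rightarrow> 'd free_poly) \<Rightarrow> nat \<Rightarrow> 'd mat_tuple \<Rightarrow> real \<Rightarrow> bool" where
  "block_contraction S d n x q \<longleftrightarrow> (\<forall>u. norm2_on ({..<S} \<times> {..<n}) (kapply ({..<S} \<times> {..<n}) (block_kernel d x) u)
    \<le> q\<^sup>2 * norm2_on ({..<S} \<times> {..<n}) u)"

text \<open>Padding by zeros makes \<open>\<delta>\<close> square and nonempty without changing the ball.\<close>

definition padded :: "'d free_poly mat \<Rightarrow> nat \<Rightarrow> nat \<Rightarrow> 'd free_poly" where
  "padded \<delta> i j = (if i < dim_row \<delta> \<and> j < dim_col \<delta> then \<delta> $$ (i, j) else 0)"

lemma sum_blocks: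
  fixes n :: nat
  shows "(\<Sum>p\<in>{..<s} \<times> {..<n}. F (fst p * n + snd p)) = (\<Sum>k<s * n. F k)"
proof (rule sum.reindex_bij_witness[of _ "\<lambda>k. (k div n, k mod n)" "\<lambda>p. fst p * n + snd p"])
  fix p assume p: "p \<in> {..<s} \<times> {..<n}"
  then have "fst p * n + snd p < (fst p + 1) * n" by auto
  also have "\<dots> \<le> s * n" using p by (intro mult_right_mono) auto
  finally show "fst p * n + snd p \<in> {..<s * n}" by simp
  show "((fst p * n + snd p) div n, (fst p * n + snd p) mod n) = p" using p by auto
next
  fix k assume "k \<in> {..<s * n}"
  then show "(k div n, k mod n) \<in> {..<s} \<times> {..<n}"
    using less_mult_imp_div_less[of k s n] by (cases "n = 0") auto
qed auto

text \<open>Two changes of form: padding adds only zero rows and columns, and division with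
  remainder by \<open>n\<close> identifies a flat index with a pair. Vectors pass in both directions
  by restriction and by extension with 0.\<close>

lemma op_norm_free_mat_eval_le_iff:
  assumes x: "x \<in> mat_tuples n" and c: "0 \<le> c" and S: "dim_row \<delta> \<le> S" "dim_col \<delta> \<le> S"
  shows "op_norm (free_mat_eval \<delta> x) \<le> c \<longleftrightarrow> block_contraction S (padded \<delta>) n x c"
proof -
  define s where "s = dim_row \<delta>"
  define r where "r = dim_col \<delta>"
  let ?A = "free_mat_eval \<delta> x" and ?D = "block_kernel (padded \<delta>) x"
  have A: "?A \<in> carrier_mat (s * n) (r * n)"
    by (simp add: free_mat_eval_def level_eq[OF x] Let_def s_def r_def)
  have Aij: "?A $$ (fst p * n + snd p, fst p' * n + snd p') = ?D p p'"
    if "p \<in> {..<s} \<times> {..<n}" "p' \<in> {..<r} \<times> {..<n}" for p p'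
  proof -
    have "fst p * n + snd p < (fst p + 1) * n" "fst p' * n + snd p' < (fst p' + 1) * n" using that by auto
    moreover have "(fst p + 1) * n \<le> s * n" "(fst p' + 1) * n \<le> r * n"
      using that by (auto intro!: mult_right_mono simp del: mult_Suc)
    ultimately have "fst p * n + snd p < s * n" "fst p' * n + snd p' < r * n" by linarith+
    then show ?thesis using that
      by (auto simp: free_mat_eval_def level_eq[OF x] Let_def block_kernel_def padded_def s_def r_def)
  qed
  have rows: "kapply ({..<S} \<times> {..<n}) ?D u p = (if fst p < s then kapply ({..<r} \<times> {..<n}) ?D u p else 0)"
    if "p \<in> {..<S} \<times> {..<n}" for u p
  proof -
    have "kapply ({..<S} \<times> {..<n}) ?D u p = kapply ({..<r} \<times> {..<n}) ?D u p"
      unfolding kapply_def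
      by (rule sum.mono_neutral_right)
        (use S that in \<open>auto simp: block_kernel_def padded_def r_def free_eval_zero_index[OF x]\<close>)
    moreover have "kapply ({..<r} \<times> {..<n}) ?D u p = 0" if "\<not> fst p < s"
      unfolding kapply_def by (rule sum.neutral)
        (use that \<open>p \<in> _\<close> in \<open>auto simp: block_kernel_def padded_def s_def free_eval_zero_index[OF x]\<close>)
    ultimately show ?thesis by simp
  qed
  have big: "norm2_on ({..<S} \<times> {..<n}) (kapply ({..<S} \<times> {..<n}) ?D u)
      = norm2_on ({..<s} \<times> {..<n}) (kapply ({..<r} \<times> {..<n}) ?D u)" for u
  proof -
    have "norm2_on ({..<S} \<times> {..<n}) (kapply ({..<S} \<times> {..<n}) ?D u)
      = norm2_on ({..<S} \<times> {..<n}) (\<lambda>p. if fst p < s then kapply ({..<r} \<times> {..<n}) ?D u p else 0)"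
      by (rule norm2_on_cong) (rule rows)
    also have "\<dots> = norm2_on ({..<s} \<times> {..<n}) (kapply ({..<r} \<times> {..<n}) ?D u)"
      unfolding norm2_on_def by (rule sum.mono_neutral_cong_right) (use S in \<open>auto simp: s_def\<close>)
    finally show ?thesis .
  qed
  have flat: "norm2_on {..<s * n} (kapply {..<r * n} (\<lambda>i j. ?A $$ (i, j)) f)
      = norm2_on ({..<s} \<times> {..<n}) (kapply ({..<r} \<times> {..<n}) ?D (\<lambda>p. f (fst p * n + snd p)))" for f
    unfolding norm2_on_def sum_blocks[symmetric]
    by (rule sum.cong[OF refl]) (simp add: kapply_def sum_blocks[symmetric] Aij cong: sum.cong)
  have flat': "norm2_on {..<r * n} f = norm2_on ({..<r} \<times> {..<n}) (\<lambda>p. f (fst p * n + snd p))" for f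
    unfolding norm2_on_def sum_blocks[symmetric] ..
  show ?thesis
    unfolding op_norm_le_iff[OF A c] block_contraction_def big
  proof (intro iffI allI)
    fix u :: "nat \<times> nat \<Rightarrow> complex"
    assume *: "\<forall>f. norm2_on {..<s * n} (kapply {..<r * n} (\<lambda>i j. ?A $$ (i, j)) f) \<le> c\<^sup>2 * norm2_on {..<r * n} f"
    define f where "f = (\<lambda>k. u (k div n, k mod n))"
    have fu: "f (fst p * n + snd p) = u p" if "p \<in> {..<r} \<times> {..<n}" for p using that by (auto simp: f_def)
    have "norm2_on ({..<s} \<times> {..<n}) (kapply ({..<r} \<times> {..<n}) ?D u)
      = norm2_on ({..<s} \<times> {..<n}) (kapply ({..<r} \<times> {..<n}) ?D (\<lambda>p. f (fst p * n + snd p)))"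
      by (rule norm2_on_cong, rule kapply_cong) (simp only: fu)
    also have "\<dots> \<le> c\<^sup>2 * norm2_on ({..<r} \<times> {..<n}) (\<lambda>p. f (fst p * n + snd p))"
      using * unfolding flat flat' by blast
    also have "norm2_on ({..<r} \<times> {..<n}) (\<lambda>p. f (fst p * n + snd p)) = norm2_on ({..<r} \<times> {..<n}) u"
      by (rule norm2_on_cong) (rule fu)
    also have "norm2_on ({..<r} \<times> {..<n}) u \<le> norm2_on ({..<S} \<times> {..<n}) u"
      unfolding norm2_on_def by (rule sum_mono2) (use S in \<open>auto simp: r_def\<close>)
    finally show "norm2_on ({..<s} \<times> {..<n}) (kapply ({..<r} \<times> {..<n}) ?D u) \<le> c\<^sup>2 * norm2_on ({..<S} \<times> {..<n}) u"
      by (simp add: mult_left_mono)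
  next
    fix f :: "nat \<Rightarrow> complex"
    assume *: "\<forall>u. norm2_on ({..<s} \<times> {..<n}) (kapply ({..<r} \<times> {..<n}) ?D u) \<le> c\<^sup>2 * norm2_on ({..<S} \<times> {..<n}) u"
    define u where "u = (\<lambda>p. if fst p < r then f (fst p * n + snd p) else 0)"
    have "norm2_on ({..<s} \<times> {..<n}) (kapply ({..<r} \<times> {..<n}) ?D (\<lambda>p. f (fst p * n + snd p)))
      = norm2_on ({..<s} \<times> {..<n}) (kapply ({..<r} \<times> {..<n}) ?D u)"
      by (rule norm2_on_cong, rule kapply_cong) (auto simp: u_def)
    also have "\<dots> \<le> c\<^sup>2 * norm2_on ({..<S} \<times> {..<n}) u" using * by blast
    also have "norm2_on ({..<S} \<times> {..<n}) u = norm2_on ({..<r} \<times> {..<n}) (\<lambda>p. f (fst p * n + snd p))"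
      unfolding norm2_on_def by (rule sum.mono_neutral_cong_right) (use S in \<open>auto simp: u_def r_def\<close>)
    finally show "norm2_on {..<s * n} (kapply {..<r * n} (\<lambda>i j. ?A $$ (i, j)) f) \<le> c\<^sup>2 * norm2_on {..<r * n} f"
      unfolding flat flat' .
  qed
qed

section \<open>Power series of Herglotz type\<close>

definition poly_act :: "'d free_poly \<Rightarrow> 'd mat_tuple \<Rightarrow> nat \<Rightarrow> (nat \<Rightarrow> complex) \<Rightarrow> nat \<Rightarrow> complex" where
  "poly_act p x n = kapply {..<n} (\<lambda>a b. free_eval p x $$ (a, b))"

lemma poly_act_sum:
  assumes "x \<in> mat_tuples n" "a < n"
  shows "poly_act (\<Sum>k\<in>K. p k) x n v a = (\<Sum>k\<in>K. poly_act (p k) x n v a)"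
proof -
  have "poly_act (\<Sum>k\<in>K. p k) x n v a = (\<Sum>b<n. \<Sum>k\<in>K. free_eval (p k) x $$ (a, b) * v b)"
    using assms by (simp add: poly_act_def kapply_def free_eval_sum_index sum_distrib_right)
  also have "\<dots> = (\<Sum>k\<in>K. poly_act (p k) x n v a)"
    unfolding poly_act_def kapply_def by (rule sum.swap)
  finally show ?thesis .
qed

lemma poly_act_mult:
  assumes "x \<in> mat_tuples n" "a < n"
  shows "poly_act (p * q) x n v a = poly_act p x n (poly_act q x n v) a"
proof -
  have "poly_act (p * q) x n v a = (\<Sum>b<n. \<Sum>c<n. free_eval p x $$ (a, c) * free_eval q x $$ (c, b) * v b)"
    using assms by (simp add: poly_act_def kapply_def free_eval_mult_index sum_distrib_right)
  also have "\<dots> = (\<Sum>c<n. free_eval p x $$ (a, c) * (\<Sum>b<n. free_eval q x $$ (c, b) * v b))"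
    by (subst sum.swap) (simp add: sum_distrib_left mult_ac)
  finally show ?thesis by (simp add: poly_act_def kapply_def)
qed

lemma poly_act_const:
  assumes "x \<in> mat_tuples n" "a < n"
  shows "poly_act (Poly_Mapping.single 0 c) x n v a = c * v a"
proof -
  have "free_eval (Poly_Mapping.single 0 c) x $$ (a, b) = (if a = b then c else 0)" if "b < n" for b
    using assms that by (simp add: free_eval_single_index zero_list_def)
  then show ?thesis using assms
    by (simp add: poly_act_def kapply_def if_distrib[of "\<lambda>z. z * _"] cong: if_cong)
qed

lemma poly_act_one: "x \<in> mat_tuples n \<Longrightarrow> a < n \<Longrightarrow> poly_act 1 x n v a = v a"
  using poly_act_const[of x n a 1 v] by simp

lemma poly_act_cong: "(\<And>b. b < n \<Longrightarrow> v b = w b) \<Longrightarrow> poly_act p x n v a = poly_act p x n w a"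
  unfolding poly_act_def by (rule kapply_cong) simp

section \<open>Polynomials in the entries of a square matrix of free polynomials\<close>

definition words_of_length :: "nat \<Rightarrow> nat \<Rightarrow> (nat \<times> nat) list set" where
  "words_of_length S l = {w. set w \<subseteq> {..<S} \<times> {..<S} \<and> length w = l}"

text \<open>A letter is a position in the matrix \<open>d\<close>, not a variable, so a word stands
  for a product of entries and different words may give the same polynomial.\<close>

fun word_poly :: "(nat \<Rightarrow> nat \<Rightarrow> 'd free_poly) \<Rightarrow> (nat \<times> nat) list \<Rightarrow> 'd free_poly" where
  "word_poly d [] = 1"
| "word_poly d (e # w) = d (fst e) (snd e) * word_poly d w"

text \<open>Homogeneous in the entries of \<open>d\<close>, not in the variables.\<close>

definition hom_poly :: "nat \<Rightarrow> (nat \<Rightarrow> nat \<Rightarrow> 'd free_poly) \<Rightarrow> ((nat \<times> nat) list \<Rightarrow> complex) \<Rightarrow> nat \<Rightarrow> 'd free_poly" where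
  "hom_poly S d c l = (\<Sum>w\<in>words_of_length S l. Poly_Mapping.single 0 (c w) * word_poly d w)"

definition partial_poly :: "nat \<Rightarrow> (nat \<Rightarrow> nat \<Rightarrow> 'd free_poly) \<Rightarrow> ((nat \<times> nat) list \<Rightarrow> complex) \<Rightarrow> nat \<Rightarrow> 'd free_poly" where
  "partial_poly S d c M = (\<Sum>l<M. hom_poly S d c l)"

text \<open>The Cesaro mean of \<open>N\<close> partial sums; \<open>Suc M\<close> makes the
  constant term the first of them.\<close>

definition fejer_poly :: "nat \<Rightarrow> (nat \<Rightarrow> nat \<Rightarrow> 'd free_poly) \<Rightarrow> ((nat \<times> nat) list \<Rightarrow> complex) \<Rightarrow> nat \<Rightarrow> 'd free_poly" where
  "fejer_poly S d c N = Poly_Mapping.single 0 (1 / of_nat N) * (\<Sum>M<N. partial_poly S d c (Suc M))"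

lemma words_of_length_0: "words_of_length S 0 = {[]}"
  by (auto simp: words_of_length_def)

lemma sum_words_of_length_Suc:
  "(\<Sum>w\<in>words_of_length S (Suc l). F w) = (\<Sum>i<S. \<Sum>j<S. \<Sum>w\<in>words_of_length S l. F ((i, j) # w))"
proof -
  have "(\<Sum>w\<in>words_of_length S (Suc l). F w) = (\<Sum>(w, e)\<in>words_of_length S l \<times> ({..<S} \<times> {..<S}). F (e # w))"
    unfolding words_of_length_def lists_length_Suc_eq
    by (subst sum.reindex) (auto simp: inj_on_def intro!: sum.cong)
  also have "\<dots> = (\<Sum>w\<in>words_of_length S l. \<Sum>e\<in>{..<S} \<times> {..<S}. F (e # w))"
    by (simp add: sum.cartesian_product)
  also have "\<dots> = (\<Sum>e\<in>{..<S} \<times> {..<S}. \<Sum>w\<in>words_of_length S l. F (e # w))"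
    by (rule sum.swap)
  also have "\<dots> = (\<Sum>i<S. \<Sum>j<S. \<Sum>w\<in>words_of_length S l. F ((i, j) # w))"
    unfolding sum.cartesian_product[of "\<lambda>i j. \<Sum>w\<in>words_of_length S l. F ((i, j) # w)"]
    by (simp add: split_beta)
  finally show ?thesis .
qed

lemma poly_act_hom_poly:
  assumes "x \<in> mat_tuples n" "a < n"
  shows "poly_act (hom_poly S d c l) x n v a = (\<Sum>w\<in>words_of_length S l. c w * poly_act (word_poly d w) x n v a)"
  using assms by (simp add: hom_poly_def poly_act_sum poly_act_mult poly_act_const)

lemma poly_act_fejer_poly:
  assumes "x \<in> mat_tuples n" "a < n"
  shows "poly_act (fejer_poly S d c N) x n v a = 1 / of_nat N * (\<Sum>M<N. poly_act (partial_poly S d c (Suc M)) x n v a)"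
  using assms by (simp add: fejer_poly_def poly_act_sum poly_act_mult poly_act_const)

text \<open>Let \<open>s M\<close> be the sum of \<open>T ^ l U\<close> over \<open>l < M\<close>.
  Then \<open>s (Suc M) = U + T (s M)\<close>, so the inner sum has real part
  \<open>|s (Suc M)|^2 - |T (s M)|^2\<close>. Contractivity makes this at least the increment of
  \<open>|s M|^2\<close>, and summing over \<open>M\<close> lets the increments telescope to
  \<open>|s N|^2\<close>.\<close>

lemma fejer_sum_nonneg:
  fixes T :: "('i \<Rightarrow> complex) \<Rightarrow> 'i \<Rightarrow> complex"
  assumes add: "\<And>f g. T (\<lambda>i. f i + g i) = (\<lambda>i. T f i + T g i)"
    and zero: "T (\<lambda>i. 0) = (\<lambda>i. 0)"
    and contr: "\<And>f. norm2_on J (T f) \<le> norm2_on J f"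
  shows "0 \<le> Re (\<Sum>M<N. \<Sum>l<Suc M. (if l = 0 then 1 else 2) * inner_on J ((T ^^ l) U) U)"
proof -
  define s where "s = (\<lambda>M i. \<Sum>l<M. (T ^^ l) U i)"
  have Tsum: "T (\<lambda>i. \<Sum>l<M. f l i) = (\<lambda>i. \<Sum>l<M. T (f l) i)" for M and f :: "nat \<Rightarrow> 'i \<Rightarrow> complex"
    by (induction M) (simp_all add: zero add)
  have s_Suc: "s (Suc M) = (\<lambda>i. U i + T (s M) i)" for M
    unfolding s_def Tsum by (simp add: sum.lessThan_Suc_shift del: sum.lessThan_Suc)
  have D: "Re (\<Sum>l<Suc M. (if l = 0 then 1 else 2) * inner_on J ((T ^^ l) U) U)
      \<ge> norm2_on J (s (Suc M)) - norm2_on J (s M)" for M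
  proof -
    have "(\<Sum>l<Suc M. (if l = 0 then 1 else 2) * inner_on J ((T ^^ l) U) U)
        = inner_on J U U + 2 * (\<Sum>l<M. inner_on J ((T ^^ Suc l) U) U)"
      by (simp add: sum.lessThan_Suc_shift sum_distrib_left del: sum.lessThan_Suc)
    also have "(\<Sum>l<M. inner_on J ((T ^^ Suc l) U) U) = inner_on J (T (s M)) U"
      unfolding s_def Tsum by (simp add: inner_on_sum_left)
    finally have "Re (\<Sum>l<Suc M. (if l = 0 then 1 else 2) * inner_on J ((T ^^ l) U) U)
        = norm2_on J U + 2 * Re (inner_on J (T (s M)) U)"
      by (simp add: norm2_on_eq_Re_inner)
    also have "Re (inner_on J (T (s M)) U) = Re (inner_on J U (T (s M)))"
      using inner_on_commute[of J U "T (s M)"] by simp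
    also have "norm2_on J U + 2 * Re (inner_on J U (T (s M))) = norm2_on J (s (Suc M)) - norm2_on J (T (s M))"
      by (simp add: s_Suc norm2_on_add)
    finally show ?thesis using contr[of "s M"] by simp
  qed
  have "norm2_on J (s N) \<le> Re (\<Sum>M<N. \<Sum>l<Suc M. (if l = 0 then 1 else 2) * inner_on J ((T ^^ l) U) U)"
  proof (induction N)
    case 0
    then show ?case by (simp add: s_def norm2_on_def)
  next
    case (Suc N)
    then show ?case using D[of N] by (simp del: sum.lessThan_Suc add: sum.lessThan_Suc[of _ N])
  qed
  then show ?thesis using norm2_on_nonneg[of J "s N"] by linarith
qed

section \<open>Herglotz series realised by a contraction \<open>W\<close> and a unit vector
  \<open>\<nu>\<close>\<close>

context
  fixes K :: "'k set" and S :: nat and W :: "'k \<times> nat \<Rightarrow> 'k \<times> nat \<Rightarrow> complex" and \<nu> :: "'k \<times> nat \<Rightarrow> complex"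
  assumes finK: "finite K"
    and W_contr: "\<And>f. norm2_on (K \<times> {..<S}) (kapply (K \<times> {..<S}) W f) \<le> norm2_on (K \<times> {..<S}) f"
    and \<nu>_unit: "norm2_on (K \<times> {..<S}) \<nu> = 1"
begin

text \<open>Coefficient vector of a word in a power of \<open>W \<delta>\<close> applied to
  \<open>\<nu>\<close>: a letter \<open>(i, j)\<close> moves block \<open>j\<close> to block
  \<open>i\<close>, after which \<open>W\<close> acts.\<close>

fun transfer_coeff :: "(nat \<times> nat) list \<Rightarrow> 'k \<times> nat \<Rightarrow> complex" where
  "transfer_coeff [] = \<nu>"
| "transfer_coeff (e # w) = (\<lambda>p. \<Sum>k\<in>K. W p (k, fst e) * transfer_coeff w (k, snd e))"

text \<open>Coefficients of \<open>(1 + Z) / (1 - Z) = 1 + 2 Z + 2 Z^2 + ...\<close> with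
  \<open>Z = W \<delta>\<close>, paired with \<open>\<nu>\<close>; hence the factor 2 beyond the
  empty word. Words with letters outside the matrix get 0 so that one bound holds on the whole
  type.\<close>

definition herglotz_coeff :: "(nat \<times> nat) list \<Rightarrow> complex" where
  "herglotz_coeff w = (if set w \<subseteq> {..<S} \<times> {..<S}
     then (if w = [] then 1 else 2) * inner_on (K \<times> {..<S}) (transfer_coeff w) \<nu> else 0)"

text \<open>This is \<open>W \<delta>(x)\<close>: \<open>\<delta>(x)\<close> acts on the block and
  the coordinate, \<open>W\<close> on \<open>K\<close> and the block.\<close>

definition transfer_op :: "(nat \<Rightarrow> nat \<Rightarrow> 'd free_poly) \<Rightarrow> 'd mat_tuple \<Rightarrow> nat
    \<Rightarrow> (('k \<times> nat) \<times> nat \<Rightarrow> complex) \<Rightarrow> ('k \<times> nat) \<times> nat \<Rightarrow> complex" where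
  "transfer_op d x n U pa = (\<Sum>p'\<in>K \<times> {..<S}. W (fst pa) p' *
     kapply ({..<S} \<times> {..<n}) (block_kernel d x) (\<lambda>jb. U ((fst p', fst jb), snd jb)) (snd p', snd pa))"

text \<open>A letter moves one block to another position and discards the remaining blocks, which
  cannot increase the norm; then the contraction \<open>W\<close> is applied.\<close>

lemma norm2_transfer_coeff:
  "set w \<subseteq> {..<S} \<times> {..<S} \<Longrightarrow> norm2_on (K \<times> {..<S}) (transfer_coeff w) \<le> 1"
proof (induction w)
  case Nil
  then show ?case by (simp add: \<nu>_unit)
next
  case (Cons e w)
  define f where "f = (\<lambda>p. if snd p = fst e then transfer_coeff w (fst p, snd e) else 0)"
  have e: "fst e < S" "snd e < S" using Cons.prems by auto
  have "kapply (K \<times> {..<S}) W f p = transfer_coeff (e # w) p" for p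
  proof -
    have "kapply (K \<times> {..<S}) W f p = (\<Sum>k\<in>K. \<Sum>i<S. if i = fst e then W p (k, i) * transfer_coeff w (k, snd e) else 0)"
      unfolding kapply_def sum.cartesian_product by (rule sum.cong) (auto simp: f_def)
    then show ?thesis using e by simp
  qed
  then have "transfer_coeff (e # w) = kapply (K \<times> {..<S}) W f" by (intro ext) simp
  then have "norm2_on (K \<times> {..<S}) (transfer_coeff (e # w)) \<le> norm2_on (K \<times> {..<S}) f"
    using W_contr by simp
  also have "norm2_on (K \<times> {..<S}) f = (\<Sum>k\<in>K. \<Sum>i<S. if i = fst e then (cmod (transfer_coeff w (k, snd e)))\<^sup>2 else 0)"
    unfolding norm2_on_def sum.cartesian_product by (rule sum.cong) (auto simp: f_def)
  also have "\<dots> = (\<Sum>k\<in>K. (cmod (transfer_coeff w (k, snd e)))\<^sup>2)" using e by simp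
  also have "\<dots> \<le> (\<Sum>k\<in>K. \<Sum>j<S. (cmod (transfer_coeff w (k, j)))\<^sup>2)"
    by (rule sum_mono, rule member_le_sum) (use e in auto)
  also have "\<dots> = norm2_on (K \<times> {..<S}) (transfer_coeff w)"
    by (simp add: norm2_on_def sum.cartesian_product split_beta)
  also have "\<dots> \<le> 1" using Cons by simp
  finally show ?case .
qed

lemma cmod_herglotz_coeff: "cmod (herglotz_coeff w) \<le> 2"
proof (cases "set w \<subseteq> {..<S} \<times> {..<S}")
  case True
  have "cmod (inner_on (K \<times> {..<S}) (transfer_coeff w) \<nu>) \<le> sqrt (norm2_on (K \<times> {..<S}) (transfer_coeff w)) * 1"
    using inner_on_Cauchy_Schwarz[of "K \<times> {..<S}" "transfer_coeff w" \<nu>] by (simp add: \<nu>_unit)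
  also have "\<dots> \<le> 1" using norm2_transfer_coeff[OF True] by simp
  finally show ?thesis using True by (cases "w = []") (auto simp: herglotz_coeff_def norm_mult)
qed (simp add: herglotz_coeff_def)

lemma herglotz_coeff_Nil: "herglotz_coeff [] = 1"
  by (simp add: herglotz_coeff_def inner_on_self \<nu>_unit)

lemma transfer_op_add: "transfer_op d x n (\<lambda>i. f i + g i) = (\<lambda>i. transfer_op d x n f i + transfer_op d x n g i)"
  by (rule ext) (simp add: transfer_op_def kapply_add distrib_left sum.distrib)

lemma transfer_op_zero: "transfer_op d x n (\<lambda>i. 0) = (\<lambda>i. 0)"
  by (rule ext) (simp add: transfer_op_def kapply_def)

lemma norm2_on_triple:
  "norm2_on ((K \<times> {..<S}) \<times> {..<n}) U = (\<Sum>k\<in>K. norm2_on ({..<S} \<times> {..<n}) (\<lambda>jb. U ((k, fst jb), snd jb)))"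
  unfolding norm2_on_def sum.cartesian_product
  by (rule sum.reindex_bij_witness[of _ "\<lambda>(k, j, b). ((k, j), b)" "\<lambda>((k, j), b). (k, j, b)"]) auto

lemma norm2_on_pairs:
  "norm2_on (P \<times> {..<n}) U = (\<Sum>a<n. norm2_on P (\<lambda>p. U (p, a)))" for P :: "'p set"
  unfolding norm2_on_def sum.cartesian_product
  by (rule sum.reindex_bij_witness[of _ "\<lambda>(a, p). (p, a)" "\<lambda>(p, a). (a, p)"]) auto

text \<open>The norm is sliced in two ways: by the coordinate, where \<open>W\<close> acts on each
  slice, and by the index in \<open>K\<close>, where \<open>\<delta>(x)\<close> does.\<close>

lemma norm2_transfer_op:
  assumes "block_contraction S d n x q"
  shows "norm2_on ((K \<times> {..<S}) \<times> {..<n}) (transfer_op d x n U) \<le> q\<^sup>2 * norm2_on ((K \<times> {..<S}) \<times> {..<n}) U"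
proof -
  let ?P = "K \<times> {..<S}"
  define V where "V = (\<lambda>pa. kapply ({..<S} \<times> {..<n}) (block_kernel d x)
      (\<lambda>jb. U ((fst (fst pa), fst jb), snd jb)) (snd (fst pa), snd pa))"
  have "transfer_op d x n U (p, a) = kapply ?P W (\<lambda>p'. V (p', a)) p" for p a
    by (simp add: transfer_op_def kapply_def[of ?P] V_def)
  then have "norm2_on (?P \<times> {..<n}) (transfer_op d x n U) = (\<Sum>a<n. norm2_on ?P (kapply ?P W (\<lambda>p'. V (p', a))))"
    by (simp add: norm2_on_pairs)
  also have "\<dots> \<le> (\<Sum>a<n. norm2_on ?P (\<lambda>p'. V (p', a)))" by (rule sum_mono) (rule W_contr)
  also have "\<dots> = norm2_on (?P \<times> {..<n}) V" by (simp add: norm2_on_pairs)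
  also have "\<dots> = (\<Sum>k\<in>K. norm2_on ({..<S} \<times> {..<n}) (kapply ({..<S} \<times> {..<n}) (block_kernel d x) (\<lambda>jb. U ((k, fst jb), snd jb))))"
    by (simp add: norm2_on_triple V_def)
  also have "\<dots> \<le> (\<Sum>k\<in>K. q\<^sup>2 * norm2_on ({..<S} \<times> {..<n}) (\<lambda>jb. U ((k, fst jb), snd jb)))"
    by (rule sum_mono) (use assms in \<open>simp add: block_contraction_def\<close>)
  also have "\<dots> = q\<^sup>2 * norm2_on (?P \<times> {..<n}) U"
    by (simp add: norm2_on_triple sum_distrib_left)
  finally show ?thesis .
qed

lemma norm2_transfer_op_power:
  assumes "block_contraction S d n x q"
  shows "norm2_on ((K \<times> {..<S}) \<times> {..<n}) ((transfer_op d x n ^^ l) U) \<le> (q ^ l)\<^sup>2 * norm2_on ((K \<times> {..<S}) \<times> {..<n}) U"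
proof (induction l)
  case (Suc l)
  have "norm2_on ((K \<times> {..<S}) \<times> {..<n}) ((transfer_op d x n ^^ Suc l) U)
     \<le> q\<^sup>2 * norm2_on ((K \<times> {..<S}) \<times> {..<n}) ((transfer_op d x n ^^ l) U)"
    by (simp add: norm2_transfer_op[OF assms])
  also have "\<dots> \<le> q\<^sup>2 * ((q ^ l)\<^sup>2 * norm2_on ((K \<times> {..<S}) \<times> {..<n}) U)"
    by (rule mult_left_mono[OF Suc.IH]) simp
  finally show ?case by (simp add: power_mult_distrib mult_ac)
qed simp

text \<open>Bridge between powers of the operator, which carry the norm estimates at
  \<open>x\<close>, and words, whose coefficients do not depend on \<open>x\<close>.\<close>

lemma transfer_op_power_expansion:
  assumes x: "x \<in> mat_tuples n"
  shows "p \<in> K \<times> {..<S} \<Longrightarrow> a < n \<Longrightarrow> (transfer_op d x n ^^ l) (\<lambda>pa. \<nu> (fst pa) * v (snd pa)) (p, a) =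
    (\<Sum>w\<in>words_of_length S l. transfer_coeff w p * poly_act (word_poly d w) x n v a)"
proof (induction l arbitrary: p a)
  case 0
  then show ?case by (simp add: words_of_length_0 poly_act_one[OF x])
next
  case (Suc l)
  let ?U = "(transfer_op d x n ^^ l) (\<lambda>pa. \<nu> (fst pa) * v (snd pa))"
  have "(transfer_op d x n ^^ Suc l) (\<lambda>pa. \<nu> (fst pa) * v (snd pa)) (p, a) =
    (\<Sum>k\<in>K. \<Sum>i<S. W p (k, i) * (\<Sum>j<S. \<Sum>b<n. free_eval (d i j) x $$ (a, b) * ?U ((k, j), b)))"
    by (simp add: transfer_op_def kapply_def block_kernel_def sum.cartesian_product split_beta)
  also have "\<dots> = (\<Sum>k\<in>K. \<Sum>i<S. \<Sum>j<S. \<Sum>b<n. \<Sum>w\<in>words_of_length S l. W p (k, i) * transfer_coeff w (k, j)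
      * (free_eval (d i j) x $$ (a, b) * poly_act (word_poly d w) x n v b))"
    by (intro sum.cong refl) (simp add: Suc.IH sum_distrib_left mult_ac)
  also have "\<dots> = (\<Sum>i<S. \<Sum>j<S. \<Sum>w\<in>words_of_length S l. \<Sum>k\<in>K. \<Sum>b<n. W p (k, i) * transfer_coeff w (k, j)
      * (free_eval (d i j) x $$ (a, b) * poly_act (word_poly d w) x n v b))"
    by (subst sum.swap[of _ "{..<S}" K], intro sum.cong[OF refl], subst sum.swap[of _ "{..<S}" K],
        intro sum.cong[OF refl], subst (2) sum.swap, intro sum.cong[OF refl], rule sum.swap)
  also have "\<dots> = (\<Sum>i<S. \<Sum>j<S. \<Sum>w\<in>words_of_length S l.
      transfer_coeff ((i, j) # w) p * poly_act (word_poly d ((i, j) # w)) x n v a)"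
    using Suc.prems by (simp add: poly_act_mult[OF x] poly_act_def[of "d _ _"] kapply_def sum_product)
  finally show ?case by (simp add: sum_words_of_length_Suc)
qed

lemma poly_act_hom_poly_herglotz:
  assumes x: "x \<in> mat_tuples n" and a: "a < n"
  shows "poly_act (hom_poly S d herglotz_coeff l) x n v a =
    (if l = 0 then 1 else 2) * (\<Sum>p\<in>K \<times> {..<S}. (transfer_op d x n ^^ l) (\<lambda>pa. \<nu> (fst pa) * v (snd pa)) (p, a) * cnj (\<nu> p))"
proof -
  have "poly_act (hom_poly S d herglotz_coeff l) x n v a =
    (\<Sum>w\<in>words_of_length S l. (if l = 0 then 1 else 2) * (\<Sum>p\<in>K \<times> {..<S}. transfer_coeff w p * cnj (\<nu> p)) * poly_act (word_poly d w) x n v a)"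
    unfolding poly_act_hom_poly[OF assms]
    by (rule sum.cong) (auto simp: herglotz_coeff_def words_of_length_def inner_on_def)
  also have "\<dots> = (if l = 0 then 1 else 2) * (\<Sum>p\<in>K \<times> {..<S}. (\<Sum>w\<in>words_of_length S l. transfer_coeff w p * poly_act (word_poly d w) x n v a) * cnj (\<nu> p))"
  proof -
    have "(\<Sum>w\<in>A. e * (\<Sum>p\<in>B. f w p * g p) * h w) = e * (\<Sum>p\<in>B. (\<Sum>w\<in>A. f w p * h w) * g p)"
      for A B e g h and f :: "_ \<Rightarrow> _ \<Rightarrow> complex"
      by (simp add: sum_distrib_left sum_distrib_right mult_ac) (rule sum.swap)
    then show ?thesis .
  qed
  also have "\<dots> = (if l = 0 then 1 else 2) * (\<Sum>p\<in>K \<times> {..<S}. (transfer_op d x n ^^ l) (\<lambda>pa. \<nu> (fst pa) * v (snd pa)) (p, a) * cnj (\<nu> p))"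
    by (intro arg_cong[where f = "\<lambda>z. _ * z"] sum.cong refl) (simp only: transfer_op_power_expansion[OF x _ a])
  finally show ?thesis .
qed

text \<open>With \<open>T\<close> the transfer operator and \<open>U\<close> the tensor product of
  \<open>\<nu>\<close> and \<open>v\<close>, the term of degree \<open>l\<close> has as its form at
  \<open>v\<close> the pairing of \<open>T ^ l U\<close> with \<open>U\<close>, times 1 or 2. So
  \<open>fejer_sum_nonneg\<close> applies, \<open>T\<close> being a contraction because
  \<open>W\<close> and \<open>\<delta>(x)\<close> are.\<close>

lemma fejer_poly_herglotz_nonneg:
  assumes x: "x \<in> mat_tuples n" and contr: "block_contraction S d n x 1"
  shows "0 \<le> Re (inner_on {..<n} (poly_act (fejer_poly S d herglotz_coeff N) x n v) v)"
proof -
  let ?P = "K \<times> {..<S}" and ?U = "\<lambda>pa. \<nu> (fst pa) * v (snd pa)"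
  have h: "inner_on {..<n} (poly_act (hom_poly S d herglotz_coeff l) x n v) v =
    (if l = 0 then 1 else 2) * inner_on (?P \<times> {..<n}) ((transfer_op d x n ^^ l) ?U) ?U" for l
  proof -
    have "inner_on {..<n} (poly_act (hom_poly S d herglotz_coeff l) x n v) v =
      (\<Sum>a<n. (if l = 0 then 1 else 2) * (\<Sum>p\<in>?P. (transfer_op d x n ^^ l) ?U (p, a) * cnj (\<nu> p)) * cnj (v a))"
      unfolding inner_on_def by (rule sum.cong) (simp_all add: poly_act_hom_poly_herglotz[OF x])
    also have "\<dots> = (if l = 0 then 1 else 2) * (\<Sum>a<n. \<Sum>p\<in>?P. (transfer_op d x n ^^ l) ?U (p, a) * (cnj (\<nu> p) * cnj (v a)))"
      by (simp add: sum_distrib_left sum_distrib_right mult_ac)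
    also have "\<dots> = (if l = 0 then 1 else 2) * inner_on (?P \<times> {..<n}) ((transfer_op d x n ^^ l) ?U) ?U"
      unfolding inner_on_def by (subst sum.swap) (simp add: sum.cartesian_product split_beta)
    finally show ?thesis .
  qed
  have "inner_on {..<n} (poly_act (fejer_poly S d herglotz_coeff N) x n v) v =
    inner_on {..<n} (\<lambda>a. 1 / of_nat N * (\<Sum>M<N. \<Sum>l<Suc M. poly_act (hom_poly S d herglotz_coeff l) x n v a)) v"
    by (rule inner_on_cong) (simp_all only: lessThan_iff poly_act_fejer_poly[OF x] partial_poly_def poly_act_sum[OF x])
  also have "\<dots> = 1 / of_nat N * (\<Sum>M<N. \<Sum>l<Suc M. (if l = 0 then 1 else 2) * inner_on (?P \<times> {..<n}) ((transfer_op d x n ^^ l) ?U) ?U)"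
    by (simp only: inner_on_scale_left inner_on_sum_left h)
  finally have e: "inner_on {..<n} (poly_act (fejer_poly S d herglotz_coeff N) x n v) v = of_real (1 / of_nat N) *
      (\<Sum>M<N. \<Sum>l<Suc M. (if l = 0 then 1 else 2) * inner_on (?P \<times> {..<n}) ((transfer_op d x n ^^ l) ?U) ?U)"
    by simp
  have "0 \<le> Re (\<Sum>M<N. \<Sum>l<Suc M. (if l = 0 then 1 else 2) * inner_on (?P \<times> {..<n}) ((transfer_op d x n ^^ l) ?U) ?U)"
    by (rule fejer_sum_nonneg) (use norm2_transfer_op[OF contr] in \<open>simp_all add: transfer_op_add transfer_op_zero\<close>)
  then show ?thesis unfolding e Re_complex_of_real times_complex.sel Im_complex_of_real by simp
qed

text \<open>With \<open>T\<close> the transfer operator, the hypothesis on \<open>V\<close> is the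
  resolvent equation \<open>V = \<nu> \<otimes> v + T V\<close>, and \<open>g\<close> is the value
  of the full series at \<open>v\<close>. Iterating the equation gives the partial sum plus twice
  the pairing of \<open>T ^ (M + 1) V\<close> with \<open>\<nu>\<close>.\<close>

lemma partial_poly_herglotz_bound:
  assumes x: "x \<in> mat_tuples n" and q: "0 \<le> q" "q < 1" and contr: "block_contraction S d n x q"
    and V: "\<And>p a. p \<in> K \<times> {..<S} \<Longrightarrow> a < n \<Longrightarrow> V (p, a) = \<nu> p * v a + transfer_op d x n V (p, a)"
    and g: "\<And>a. a < n \<Longrightarrow> g a = 2 * (\<Sum>p\<in>K \<times> {..<S}. V (p, a) * cnj (\<nu> p)) - v a"
  shows "sqrt (norm2_on {..<n} (\<lambda>a. g a - poly_act (partial_poly S d herglotz_coeff (Suc M)) x n v a))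
    \<le> 2 * q ^ Suc M / (1 - q) * sqrt (norm2_on {..<n} v)"
proof -
  let ?P = "K \<times> {..<S}" and ?U = "\<lambda>pa. \<nu> (fst pa) * v (snd pa)" and ?T = "transfer_op d x n"
  let ?J = "?P \<times> {..<n}"
  \<comment> \<open>The equation for \<open>V\<close> is known only on the finite index set, so
    before iterating, \<open>T\<close> must be seen to depend on these values alone.\<close>
  have cong: "?T f = ?T g" if "\<And>i. i \<in> ?J \<Longrightarrow> f i = g i" for f g
    unfolding transfer_op_def
    by (intro ext sum.cong refl arg_cong[where f = "\<lambda>z. _ * z"] kapply_cong) (use that in auto)
  have nU: "norm2_on ?J ?U = norm2_on {..<n} v"
  proof -
    have "norm2_on ?J ?U = (\<Sum>a<n. (cmod (v a))\<^sup>2 * norm2_on ?P \<nu>)"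
      unfolding norm2_on_pairs by (rule sum.cong) (simp_all add: norm2_on_def norm_mult power_mult_distrib sum_distrib_left mult_ac)
    then show ?thesis unfolding \<nu>_unit by (simp add: norm2_on_def[of "{..<n}"])
  qed
  have VJ: "V i = ?U i + ?T V i" if "i \<in> ?J" for i using V that by auto
  have exp: "V i = (\<Sum>l<N. (?T ^^ l) ?U i) + (?T ^^ N) V i" if "i \<in> ?J" for N i
    using that
  proof (induction N arbitrary: i)
    case (Suc N)
    have "?T V = ?T (\<lambda>i. (\<Sum>l<N. (?T ^^ l) ?U i) + (?T ^^ N) V i)"
      by (rule cong) (rule Suc.IH)
    also have "\<dots> = (\<lambda>i. (\<Sum>l<N. (?T ^^ Suc l) ?U i) + (?T ^^ Suc N) V i)"
    proof -
      have "?T (\<lambda>i. \<Sum>l<N. f l i) = (\<lambda>i. \<Sum>l<N. ?T (f l) i)" for N and f :: "nat \<Rightarrow> _"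
        by (induction N) (simp_all add: transfer_op_zero transfer_op_add)
      then show ?thesis by (simp add: transfer_op_add)
    qed
    finally show ?case using VJ[OF Suc.prems]
      by (simp add: sum.lessThan_Suc_shift del: sum.lessThan_Suc)
  qed simp
  \<comment> \<open>The norm of \<open>V\<close> is at most that of \<open>v\<close> plus
    \<open>q\<close> times itself, and the last term is absorbed on the left.\<close>
  have nV: "sqrt (norm2_on ?J V) \<le> sqrt (norm2_on {..<n} v) / (1 - q)"
  proof -
    have "norm2_on ?J V = norm2_on ?J (\<lambda>i. ?U i + ?T V i)" by (rule norm2_on_cong) (rule VJ)
    then have "sqrt (norm2_on ?J V) \<le> sqrt (norm2_on ?J ?U) + sqrt (norm2_on ?J (?T V))"
      using sqrt_norm2_on_triangle[of ?J ?U "?T V"] by simp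
    also have "sqrt (norm2_on ?J (?T V)) \<le> sqrt (q\<^sup>2 * norm2_on ?J V)"
      using norm2_transfer_op[OF contr] by simp
    also have "\<dots> = q * sqrt (norm2_on ?J V)" using q by (simp add: real_sqrt_mult)
    finally have "(1 - q) * sqrt (norm2_on ?J V) \<le> sqrt (norm2_on {..<n} v)" by (simp add: nU algebra_simps)
    then show ?thesis using q by (simp add: field_simps)
  qed
  let ?Z = "(?T ^^ Suc M) V"
  have diff: "g a - poly_act (partial_poly S d herglotz_coeff (Suc M)) x n v a = 2 * (\<Sum>p\<in>?P. ?Z (p, a) * cnj (\<nu> p))"
    if a: "a < n" for a
  proof -
    have "(\<Sum>p\<in>?P. V (p, a) * cnj (\<nu> p)) =
      (\<Sum>p\<in>?P. ((\<Sum>l<Suc M. (?T ^^ l) ?U (p, a)) + ?Z (p, a)) * cnj (\<nu> p))"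
      by (rule sum.cong[OF refl], subst exp[of _ "Suc M"]) (use a in auto)
    also have "\<dots> = (\<Sum>l<Suc M. \<Sum>p\<in>?P. (?T ^^ l) ?U (p, a) * cnj (\<nu> p)) + (\<Sum>p\<in>?P. ?Z (p, a) * cnj (\<nu> p))"
      unfolding distrib_right sum.distrib sum_distrib_right by (subst sum.swap) (rule refl)
    also have "(\<Sum>l<Suc M. \<Sum>p\<in>?P. (?T ^^ l) ?U (p, a) * cnj (\<nu> p)) =
      (\<Sum>p\<in>?P. \<nu> p * v a * cnj (\<nu> p)) + (\<Sum>l<M. \<Sum>p\<in>?P. (?T ^^ Suc l) ?U (p, a) * cnj (\<nu> p))"
      by (subst sum.lessThan_Suc_shift) simp
    also have "(\<Sum>p\<in>?P. \<nu> p * v a * cnj (\<nu> p)) = v a * inner_on ?P \<nu> \<nu>"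
      by (simp add: inner_on_def sum_distrib_left mult_ac)
    finally have ga: "g a = v a + 2 * (\<Sum>l<M. \<Sum>p\<in>?P. (?T ^^ Suc l) ?U (p, a) * cnj (\<nu> p)) + 2 * (\<Sum>p\<in>?P. ?Z (p, a) * cnj (\<nu> p))"
      using g[OF a] by (simp add: inner_on_self \<nu>_unit)
    have "poly_act (partial_poly S d herglotz_coeff (Suc M)) x n v a =
      (\<Sum>l<Suc M. (if l = 0 then 1 else 2) * (\<Sum>p\<in>?P. (?T ^^ l) ?U (p, a) * cnj (\<nu> p)))"
      using a by (simp only: partial_poly_def poly_act_sum[OF x] poly_act_hom_poly_herglotz[OF x])
    also have "\<dots> = (\<Sum>p\<in>?P. \<nu> p * v a * cnj (\<nu> p)) + 2 * (\<Sum>l<M. \<Sum>p\<in>?P. (?T ^^ Suc l) ?U (p, a) * cnj (\<nu> p))"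
      by (subst sum.lessThan_Suc_shift) (simp add: sum_distrib_left)
    also have "(\<Sum>p\<in>?P. \<nu> p * v a * cnj (\<nu> p)) = v a * inner_on ?P \<nu> \<nu>"
      by (simp add: inner_on_def sum_distrib_left mult_ac)
    finally show ?thesis unfolding ga by (simp add: inner_on_self \<nu>_unit)
  qed
  have "norm2_on {..<n} (\<lambda>a. g a - poly_act (partial_poly S d herglotz_coeff (Suc M)) x n v a)
      = norm2_on {..<n} (\<lambda>a. 2 * inner_on ?P (\<lambda>p. ?Z (p, a)) \<nu>)"
    by (rule norm2_on_cong) (simp add: diff inner_on_def)
  also have "\<dots> = 4 * (\<Sum>a<n. (cmod (inner_on ?P (\<lambda>p. ?Z (p, a)) \<nu>))\<^sup>2)"
    by (simp add: norm2_on_scale) (simp add: norm2_on_def)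
  also have "\<dots> \<le> 4 * (\<Sum>a<n. norm2_on ?P (\<lambda>p. ?Z (p, a)))"
  proof (intro mult_left_mono sum_mono)
    fix a
    have "cmod (inner_on ?P (\<lambda>p. ?Z (p, a)) \<nu>) \<le> sqrt (norm2_on ?P (\<lambda>p. ?Z (p, a)))"
      using inner_on_Cauchy_Schwarz[of ?P "\<lambda>p. ?Z (p, a)" \<nu>] by (simp add: \<nu>_unit)
    then have "(cmod (inner_on ?P (\<lambda>p. ?Z (p, a)) \<nu>))\<^sup>2 \<le> (sqrt (norm2_on ?P (\<lambda>p. ?Z (p, a))))\<^sup>2"
      by (rule power_mono) simp
    then show "(cmod (inner_on ?P (\<lambda>p. ?Z (p, a)) \<nu>))\<^sup>2 \<le> norm2_on ?P (\<lambda>p. ?Z (p, a))"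
      by (simp add: norm2_on_nonneg)
  qed simp
  also have "(\<Sum>a<n. norm2_on ?P (\<lambda>p. ?Z (p, a))) = norm2_on ?J ?Z" by (simp only: norm2_on_pairs)
  also have "4 * norm2_on ?J ?Z \<le> 4 * ((q ^ Suc M)\<^sup>2 * norm2_on ?J V)"
    by (intro mult_left_mono norm2_transfer_op_power[OF contr]) simp
  finally have "sqrt (norm2_on {..<n} (\<lambda>a. g a - poly_act (partial_poly S d herglotz_coeff (Suc M)) x n v a))
      \<le> sqrt (4 * ((q ^ Suc M)\<^sup>2 * norm2_on ?J V))" by simp
  also have "\<dots> = 2 * q ^ Suc M * sqrt (norm2_on ?J V)"
    using q by (simp add: real_sqrt_mult del: power_Suc)
  also have "\<dots> \<le> 2 * q ^ Suc M * (sqrt (norm2_on {..<n} v) / (1 - q))"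
    using q nV by (intro mult_left_mono) simp_all
  finally show ?thesis by simp
qed

end

section \<open>Interpolation at a point\<close>

definition mat_act :: "nat \<Rightarrow> complex mat \<Rightarrow> (nat \<Rightarrow> complex) \<Rightarrow> nat \<Rightarrow> complex" where
  "mat_act m A = kapply {..<m} (\<lambda>a b. A $$ (a, b))"

lemma poly_act_eq_mat_act: "poly_act p x n = mat_act n (free_eval p x)"
  by (simp add: poly_act_def mat_act_def)

lemma mat_act_mult:
  assumes "A \<in> carrier_mat n k" "B \<in> carrier_mat k m" "a < n"
  shows "mat_act m (A * B) f a = mat_act k A (mat_act m B f) a"
proof -
  have "mat_act m (A * B) f a = (\<Sum>b<m. \<Sum>c<k. A $$ (a, c) * B $$ (c, b) * f b)"
    using assms by (simp add: mat_act_def kapply_def scalar_prod_def lessThan_atLeast0 sum_distrib_right)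
  also have "\<dots> = (\<Sum>c<k. A $$ (a, c) * (\<Sum>b<m. B $$ (c, b) * f b))"
    by (subst sum.swap) (simp add: sum_distrib_left mult_ac)
  finally show ?thesis by (simp add: mat_act_def kapply_def)
qed

lemma mat_act_one: "a < n \<Longrightarrow> mat_act n (1\<^sub>m n) f a = f a"
  by (simp add: mat_act_def kapply_def if_distrib[of "\<lambda>z. z * _"] cong: if_cong)

lemma mat_act_cong: "(\<And>b. b < m \<Longrightarrow> f b = g b) \<Longrightarrow> mat_act m A f a = mat_act m A g a"
  unfolding mat_act_def by (rule kapply_cong) simp

lemma mat_act_intertwine:
  assumes "\<alpha> * A = B * \<alpha>" "\<alpha> \<in> carrier_mat m n" "A \<in> carrier_mat n n" "B \<in> carrier_mat m m" "a < m"
  shows "mat_act n \<alpha> (mat_act n A f) a = mat_act m B (mat_act n \<alpha> f) a"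
  using mat_act_mult[OF assms(2,3,5), of f] mat_act_mult[OF assms(4,2,5), of f] assms(1) by simp

lemma kapply_block_kernel:
  "kapply ({..<S} \<times> {..<n}) (block_kernel d x) u (i, a) = (\<Sum>j<S. poly_act (d i j) x n (\<lambda>b. u (j, b)) a)"
  by (simp add: kapply_def block_kernel_def poly_act_def sum.cartesian_product split_beta)

lemma mult_mat_vec_cscalar_prod:
  assumes "A \<in> carrier_mat n n" "v \<in> carrier_vec n"
  shows "(A *\<^sub>v v) \<bullet>c v = inner_on {..<n} (mat_act n A (\<lambda>i. v $ i)) (\<lambda>i. v $ i)"
proof -
  have "(A *\<^sub>v v) \<bullet>c v = (\<Sum>i<n. (A *\<^sub>v v) $ i * cnj (v $ i))"
    using assms by (simp add: scalar_prod_def lessThan_atLeast0)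
  also have "\<dots> = inner_on {..<n} (mat_act n A (\<lambda>i. v $ i)) (\<lambda>i. v $ i)"
    unfolding inner_on_def
    by (rule sum.cong[OF refl]) (simp only: mult_mat_vec_index[OF assms] mat_act_def lessThan_iff)
  finally show ?thesis .
qed

lemma inner_on_mat_act_adjoint:
  assumes "A \<in> carrier_mat n n"
  shows "inner_on {..<n} (mat_act n (mat_adjoint A) f) f = cnj (inner_on {..<n} (mat_act n A f) f)"
proof -
  have "mat_adjoint A $$ (a, b) = cnj (A $$ (b, a))" if "a < n" "b < n" for a b
    using assms that by (simp add: mat_adjoint_def mat_of_rows_def)
  then have "inner_on {..<n} (mat_act n (mat_adjoint A) f) f = (\<Sum>a<n. \<Sum>b<n. cnj (A $$ (b, a)) * f b * cnj (f a))"
    by (simp add: inner_on_def mat_act_def kapply_def sum_distrib_right)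
  also have "\<dots> = (\<Sum>b<n. \<Sum>a<n. cnj (A $$ (b, a)) * f b * cnj (f a))" by (rule sum.swap)
  also have "\<dots> = cnj (inner_on {..<n} (mat_act n A f) f)"
    by (simp add: inner_on_def mat_act_def kapply_def sum_distrib_left sum_distrib_right mult_ac)
  finally show ?thesis .
qed

text \<open>The quadratic form of \<open>mat_Re A\<close> is real and equals the real part of the
  form of \<open>A\<close>, so the complex order in \<open>mat_psd\<close> reduces to a real
  inequality.\<close>

lemma mat_psd_mat_Re_iff:
  assumes A: "A \<in> carrier_mat n n"
  shows "mat_psd (mat_Re A) \<longleftrightarrow> (\<forall>f. 0 \<le> Re (inner_on {..<n} (mat_act n A f) f))"
proof -
  have A': "mat_adjoint A \<in> carrier_mat n n" 
    by (rule carrier_matI) (use A in \<open>simp_all add: mat_adjoint_def mat_of_rows_def\<close>)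
  have R: "mat_Re A \<in> carrier_mat n n" using A A' by (simp add: mat_Re_def)
  have Re: "inner_on {..<n} (mat_act n (mat_Re A) f) f = of_real (Re (inner_on {..<n} (mat_act n A f) f))" for f
  proof -
    have "mat_act n (mat_Re A) f a = (1 / 2) * (mat_act n A f a + mat_act n (mat_adjoint A) f a)" if "a < n" for a
      using A A' that by (simp add: mat_act_def kapply_def mat_Re_def sum.distrib sum_distrib_left sum_divide_distrib algebra_simps add_divide_distrib)
    then have "inner_on {..<n} (mat_act n (mat_Re A) f) f
        = inner_on {..<n} (\<lambda>a. (1 / 2) * (mat_act n A f a + mat_act n (mat_adjoint A) f a)) f"
      by (intro inner_on_cong) auto
    also have "\<dots> = (1 / 2) * (inner_on {..<n} (mat_act n A f) f + cnj (inner_on {..<n} (mat_act n A f) f))"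
      by (simp only: inner_on_linear inner_on_mat_act_adjoint[OF A])
    also have "\<dots> = of_real (Re (inner_on {..<n} (mat_act n A f) f))" by (simp add: complex_eq_iff)
    finally show ?thesis .
  qed
  have "mat_psd (mat_Re A) \<longleftrightarrow> (\<forall>v\<in>carrier_vec n. 0 \<le> Re (inner_on {..<n} (mat_act n A (\<lambda>i. v $ i)) (\<lambda>i. v $ i)))"
    using R by (auto simp: mat_psd_def mult_mat_vec_cscalar_prod[OF R] Re less_eq_complex_def)
  also have "\<dots> \<longleftrightarrow> (\<forall>f. 0 \<le> Re (inner_on {..<n} (mat_act n A f) f))"
  proof (intro iffI allI ballI)
    fix f assume *: "\<forall>v\<in>carrier_vec n. 0 \<le> Re (inner_on {..<n} (mat_act n A (\<lambda>i. v $ i)) (\<lambda>i. v $ i))"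
    have "inner_on {..<n} (mat_act n A (\<lambda>i. Matrix.vec n f $ i)) (\<lambda>i. Matrix.vec n f $ i) = inner_on {..<n} (mat_act n A f) f"
      by (intro inner_on_cong mat_act_cong) auto
    then show "0 \<le> Re (inner_on {..<n} (mat_act n A f) f)" using * by (metis vec_carrier)
  qed auto
  finally show ?thesis .
qed

text \<open>The strict inequality is expressed by a witness \<open>q < 1\<close>, the quantity that
  enters the estimates.\<close>

definition contraction_ball :: "nat \<Rightarrow> (nat \<Rightarrow> nat \<Rightarrow> 'd free_poly) \<Rightarrow> 'd mat_tuple set" where
  "contraction_ball S d = {x. \<exists>n\<ge>1. x \<in> mat_tuples n \<and> (\<exists>q. 0 \<le> q \<and> q < 1 \<and> block_contraction S d n x q)}"

text \<open>A crude entrywise bound; it starts the iteration that proves \<open>G\<close> positive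
  and later bounds the form of \<open>G\<close> from above at the conjugated point.\<close>

lemma abs_qform_le:
  fixes m :: nat
  obtains C where "0 \<le> C" "\<And>f. \<bar>qform {..<m} G f\<bar> \<le> C * norm2_on {..<m} f"
proof
  let ?C = "\<Sum>a<m. \<Sum>b<m. cmod (G a b)"
  show "0 \<le> ?C" by (intro sum_nonneg) auto
  fix f
  have f: "cmod (f a) \<le> sqrt (norm2_on {..<m} f)" if "a < m" for a
    using cmod_le_sqrt_norm2_on[of "{..<m}" a f] that by simp
  have "\<bar>qform {..<m} G f\<bar> \<le> cmod (\<Sum>a<m. \<Sum>b<m. G a b * f b * cnj (f a))"
    unfolding qform_eq by (rule abs_Re_le_cmod)
  also have "\<dots> \<le> (\<Sum>a<m. \<Sum>b<m. cmod (G a b * f b * cnj (f a)))"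
    by (rule order_trans[OF norm_sum]) (intro sum_mono norm_sum)
  also have "\<dots> \<le> (\<Sum>a<m. \<Sum>b<m. cmod (G a b) * norm2_on {..<m} f)"
  proof (intro sum_mono)
    fix a b assume "a \<in> {..<m}" "b \<in> {..<m}"
    then have "cmod (f b) * cmod (f a) \<le> sqrt (norm2_on {..<m} f) * sqrt (norm2_on {..<m} f)"
      by (intro mult_mono f) (auto simp: norm2_on_nonneg)
    then show "cmod (G a b * f b * cnj (f a)) \<le> cmod (G a b) * norm2_on {..<m} f"
      by (simp add: norm_mult mult.assoc mult_left_mono norm2_on_nonneg)
  qed
  finally show "\<bar>qform {..<m} G f\<bar> \<le> ?C * norm2_on {..<m} f" by (simp add: sum_distrib_right)
qed

text \<open>Feeding a vector into the first column of \<open>D\<close> improves any lower bound \<open>- C\<close> on the form \<open>G\<close>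
  to \<open>- C * q\<^sup>2\<close>, so \<open>G\<close> is positive.\<close>

lemma qform_pos_of_block_form_pos:
  assumes S: "1 \<le> S" and q: "0 \<le> q" "q < 1"
    and contr: "\<And>u. norm2_on ({..<S} \<times> {..<m}) (kapply ({..<S} \<times> {..<m}) D u) \<le> q\<^sup>2 * norm2_on ({..<S} \<times> {..<m}) u"
    and pos: "\<And>u. \<kappa> * norm2_on ({..<S} \<times> {..<m}) u \<le> block_form S m D G u" and \<kappa>: "0 < \<kappa>"
  shows "\<kappa> * norm2_on {..<m} f \<le> qform {..<m} G f"
proof -
  let ?I = "{..<S} \<times> {..<m}"
  define col where "col = (\<lambda>(f :: nat \<Rightarrow> complex) (p :: nat \<times> nat). if fst p = 0 then f (snd p) else 0)"
  define row where "row = (\<lambda>f i a. kapply ?I D (col f) (i, a))"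
  have ncol: "norm2_on ?I (col f) = norm2_on {..<m} f" for f
  proof -
    have "norm2_on ?I (col f) = (\<Sum>j<S. if j = 0 then norm2_on {..<m} f else 0)"
      unfolding sum_norm2_on_rows[symmetric] by (rule sum.cong) (auto simp: col_def norm2_on_def)
    then show ?thesis using S by simp
  qed
  have nrow: "(\<Sum>i<S. norm2_on {..<m} (row f i)) \<le> q\<^sup>2 * norm2_on {..<m} f" for f
    using contr[of "col f"] by (simp add: ncol row_def sum_norm2_on_rows[where u = "kapply ?I D (col f)"])
  have bf: "block_form S m D G (col f) = qform {..<m} G f - (\<Sum>i<S. qform {..<m} G (row f i))" for f
  proof -
    have "(\<Sum>j<S. qform {..<m} G (\<lambda>a. col f (j, a))) = (\<Sum>j<S. if j = 0 then qform {..<m} G f else 0)"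
      by (rule sum.cong) (auto simp: col_def qform_eq)
    then show ?thesis using S by (simp add: block_form_def row_def)
  qed
  obtain C where C: "0 \<le> C" "\<And>f. \<bar>qform {..<m} G f\<bar> \<le> C * norm2_on {..<m} f"
    by (rule abs_qform_le[of m G]) (rule that)
  have step: "- (C * (q\<^sup>2) ^ k) * norm2_on {..<m} f \<le> qform {..<m} G f" for k f
  proof (induction k arbitrary: f)
    case 0
    then show ?case using C(2)[of f] by (simp add: abs_le_iff)
  next
    case (Suc k)
    have "- (C * (q\<^sup>2) ^ Suc k) * norm2_on {..<m} f = - (C * (q\<^sup>2) ^ k) * (q\<^sup>2 * norm2_on {..<m} f)"
      by simp
    also have "\<dots> \<le> - (C * (q\<^sup>2) ^ k) * (\<Sum>i<S. norm2_on {..<m} (row f i))"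
      by (rule mult_left_mono_neg[OF nrow]) (use C(1) in simp)
    also have "\<dots> = (\<Sum>i<S. - (C * (q\<^sup>2) ^ k) * norm2_on {..<m} (row f i))" by (rule sum_distrib_left)
    also have "\<dots> \<le> (\<Sum>i<S. qform {..<m} G (row f i))" by (rule sum_mono) (rule Suc.IH)
    also have "\<dots> \<le> qform {..<m} G f"
      using pos[of "col f"] mult_nonneg_nonneg[OF less_imp_le[OF \<kappa>] norm2_on_nonneg[of ?I "col f"]]
      unfolding bf by linarith
    finally show ?case .
  qed
  have nonneg: "0 \<le> qform {..<m} G f" for f
  proof (rule LIMSEQ_le_const2)
    have "q\<^sup>2 < 1" using q by (simp add: power_less_one_iff abs_square_less_1)
    then have "(\<lambda>k. (q\<^sup>2) ^ k) \<longlonglongrightarrow> 0" by (intro LIMSEQ_power_zero) simp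
    from tendsto_mult[OF tendsto_const[of "- C * norm2_on {..<m} f"] this]
    show "(\<lambda>k. - (C * (q\<^sup>2) ^ k) * norm2_on {..<m} f) \<longlonglongrightarrow> 0" by (simp add: mult_ac)
    show "\<exists>N. \<forall>k\<ge>N. - (C * (q\<^sup>2) ^ k) * norm2_on {..<m} f \<le> qform {..<m} G f" using step by blast
  qed
  \<comment> \<open>Now that \<open>G\<close> is known to be positive, the row terms have a sign,
    and the bound on the block form passes to \<open>G\<close> with the same
    \<open>\<kappa>\<close>.\<close>
  have "\<kappa> * norm2_on {..<m} f + (\<Sum>i<S. qform {..<m} G (row f i)) \<le> qform {..<m} G f"
    using pos[of "col f"] by (simp add: bf ncol)
  moreover have "0 \<le> (\<Sum>i<S. qform {..<m} G (row f i))" by (intro sum_nonneg nonneg)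
  ultimately show ?thesis by simp
qed

text \<open>In the inner product of \<open>G\<close> the map \<open>\<delta>(x)\<close> is a strict
  contraction. A factor \<open>B\<close> of \<open>G\<close> transports this inner product to the
  standard one, and the similarity by \<open>B\<close> carries \<open>\<delta>(x)\<close> to
  \<open>\<delta>(y)\<close>.\<close>

lemma conjugated_point:
  fixes x :: "'d mat_tuple"
  assumes S: "1 \<le> S" and m: "1 \<le> m" and x: "x \<in> mat_tuples m"
    and q: "0 \<le> q" "q < 1" and contr: "block_contraction S d m x q"
    and herm: "hermitian_on {..<m} G" and \<kappa>: "0 < \<kappa>"
    and pos: "\<And>u. \<kappa> * norm2_on ({..<S} \<times> {..<m}) u \<le> block_form S m (block_kernel d x) G u"
  obtains B y where "B \<in> carrier_mat m m" "y \<in> mat_tuples m" "\<And>i. B * x i = y i * B"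
    "y \<in> contraction_ball S d"
    "\<And>f g. inner_on {..<m} (mat_act m B f) (mat_act m B g) = inner_on {..<m} (kapply {..<m} G f) g"
proof -
  let ?I = "{..<S} \<times> {..<m}" and ?D = "block_kernel d x"
  have Gpos: "\<kappa> * norm2_on {..<m} f \<le> qform {..<m} G f" for f
    by (rule qform_pos_of_block_form_pos[OF S q _ pos \<kappa>]) (use contr in \<open>simp add: block_contraction_def\<close>)
  have "0 \<le> qform {..<m} G f" for f
    using Gpos[of f] \<kappa> norm2_on_nonneg[of "{..<m}" f] by (smt (verit) mult_nonneg_nonneg)
  then obtain C where C: "\<And>a b. a < m \<Longrightarrow> b < m \<Longrightarrow> G a b = (\<Sum>k<m. C a k * cnj (C b k))"
    using psd_factorization[OF _ herm] by (metis finite_lessThan lessThan_iff)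
  \<comment> \<open>\<open>B\<close> is the adjoint of \<open>C\<close>, so that
    \<open>G = C C\<^sup>*\<close> reads \<open>G = B\<^sup>* B\<close>.\<close>
  define B where "B = Matrix.mat m m (\<lambda>(k, a). cnj (C a k))"
  have B: "B \<in> carrier_mat m m" by (simp add: B_def)
  have inner: "inner_on {..<m} (mat_act m B f) (mat_act m B g) = inner_on {..<m} (kapply {..<m} G f) g" for f g
  proof -
    have "inner_on {..<m} (mat_act m B f) (mat_act m B g) =
      (\<Sum>k<m. \<Sum>a<m. \<Sum>b<m. cnj (C a k) * f a * (C b k * cnj (g b)))"
      unfolding inner_on_def mat_act_def kapply_def cnj_sum sum_product by (simp add: B_def)
    also have "\<dots> = (\<Sum>a<m. \<Sum>k<m. \<Sum>b<m. cnj (C a k) * f a * (C b k * cnj (g b)))"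
      by (rule sum.swap)
    also have "\<dots> = (\<Sum>a<m. \<Sum>b<m. \<Sum>k<m. cnj (C a k) * f a * (C b k * cnj (g b)))"
      by (rule sum.cong[OF refl], rule sum.swap)
    also have "\<dots> = (\<Sum>a<m. \<Sum>b<m. G b a * f a * cnj (g b))"
      by (intro sum.cong refl) (simp add: C sum_distrib_left sum_distrib_right mult_ac)
    also have "\<dots> = (\<Sum>b<m. \<Sum>a<m. G b a * f a * cnj (g b))" by (rule sum.swap)
    finally show ?thesis by (simp add: inner_on_def kapply_def sum_distrib_right)
  qed
  have normB: "norm2_on {..<m} (mat_act m B f) = qform {..<m} G f" for f
    by (simp add: norm2_on_eq_Re_inner inner qform_def)
  have "det B \<noteq> 0"
  proof
    assume "det B = 0"
    then obtain v where v: "v \<in> carrier_vec m" "v \<noteq> 0\<^sub>v m" "B *\<^sub>v v = 0\<^sub>v m"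
      using det_0_iff_vec_prod_zero_field[OF B] by blast
    have "mat_act m B (\<lambda>i. v $ i) a = 0" if "a < m" for a
      using mult_mat_vec_index[OF B v(1) that] v(3) that by (simp add: mat_act_def)
    then have "norm2_on {..<m} (mat_act m B (\<lambda>i. v $ i)) = 0" by (simp add: norm2_on_def)
    then have "\<kappa> * norm2_on {..<m} (\<lambda>i. v $ i) \<le> 0" using Gpos normB by metis
    then have "norm2_on {..<m} (\<lambda>i. v $ i) = 0"
      using \<kappa> norm2_on_nonneg[of "{..<m}" "\<lambda>i. v $ i"] by (simp add: mult_le_0_iff)
    then have "v = 0\<^sub>v m" using v(1) by (intro eq_vecI) (auto simp: norm2_on_eq_0_iff)
    then show False using v(2) by simp
  qed
  then obtain B' where B': "B' \<in> carrier_mat m m" "B' * B = 1\<^sub>m m" "B * B' = 1\<^sub>m m"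
    using det_non_zero_imp_unit[OF B, of "()"] by (auto simp: Units_def ring_mat_def)
  define y where "y = (\<lambda>i. B * x i * B')"
  note xc = mat_tuples_carrier[OF x]
  have y: "y \<in> mat_tuples m" using B B' xc by (auto simp: mat_tuples_def y_def)
  have Bx: "B * x i = y i * B" for i
  proof -
    have "y i * B = B * x i * (B' * B)"
      unfolding y_def using B B' xc[of i] by (intro assoc_mult_mat[of _ m m _ m _ m]) auto
    then show ?thesis using B xc[of i] by (simp add: B')
  qed
  obtain M where M: "0 \<le> M" "\<And>f. \<bar>qform {..<m} G f\<bar> \<le> M * norm2_on {..<m} f"
    by (rule abs_qform_le[of m G]) (rule that)
  \<comment> \<open>\<open>c\<close> bounds the form of \<open>G\<close> from above and is at least
    \<open>\<kappa>\<close>, so \<open>1 - \<kappa> / c\<close> lies in \<open>[0, 1)\<close>. It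
    comes from comparing the loss, \<open>\<kappa>\<close> times the squared norm of
    \<open>w\<close>, with the squared norm of \<open>u\<close>, which is at most \<open>c\<close>
    times that of \<open>w\<close>.\<close>
  define c where "c = max M \<kappa>"
  have c: "0 < c" "\<kappa> \<le> c" using \<kappa> by (auto simp: c_def)
  define q' where "q' = sqrt (1 - \<kappa> / c)"
  have q': "0 \<le> q'" "q' < 1" "q'\<^sup>2 = 1 - \<kappa> / c" using \<kappa> c by (auto simp: q'_def)
  have "block_contraction S d m y q'"
    unfolding block_contraction_def
  proof
    fix u :: "nat \<times> nat \<Rightarrow> complex"
    define w where "w = (\<lambda>p. mat_act m B' (\<lambda>b. u (fst p, b)) (snd p))"
    have u: "u (j, a) = mat_act m B (\<lambda>b. w (j, b)) a" if "a < m" for j a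
      using mat_act_mult[OF B B'(1) that, of "\<lambda>b. u (j, b)"] mat_act_one[OF that, of "\<lambda>b. u (j, b)"]
      by (simp add: w_def B'(3))
    have Dy: "kapply ?I (block_kernel d y) u (i, a) = mat_act m B (\<lambda>b. kapply ?I ?D w (i, b)) a" if a: "a < m" for i a
    proof -
      have "kapply ?I (block_kernel d y) u (i, a) = (\<Sum>j<S. poly_act (d i j) y m (mat_act m B (\<lambda>b. w (j, b))) a)"
        unfolding kapply_block_kernel by (intro sum.cong refl poly_act_cong) (rule u)
      also have "\<dots> = (\<Sum>j<S. mat_act m B (poly_act (d i j) x m (\<lambda>b. w (j, b))) a)"
        unfolding poly_act_eq_mat_act
        by (intro sum.cong refl mat_act_intertwine[symmetric] free_eval_intertwine[OF x y B Bx]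
          free_eval_carrier[OF x] free_eval_carrier[OF y] B a)
      also have "\<dots> = mat_act m B (\<lambda>b. kapply ?I ?D w (i, b)) a"
        unfolding mat_act_def kapply_block_kernel kapply_sum ..
      finally show ?thesis .
    qed
    have "norm2_on ?I (kapply ?I (block_kernel d y) u) = (\<Sum>i<S. norm2_on {..<m} (mat_act m B (\<lambda>b. kapply ?I ?D w (i, b))))"
      unfolding sum_norm2_on_rows[symmetric] by (intro sum.cong refl norm2_on_cong) (simp add: Dy)
    moreover have nu: "norm2_on ?I u = (\<Sum>j<S. norm2_on {..<m} (mat_act m B (\<lambda>b. w (j, b))))"
      unfolding sum_norm2_on_rows[symmetric] by (intro sum.cong refl norm2_on_cong) (simp add: u)
    ultimately have 1: "norm2_on ?I (kapply ?I (block_kernel d y) u) \<le> norm2_on ?I u - \<kappa> * norm2_on ?I w"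
      using pos[of w] by (simp add: normB block_form_def)
    have "norm2_on ?I u \<le> (\<Sum>j<S. c * norm2_on {..<m} (\<lambda>b. w (j, b)))"
      unfolding nu normB
    proof (rule sum_mono)
      fix j
      have "qform {..<m} G (\<lambda>b. w (j, b)) \<le> M * norm2_on {..<m} (\<lambda>b. w (j, b))"
        using M(2)[of "\<lambda>b. w (j, b)"] by linarith
      also have "\<dots> \<le> c * norm2_on {..<m} (\<lambda>b. w (j, b))"
        by (intro mult_right_mono norm2_on_nonneg) (simp add: c_def)
      finally show "qform {..<m} G (\<lambda>b. w (j, b)) \<le> c * norm2_on {..<m} (\<lambda>b. w (j, b))" .
    qed
    also have "\<dots> = c * norm2_on ?I w" by (simp add: sum_norm2_on_rows[symmetric] sum_distrib_left)
    finally have "\<kappa> / c * norm2_on ?I u \<le> \<kappa> / c * (c * norm2_on ?I w)"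
      using \<kappa> c by (intro mult_left_mono) auto
    also have "\<dots> = \<kappa> * norm2_on ?I w" using c by simp
    finally show "norm2_on ?I (kapply ?I (block_kernel d y) u) \<le> q'\<^sup>2 * norm2_on ?I u"
      using 1 by (simp add: q'(3) left_diff_distrib)
  qed
  then have "y \<in> contraction_ball S d" unfolding contraction_ball_def using m y q' by blast
  then show thesis using that[OF B y Bx _ inner] by blast
qed

section \<open>Cone representation and interpolating series for a fixed \<open>h\<close>\<close>

context
  fixes S :: nat and d :: "nat \<Rightarrow> nat \<Rightarrow> 'd free_poly" and h :: "'d mat_tuple \<Rightarrow> complex mat"
  assumes S: "1 \<le> S"
    and nc: "nc_function_on (contraction_ball S d) h"
    and pos: "\<forall>x\<in>contraction_ball S d. mat_psd (mat_Re (h x))"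
begin

lemma h_carrier: "x \<in> contraction_ball S d \<Longrightarrow> x \<in> mat_tuples n \<Longrightarrow> 1 \<le> n \<Longrightarrow> h x \<in> carrier_mat n n"
  using nc unfolding nc_function_on_def graded_on_def by blast

lemma h_intertwine:
  "x \<in> contraction_ball S d \<Longrightarrow> x \<in> mat_tuples n \<Longrightarrow> 1 \<le> n \<Longrightarrow>
   y \<in> contraction_ball S d \<Longrightarrow> y \<in> mat_tuples m \<Longrightarrow> 1 \<le> m \<Longrightarrow> \<alpha> \<in> carrier_mat m n \<Longrightarrow>
   (\<And>i. \<alpha> * x i = y i * \<alpha>) \<Longrightarrow> \<alpha> * h x = h y * \<alpha>"
  using nc unfolding nc_function_on_def by blast

text \<open>By \<open>cone_map_onto\<close> only functionals \<open>G\<close> with strictly positive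
  block form have to be tested. Each yields a similar point \<open>y\<close> through a matrix
  \<open>B\<close>, and the real part of the pairing of \<open>G\<close> with the right-hand side is
  that of the form of \<open>h(y)\<close> at the vector \<open>B e\<close>.\<close>

lemma cone_representation:
  assumes z: "z \<in> mat_tuples m" and m: "1 \<le> m" and q: "0 \<le> q" "q < 1" and contr: "block_contraction S d m z q"
  shows "\<exists>B. \<forall>a<m. \<forall>b<m. cone_map S m (block_kernel d z) (gram ({..<S} \<times> {..<m}) B) (a, b) =
    (mat_act m (h z) e a * cnj (e b) + e a * cnj (mat_act m (h z) e b)) / 2"
proof -
  define g where "g = mat_act m (h z) e"
  define R where "R = (\<lambda>ab. (g (fst ab) * cnj (e (snd ab)) + e (fst ab) * cnj (g (snd ab))) / 2)"
  have zb: "z \<in> contraction_ball S d" unfolding contraction_ball_def using assms by blast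
  have "\<exists>B. \<forall>ab\<in>{..<m} \<times> {..<m}. cone_map S m (block_kernel d z) (gram ({..<S} \<times> {..<m}) B) ab = R ab"
  proof (rule cone_map_onto[OF q])
    show "norm2_on ({..<S} \<times> {..<m}) (kapply ({..<S} \<times> {..<m}) (block_kernel d z) u) \<le> q\<^sup>2 * norm2_on ({..<S} \<times> {..<m}) u" for u
      using contr by (simp add: block_contraction_def)
    show "hermitian_on {..<m} (curry R)" unfolding hermitian_on_def by (simp add: R_def mult.commute add.commute)
    fix G :: "nat \<times> nat \<Rightarrow> complex" and \<kappa> :: real
    assume G: "hermitian_on {..<m} (curry G)" "0 < \<kappa>"
      "\<And>u. \<kappa> * norm2_on ({..<S} \<times> {..<m}) u \<le> block_form S m (block_kernel d z) (curry G) u"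
    obtain B y where B: "B \<in> carrier_mat m m" and y: "y \<in> mat_tuples m" and Bz: "\<And>i. B * z i = y i * B"
      and yb: "y \<in> contraction_ball S d"
      and inner: "\<And>f g. inner_on {..<m} (mat_act m B f) (mat_act m B g) = inner_on {..<m} (kapply {..<m} (curry G) f) g"
      by (rule conjugated_point[OF S m z q contr G]) (rule that)
    have "B * h z = h y * B" by (rule h_intertwine[OF zb z m yb y m B Bz])
    then have Bg: "mat_act m B g a = mat_act m (h y) (mat_act m B e) a" if "a < m" for a
      unfolding g_def by (rule mat_act_intertwine[OF _ B h_carrier[OF zb z m] h_carrier[OF yb y m] that])
    have "0 \<le> Re (inner_on {..<m} (mat_act m (h y) (mat_act m B e)) (mat_act m B e))"
      using bspec[OF pos yb] mat_psd_mat_Re_iff[OF h_carrier[OF yb y m]] by blast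
    also have "inner_on {..<m} (mat_act m (h y) (mat_act m B e)) (mat_act m B e) = inner_on {..<m} (mat_act m B g) (mat_act m B e)"
      by (rule inner_on_cong) (simp_all add: Bg)
    finally have ge: "0 \<le> Re (inner_on {..<m} (mat_act m B g) (mat_act m B e))" .
    have eg: "inner_on {..<m} (mat_act m B e) (mat_act m B g) = cnj (inner_on {..<m} (mat_act m B g) (mat_act m B e))"
      by (rule inner_on_commute)
    have "inner_on ({..<m} \<times> {..<m}) G R = (\<Sum>a<m. \<Sum>b<m. (G (a, b) * e b * cnj (g a) + G (a, b) * g b * cnj (e a)) / 2)"
      unfolding inner_on_def sum.cartesian_product by (rule sum.cong) (auto simp: R_def algebra_simps)
    also have "\<dots> = (inner_on {..<m} (kapply {..<m} (curry G) e) g + inner_on {..<m} (kapply {..<m} (curry G) g) e) / 2"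
      by (simp add: inner_on_def kapply_def sum_distrib_right sum.distrib flip: sum_divide_distrib)
    finally have eq: "inner_on ({..<m} \<times> {..<m}) G R =
      (cnj (inner_on {..<m} (mat_act m B g) (mat_act m B e)) + inner_on {..<m} (mat_act m B g) (mat_act m B e)) / 2"
      unfolding inner[symmetric] eg .
    have "Re (inner_on ({..<m} \<times> {..<m}) G R) = Re (inner_on {..<m} (mat_act m B g) (mat_act m B e))"
      unfolding eq by simp
    then show "0 \<le> Re (inner_on ({..<m} \<times> {..<m}) G R)" using ge by simp
  qed
  then show ?thesis by (auto simp: R_def g_def)
qed

text \<open>The vector \<open>e\<close> has component 1 along a one-dimensional direct summand of \<open>z\<close> equal to the origin,
  which \<open>\<rho>\<close> projects onto. This component of the cone representation is the unit vector \<open>\<nu>\<close>.\<close>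

lemma herglotz_interpolation:
  assumes zero: "\<forall>i<S. \<forall>j<S. free_eval (d i j) (zero_tuple 1) = 0\<^sub>m 1 1"
    and h_zero: "h (zero_tuple 1) = 1\<^sub>m 1"
    and z: "z \<in> mat_tuples m" and m: "1 \<le> m" and q: "0 \<le> q" "q < 1" and contr: "block_contraction S d m z q"
    and \<rho>: "\<rho> \<in> carrier_mat 1 m" "\<And>i. \<rho> * z i = zero_tuple 1 i * \<rho>" "mat_act m \<rho> e 0 = 1"
  shows "\<exists>c. c [] = 1 \<and> (\<forall>w. cmod (c w) \<le> 2) \<and>
    (\<forall>n x N v. x \<in> mat_tuples n \<longrightarrow> block_contraction S d n x 1 \<longrightarrow>
       0 \<le> Re (inner_on {..<n} (poly_act (fejer_poly S d c N) x n v) v)) \<and>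
    (\<forall>n x r \<pi> v M. 1 \<le> n \<longrightarrow> x \<in> mat_tuples n \<longrightarrow> 0 \<le> r \<longrightarrow> r < 1 \<longrightarrow> block_contraction S d n x r \<longrightarrow>
       \<pi> \<in> carrier_mat n m \<longrightarrow> (\<forall>i. \<pi> * z i = x i * \<pi>) \<longrightarrow> (\<forall>a<n. mat_act m \<pi> e a = v a) \<longrightarrow>
       sqrt (norm2_on {..<n} (\<lambda>a. mat_act n (h x) v a - poly_act (partial_poly S d c (Suc M)) x n v a))
         \<le> 2 * r ^ Suc M / (1 - r) * sqrt (norm2_on {..<n} v))"
proof -
  let ?I = "{..<S} \<times> {..<m}" and ?D = "block_kernel d z"
  let ?P = "?I \<times> {..<S}"
  have d_zero: "free_eval (d i j) (zero_tuple 1) = 0\<^sub>m 1 1" if "i < S" "j < S" for i j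
    using zero that by blast
  define g where "g = mat_act m (h z) e"
  have zb: "z \<in> contraction_ball S d" unfolding contraction_ball_def using m z q contr by blast
  have zero1: "zero_tuple 1 \<in> mat_tuples 1" by (simp add: zero_tuple_def mat_tuples_def)
  have zero1b: "zero_tuple 1 \<in> contraction_ball S d"
  proof -
    have "kapply ({..<S} \<times> {..<1}) (block_kernel d (zero_tuple 1)) u p = 0" if "p \<in> {..<S} \<times> {..<1}" for u p
      unfolding kapply_def by (rule sum.neutral) (use that d_zero in \<open>auto simp: block_kernel_def\<close>)
    then have "block_contraction S d 1 (zero_tuple 1) 0"
      by (simp add: block_contraction_def norm2_on_def)
    then show ?thesis unfolding contraction_ball_def using zero1 by force
  qed
  \<comment> \<open>The row \<open>r0\<close> evaluates the component at the origin: it is 1 on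
    \<open>e\<close> and, as \<open>h\<close> is the identity at the origin, also on
    \<open>h(z) e\<close>.\<close>
  define r0 where "r0 = (\<lambda>a. \<rho> $$ (0, a))"
  have re: "(\<Sum>a<m. r0 a * e a) = 1" using \<rho>(3) by (simp add: r0_def mat_act_def kapply_def)
  have rg: "(\<Sum>a<m. r0 a * g a) = 1"
  proof -
    have "\<rho> * h z = h (zero_tuple 1) * \<rho>"
      by (rule h_intertwine[OF zb z m zero1b zero1 order_refl \<rho>(1,2)])
    then have "mat_act m \<rho> g 0 = mat_act 1 (h (zero_tuple 1)) (mat_act m \<rho> e) 0"
      unfolding g_def
      by (rule mat_act_intertwine[OF _ \<rho>(1) h_carrier[OF zb z m] h_carrier[OF zero1b zero1 order_refl]]) simp
    then have "mat_act m \<rho> g 0 = 1" unfolding h_zero by (simp only: mat_act_one zero_less_one \<rho>(3))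
    then show ?thesis by (simp add: r0_def mat_act_def kapply_def)
  qed
  \<comment> \<open>\<open>\<delta>\<close> vanishes at the origin, so the functional
    \<open>r0\<close> kills the range of \<open>\<delta>(z)\<close> in every block.\<close>
  have rD: "(\<Sum>a<m. r0 a * kapply ?I ?D u (i, a)) = 0" if i: "i < S" for i u
  proof -
    have "(\<Sum>a<m. r0 a * poly_act (d i j) z m f a) = 0" if j: "j < S" for j f
    proof -
      have "\<rho> * free_eval (d i j) z = free_eval (d i j) (zero_tuple 1) * \<rho>"
        by (rule free_eval_intertwine[OF z zero1 \<rho>(1,2)])
      then have "mat_act m \<rho> (mat_act m (free_eval (d i j) z) f) 0
          = mat_act 1 (free_eval (d i j) (zero_tuple 1)) (mat_act m \<rho> f) 0"
        by (rule mat_act_intertwine[OF _ \<rho>(1) free_eval_carrier[OF z] free_eval_carrier[OF zero1]]) simp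
      also have "\<dots> = 0" unfolding d_zero[OF i j] by (simp add: mat_act_def kapply_def)
      finally show ?thesis by (simp add: poly_act_eq_mat_act r0_def mat_act_def[of m \<rho>] kapply_def[of _ "\<lambda>a b. \<rho> $$ (a, b)"])
    qed
    then show ?thesis
      unfolding kapply_block_kernel sum_distrib_left by (subst sum.swap) simp
  qed
  obtain B where B: "\<And>a b. a < m \<Longrightarrow> b < m \<Longrightarrow> cone_map S m ?D (gram ?I B) (a, b) = (g a * cnj (e b) + e a * cnj (g b)) / 2"
    using cone_representation[OF z m q contr, of e] unfolding g_def by blast
  \<comment> \<open>An index \<open>p\<close> pairs a column of \<open>B\<close> with a block. For
    each coordinate \<open>a\<close>, \<open>s' a\<close> collects the entries of the columns
    \<open>u\<close> and \<open>r a\<close> those of \<open>\<delta>(z) u\<close>.\<close>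
  define s' where "s' = (\<lambda>a (p :: (nat \<times> nat) \<times> nat). B (snd p, a) (fst p))"
  define r where "r = (\<lambda>a (p :: (nat \<times> nat) \<times> nat). kapply ?I ?D (\<lambda>t. B t (fst p)) (snd p, a))"
  define \<nu> where "\<nu> = (\<lambda>p. \<Sum>a<m. r0 a * s' a p)"
  \<comment> \<open>Subtracting \<open>e a * \<nu> p\<close> absorbs the right-hand side of the cone
    representation, and what remains is equality of the Gram matrices of \<open>r\<close> and
    \<open>s\<close>.\<close>
  define s where "s = (\<lambda>a p. s' a p - e a * \<nu> p)"
  have L: "inner_on ?P (s' a) (s' b) = inner_on ?P (r a) (r b) + (g a * cnj (e b) + e a * cnj (g b)) / 2"
    if "a < m" "b < m" for a b
  proof -
    have "cone_map S m ?D (gram ?I B) (a, b) = inner_on ?P (s' a) (s' b) - inner_on ?P (r a) (r b)"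
      unfolding gram_def[abs_def] cone_map_sum cone_map_rank_one
      by (simp add: sum_subtractf inner_on_def s'_def r_def sum.cartesian_product split_beta)
    then have eq: "(g a * cnj (e b) + e a * cnj (g b)) / 2 = inner_on ?P (s' a) (s' b) - inner_on ?P (r a) (r b)"
      by (simp only: B[OF that])
    show ?thesis by (subst eq) simp
  qed
  \<comment> \<open>Applying \<open>r0\<close> in the first variable of \<open>L\<close> removes the
    \<open>r\<close> term by \<open>rD\<close> and replaces \<open>e a\<close> and
    \<open>g a\<close> by 1.\<close>
  have \<nu>s: "inner_on ?P \<nu> (s' b) = (cnj (e b) + cnj (g b)) / 2" if b: "b < m" for b
  proof -
    have "inner_on ?P \<nu> (s' b) = (\<Sum>a<m. r0 a * inner_on ?P (s' a) (s' b))"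
      by (simp add: \<nu>_def inner_on_sum_left inner_on_scale_left)
    also have "\<dots> = (\<Sum>a<m. r0 a * inner_on ?P (r a) (r b))
        + ((\<Sum>a<m. r0 a * g a) * cnj (e b) + (\<Sum>a<m. r0 a * e a) * cnj (g b)) / 2"
      by (simp add: L[OF _ b] sum.distrib sum_distrib_left sum_distrib_right sum_divide_distrib algebra_simps add_divide_distrib)
    also have "(\<Sum>a<m. r0 a * inner_on ?P (r a) (r b)) = inner_on ?P (\<lambda>p. \<Sum>a<m. r0 a * r a p) (r b)"
      by (simp add: inner_on_sum_left inner_on_scale_left)
    also have "\<dots> = inner_on ?P (\<lambda>p. 0) (r b)" by (rule inner_on_cong) (auto simp: r_def rD)
    finally show ?thesis by (simp add: re rg inner_on_def)
  qed
  have s\<nu>: "inner_on ?P (s' b) \<nu> = (e b + g b) / 2" if "b < m" for b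
    by (simp only: inner_on_commute[of ?P "s' b" \<nu>] \<nu>s[OF that] complex_cnj_divide complex_cnj_add
        complex_cnj_cnj complex_cnj_numeral)
  have "inner_on ?P \<nu> \<nu> = (\<Sum>b<m. cnj (r0 b) * inner_on ?P \<nu> (s' b))"
    by (subst (2) \<nu>_def) (simp add: inner_on_sum_right inner_on_scale_right)
  also have "\<dots> = cnj ((\<Sum>a<m. r0 a * e a) + (\<Sum>a<m. r0 a * g a)) / 2"
    by (simp add: \<nu>s sum.distrib sum_distrib_left sum_divide_distrib algebra_simps add_divide_distrib)
  finally have "inner_on ?P \<nu> \<nu> = 1" by (simp add: re rg)
  then have \<nu>1: "norm2_on ?P \<nu> = 1" by (simp add: inner_on_self)
  have gram: "inner_on ?P (r a) (r b) = inner_on ?P (s a) (s b)" if "a \<in> {..<m}" "b \<in> {..<m}" for a b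
  proof -
    have ab: "a < m" "b < m" using that by auto
    have "inner_on ?P (s a) (s b) = inner_on ?P (s' a) (s' b) - cnj (e b) * ((e a + g a) / 2)
        - e a * ((cnj (e b) + cnj (g b)) / 2 - cnj (e b))"
      unfolding s_def by (simp only: inner_on_linear \<nu>s[OF ab(2)] s\<nu>[OF ab(1)] \<open>inner_on ?P \<nu> \<nu> = 1\<close>
          mult_1_right right_diff_distrib)
    then show ?thesis unfolding L[OF ab] by (simp add: field_simps)
  qed
  have fP: "finite ?P" and fm: "finite {..<m}" by simp_all
  obtain W where W: "\<And>a p. a \<in> {..<m} \<Longrightarrow> p \<in> ?P \<Longrightarrow> kapply ?P W (r a) p = s a p"
    "\<And>f. norm2_on ?P (kapply ?P W f) \<le> norm2_on ?P f"
  proof (rule equal_Gram_contraction[OF fm fP fP, where r = r and s = s])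
    show "inner_on ?P (r a) (r b) = inner_on ?P (s a) (s b)" if "a \<in> {..<m}" "b \<in> {..<m}" for a b
      by (rule gram[OF that])
  qed (rule that)
  have fin: "finite ?I" by simp
  note ctx = fin W(2) \<nu>1
  \<comment> \<open>\<open>V0\<close> is \<open>s'\<close> with its indices regrouped; the relation
    \<open>s = W r\<close> becomes the resolvent equation
    \<open>V0 = \<nu> \<otimes> e + W \<delta>(z) V0\<close>.\<close>
  define V0 where "V0 = (\<lambda>pa. B (snd (fst pa), snd pa) (fst (fst pa)) :: complex)"
  have V0: "V0 (p, a) = \<nu> p * e a + (\<Sum>p'\<in>?P. W p p' * kapply ?I ?D (\<lambda>jb. V0 ((fst p', fst jb), snd jb)) (snd p', a))"
    if "p \<in> ?P" "a < m" for p a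
  proof -
    have "(\<Sum>p'\<in>?P. W p p' * kapply ?I ?D (\<lambda>jb. V0 ((fst p', fst jb), snd jb)) (snd p', a)) = kapply ?P W (r a) p"
      by (simp add: kapply_def[of ?P] r_def V0_def)
    also have "\<dots> = s' a p - e a * \<nu> p" using W(1) that by (simp add: s_def)
    finally show ?thesis by (simp add: V0_def s'_def mult.commute)
  qed
  let ?c = "herglotz_coeff ?I S W \<nu>"
  show ?thesis
  proof (intro exI[of _ ?c] conjI allI impI)
    show "?c [] = 1" by (rule herglotz_coeff_Nil[OF ctx])
    show "cmod (?c w) \<le> 2" for w by (rule cmod_herglotz_coeff[OF ctx])
    show "0 \<le> Re (inner_on {..<n} (poly_act (fejer_poly S d ?c N) x n v) v)"
      if "x \<in> mat_tuples n" "block_contraction S d n x 1" for n x N v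
      by (rule fejer_poly_herglotz_nonneg[OF ctx that])
  next
    fix n x t \<pi> v M
    assume n: "1 \<le> n" and x: "x \<in> mat_tuples n" and t: "0 \<le> t" "t < 1" "block_contraction S d n x t"
      and \<pi>: "\<pi> \<in> carrier_mat n m" "\<forall>i. \<pi> * z i = x i * \<pi>" "\<forall>a<n. mat_act m \<pi> e a = v a"
    have xb: "x \<in> contraction_ball S d" unfolding contraction_ball_def using n x t by blast
    have \<pi>h: "\<pi> * h z = h x * \<pi>"
      by (rule h_intertwine[OF zb z m xb x n \<pi>(1)]) (use \<pi>(2) in blast)
    \<comment> \<open>\<open>\<pi>\<close> acts on the coordinate alone, so it commutes with
      \<open>W\<close> and carries the resolvent equation from \<open>z\<close> to
      \<open>x\<close>.\<close>
    define V where "V = (\<lambda>pa. mat_act m \<pi> (\<lambda>b. V0 (fst pa, b)) (snd pa))"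
    show "sqrt (norm2_on {..<n} (\<lambda>a. mat_act n (h x) v a - poly_act (partial_poly S d ?c (Suc M)) x n v a))
         \<le> 2 * t ^ Suc M / (1 - t) * sqrt (norm2_on {..<n} v)"
    proof (rule partial_poly_herglotz_bound[OF ctx x t])
      fix p a assume p: "p \<in> ?P" and a: "a < n"
      have D: "mat_act m \<pi> (\<lambda>b. kapply ?I ?D u (i, b)) a
          = kapply ({..<S} \<times> {..<n}) (block_kernel d x) (\<lambda>jb. mat_act m \<pi> (\<lambda>b. u (fst jb, b)) (snd jb)) (i, a)" for u i
      proof -
        have "\<pi> * free_eval f z = free_eval f x * \<pi>" for f
          by (rule free_eval_intertwine[OF z x \<pi>(1)]) (use \<pi>(2) in blast)
        then have "mat_act m \<pi> (mat_act m (free_eval f z) w) a = mat_act n (free_eval f x) (mat_act m \<pi> w) a" for f w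
          by (rule mat_act_intertwine[OF _ \<pi>(1) free_eval_carrier[OF z] free_eval_carrier[OF x] a])
        then show ?thesis
          unfolding kapply_block_kernel mat_act_def[of m \<pi>] kapply_sum
          by (simp add: poly_act_eq_mat_act mat_act_def[of m \<pi>])
      qed
      have "V (p, a) = mat_act m \<pi> (\<lambda>b. \<nu> p * e b + (\<Sum>p'\<in>?P. W p p' * kapply ?I ?D (\<lambda>jb. V0 ((fst p', fst jb), snd jb)) (snd p', b))) a"
        unfolding V_def fst_conv snd_conv by (rule mat_act_cong) (rule V0[OF p])
      also have "\<dots> = \<nu> p * v a + (\<Sum>p'\<in>?P. W p p' * mat_act m \<pi> (\<lambda>b. kapply ?I ?D (\<lambda>jb. V0 ((fst p', fst jb), snd jb)) (snd p', b)) a)"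
        using \<pi>(3) a unfolding mat_act_def kapply_add kapply_sum kapply_scale by simp
      also have "(\<Sum>p'\<in>?P. W p p' * mat_act m \<pi> (\<lambda>b. kapply ?I ?D (\<lambda>jb. V0 ((fst p', fst jb), snd jb)) (snd p', b)) a)
          = transfer_op ?I S W d x n V (p, a)"
        unfolding transfer_op_def[OF ctx] D by (simp add: V_def)
      finally show "V (p, a) = \<nu> p * v a + transfer_op ?I S W d x n V (p, a)" .
    next
      fix a assume a: "a < n"
      \<comment> \<open>Solving \<open>s\<nu>\<close> for \<open>g\<close> exhibits
        \<open>h(z) e\<close> as the value of the Herglotz series at \<open>e\<close>.\<close>
      have e2: "g b = 2 * (\<Sum>p\<in>?P. V0 (p, b) * cnj (\<nu> p)) - e b" if "b < m" for b
      proof -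
        have "(\<Sum>p\<in>?P. V0 (p, b) * cnj (\<nu> p)) = (e b + g b) / 2"
          using s\<nu>[OF that] unfolding inner_on_def s'_def V0_def by simp
        moreover have "X = (e b + g b) / 2 \<Longrightarrow> g b = 2 * X - e b" for X by (auto simp: field_simps)
        ultimately show ?thesis by blast
      qed
      have "mat_act n (h x) v a = mat_act n (h x) (mat_act m \<pi> e) a"
        by (rule mat_act_cong) (use \<pi>(3) in simp)
      also have "\<dots> = mat_act m \<pi> g a"
        unfolding g_def
        by (rule mat_act_intertwine[OF \<pi>h \<pi>(1) h_carrier[OF zb z m] h_carrier[OF xb x n] a, symmetric])
      also have "\<dots> = mat_act m \<pi> (\<lambda>b. 2 * (\<Sum>p\<in>?P. cnj (\<nu> p) * V0 (p, b)) - e b) a"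
        by (rule mat_act_cong) (simp add: e2 mult.commute)
      also have "\<dots> = 2 * (\<Sum>p\<in>?P. V (p, a) * cnj (\<nu> p)) - v a"
        using \<pi>(3) a unfolding mat_act_def V_def kapply_diff kapply_sum kapply_scale by (simp add: mult.commute)
      finally show "mat_act n (h x) v a = 2 * (\<Sum>p\<in>?P. V (p, a) * cnj (\<nu> p)) - v a" .
    qed
  qed
qed

end

section \<open>Approximation on the whole ball\<close>

definition tuple_sum :: "nat \<Rightarrow> nat \<Rightarrow> 'd mat_tuple \<Rightarrow> 'd mat_tuple \<Rightarrow> 'd mat_tuple" where
  "tuple_sum n m x y = (\<lambda>i. four_block_mat (x i) (0\<^sub>m n m) (0\<^sub>m m n) (y i))"

definition first_proj :: "nat \<Rightarrow> nat \<Rightarrow> complex mat" where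
  "first_proj n m = Matrix.mat n (n + m) (\<lambda>(a, b). if b = a then 1 else 0)"

definition second_proj :: "nat \<Rightarrow> nat \<Rightarrow> complex mat" where
  "second_proj n m = Matrix.mat m (n + m) (\<lambda>(a, b). if b = n + a then 1 else 0)"

lemma proj_carrier: "first_proj n m \<in> carrier_mat n (n + m)" "second_proj n m \<in> carrier_mat m (n + m)"
  by (simp_all add: first_proj_def second_proj_def)

lemma mat_act_first_proj: "a < n \<Longrightarrow> mat_act (n + m) (first_proj n m) f a = f a"
  by (simp add: mat_act_def kapply_def first_proj_def if_distrib[of "\<lambda>z. z * _"] cong: if_cong)

lemma mat_act_second_proj: "a < m \<Longrightarrow> mat_act (n + m) (second_proj n m) f a = f (n + a)"
  by (simp add: mat_act_def kapply_def second_proj_def if_distrib[of "\<lambda>z. z * _"] cong: if_cong)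

lemma sum_lessThan_add: "(\<Sum>k<n + m. f k) = (\<Sum>k<n. f k) + (\<Sum>k<m. f (n + k))" for n m :: nat
  by (induction m) (simp_all add: add_ac)

lemma tuple_sum_mat_tuples:
  "x \<in> mat_tuples n \<Longrightarrow> y \<in> mat_tuples m \<Longrightarrow> tuple_sum n m x y \<in> mat_tuples (n + m)"
  by (simp add: mat_tuples_def tuple_sum_def)

lemma first_proj_intertwine:
  assumes "x \<in> mat_tuples n" "y \<in> mat_tuples m"
  shows "first_proj n m * tuple_sum n m x y i = x i * first_proj n m"
proof (rule eq_matI)
  note c = mat_tuples_carrier[OF assms(1), of i] mat_tuples_carrier[OF assms(2), of i]
  fix a b assume "a < dim_row (x i * first_proj n m)" "b < dim_col (x i * first_proj n m)"
  then have ab: "a < n" "b < n + m" using c proj_carrier[of n m] by auto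
  have "(first_proj n m * tuple_sum n m x y i) $$ (a, b) = (\<Sum>k<n + m. (if k = a then 1 else 0) * tuple_sum n m x y i $$ (k, b))"
    using ab c by (simp add: first_proj_def tuple_sum_def scalar_prod_def lessThan_atLeast0)
  also have "\<dots> = tuple_sum n m x y i $$ (a, b)"
    using ab by (simp add: if_distrib[of "\<lambda>z. z * _"] cong: if_cong)
  also have "\<dots> = (\<Sum>k<n. x i $$ (a, k) * (if b = k then 1 else 0))"
    using ab c by (auto simp: tuple_sum_def if_distrib[of "\<lambda>z. _ * z"] cong: if_cong)
  also have "\<dots> = (x i * first_proj n m) $$ (a, b)"
    using ab c by (simp add: first_proj_def scalar_prod_def lessThan_atLeast0)
  finally show "(first_proj n m * tuple_sum n m x y i) $$ (a, b) = (x i * first_proj n m) $$ (a, b)" .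
qed (use mat_tuples_carrier[OF assms(1), of i] mat_tuples_carrier[OF assms(2), of i] in
    \<open>auto simp: first_proj_def tuple_sum_def\<close>)

lemma second_proj_intertwine:
  assumes "x \<in> mat_tuples n" "y \<in> mat_tuples m"
  shows "second_proj n m * tuple_sum n m x y i = y i * second_proj n m"
proof (rule eq_matI)
  note c = mat_tuples_carrier[OF assms(1), of i] mat_tuples_carrier[OF assms(2), of i]
  fix a b assume "a < dim_row (y i * second_proj n m)" "b < dim_col (y i * second_proj n m)"
  then have ab: "a < m" "b < n + m" using c proj_carrier[of n m] by auto
  have "(second_proj n m * tuple_sum n m x y i) $$ (a, b) = (\<Sum>k<n + m. (if k = n + a then 1 else 0) * tuple_sum n m x y i $$ (k, b))"
    using ab c by (simp add: second_proj_def tuple_sum_def scalar_prod_def lessThan_atLeast0)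
  also have "\<dots> = tuple_sum n m x y i $$ (n + a, b)"
    using ab by (simp add: if_distrib[of "\<lambda>z. z * _"] cong: if_cong)
  also have "\<dots> = (\<Sum>k<m. if k = b - n then (if n \<le> b then y i $$ (a, k) else 0) else 0)"
    using ab c by (auto simp: tuple_sum_def)
  also have "\<dots> = (\<Sum>k<m. y i $$ (a, k) * (if b = n + k then 1 else 0))"
    by (rule sum.cong) auto
  also have "\<dots> = (y i * second_proj n m) $$ (a, b)"
    using ab c by (simp add: second_proj_def scalar_prod_def lessThan_atLeast0)
  finally show "(second_proj n m * tuple_sum n m x y i) $$ (a, b) = (y i * second_proj n m) $$ (a, b)" .
qed (use mat_tuples_carrier[OF assms(1), of i] mat_tuples_carrier[OF assms(2), of i] in
    \<open>auto simp: second_proj_def tuple_sum_def\<close>)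

lemma block_contraction_mono:
  assumes "block_contraction S d n x q" "0 \<le> q" "q \<le> q'"
  shows "block_contraction S d n x q'"
  unfolding block_contraction_def
proof
  fix u :: "nat \<times> nat \<Rightarrow> complex"
  have "q\<^sup>2 * norm2_on ({..<S} \<times> {..<n}) u \<le> q'\<^sup>2 * norm2_on ({..<S} \<times> {..<n}) u"
    using assms(2,3) by (intro mult_right_mono power_mono norm2_on_nonneg) auto
  then show "norm2_on ({..<S} \<times> {..<n}) (kapply ({..<S} \<times> {..<n}) (block_kernel d x) u) \<le> q'\<^sup>2 * norm2_on ({..<S} \<times> {..<n}) u"
    using assms(1) unfolding block_contraction_def by (meson order_trans)
qed

text \<open>The coordinate projections intertwine the sum with its summands, so evaluation splits
  along the coordinates and squared norms add.\<close>

lemma block_contraction_tuple_sum: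
  assumes x: "x \<in> mat_tuples n" and y: "y \<in> mat_tuples m"
    and "block_contraction S d n x q" "block_contraction S d m y q"
  shows "block_contraction S d (n + m) (tuple_sum n m x y) q"
  unfolding block_contraction_def
proof
  let ?z = "tuple_sum n m x y"
  note z = tuple_sum_mat_tuples[OF x y]
  fix u :: "nat \<times> nat \<Rightarrow> complex"
  let ?u2 = "\<lambda>jb. u (fst jb, n + snd jb)"
  have split: "norm2_on ({..<S} \<times> {..<n + m}) w = norm2_on ({..<S} \<times> {..<n}) w + norm2_on ({..<S} \<times> {..<m}) (\<lambda>jb. w (fst jb, n + snd jb))"
    for w :: "nat \<times> nat \<Rightarrow> complex"
    unfolding sum_norm2_on_rows[symmetric] unfolding norm2_on_def sum_lessThan_add by (simp add: sum.distrib)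
  have p1: "poly_act p ?z (n + m) f a = poly_act p x n f a" if "a < n" for p f a
  proof -
    have "poly_act p ?z (n + m) f a = mat_act (n + m) (first_proj n m) (poly_act p ?z (n + m) f) a"
      using that by (simp add: mat_act_first_proj)
    also have "\<dots> = poly_act p x n (mat_act (n + m) (first_proj n m) f) a"
      unfolding poly_act_eq_mat_act
      by (rule mat_act_intertwine[OF free_eval_intertwine[OF z x proj_carrier(1) first_proj_intertwine[OF x y]]
            proj_carrier(1) free_eval_carrier[OF z] free_eval_carrier[OF x] that])
    also have "\<dots> = poly_act p x n f a" by (rule poly_act_cong) (rule mat_act_first_proj)
    finally show ?thesis .
  qed
  have p2: "poly_act p ?z (n + m) f (n + a) = poly_act p y m (\<lambda>b. f (n + b)) a" if "a < m" for p f a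
  proof -
    have "poly_act p ?z (n + m) f (n + a) = mat_act (n + m) (second_proj n m) (poly_act p ?z (n + m) f) a"
      using that by (simp add: mat_act_second_proj)
    also have "\<dots> = poly_act p y m (mat_act (n + m) (second_proj n m) f) a"
      unfolding poly_act_eq_mat_act
      by (rule mat_act_intertwine[OF free_eval_intertwine[OF z y proj_carrier(2) second_proj_intertwine[OF x y]]
            proj_carrier(2) free_eval_carrier[OF z] free_eval_carrier[OF y] that])
    also have "\<dots> = poly_act p y m (\<lambda>b. f (n + b)) a" by (rule poly_act_cong) (rule mat_act_second_proj)
    finally show ?thesis .
  qed
  have "norm2_on ({..<S} \<times> {..<n + m}) (kapply ({..<S} \<times> {..<n + m}) (block_kernel d ?z) u)
     = norm2_on ({..<S} \<times> {..<n}) (kapply ({..<S} \<times> {..<n}) (block_kernel d x) u)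
      + norm2_on ({..<S} \<times> {..<m}) (kapply ({..<S} \<times> {..<m}) (block_kernel d y) ?u2)"
    unfolding split
    by (intro arg_cong2[where f = "(+)"] norm2_on_cong) (auto simp: kapply_block_kernel p1 p2)
  also have "\<dots> \<le> q\<^sup>2 * norm2_on ({..<S} \<times> {..<n}) u + q\<^sup>2 * norm2_on ({..<S} \<times> {..<m}) ?u2"
    using assms(3,4) unfolding block_contraction_def by (intro add_mono) blast+
  also have "\<dots> = q\<^sup>2 * norm2_on ({..<S} \<times> {..<n + m}) u" unfolding split by (simp add: distrib_left)
  finally show "norm2_on ({..<S} \<times> {..<n + m}) (kapply ({..<S} \<times> {..<n + m}) (block_kernel d ?z) u)
    \<le> q\<^sup>2 * norm2_on ({..<S} \<times> {..<n + m}) u" .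
qed

text \<open>\<open>\<pi>\<close> is an arbitrary intertwiner that takes \<open>e\<close> to
  \<open>v\<close>. Polynomials and nc functions commute with it, so identities at
  \<open>(z, e)\<close> descend to \<open>(x, v)\<close>.\<close>

definition compresses :: "nat \<Rightarrow> 'd mat_tuple \<Rightarrow> (nat \<Rightarrow> complex) \<Rightarrow> nat \<Rightarrow> 'd mat_tuple \<Rightarrow> (nat \<Rightarrow> complex) \<Rightarrow> bool" where
  "compresses m z e n x v \<longleftrightarrow>
    (\<exists>\<pi>\<in>carrier_mat n m. (\<forall>i. \<pi> * z i = x i * \<pi>) \<and> (\<forall>a<n. mat_act m \<pi> e a = v a))"

lemma compresses_trans:
  assumes x: "x \<in> mat_tuples n" and z: "z \<in> mat_tuples m" and z': "z' \<in> mat_tuples m'"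
    and "compresses m' z' e' m z e" "compresses m z e n x v"
  shows "compresses m' z' e' n x v"
proof -
  obtain \<pi>' where 1: "\<pi>' \<in> carrier_mat m m'" "\<And>i. \<pi>' * z' i = z i * \<pi>'" "\<And>a. a < m \<Longrightarrow> mat_act m' \<pi>' e' a = e a"
    using assms(4) unfolding compresses_def by blast
  obtain \<pi> where 2: "\<pi> \<in> carrier_mat n m" "\<And>i. \<pi> * z i = x i * \<pi>" "\<And>a. a < n \<Longrightarrow> mat_act m \<pi> e a = v a"
    using assms(5) unfolding compresses_def by blast
  have "(\<pi> * \<pi>') * z' i = x i * (\<pi> * \<pi>')" for i
  proof -
    note c = mat_tuples_carrier[OF x, of i] mat_tuples_carrier[OF z, of i] mat_tuples_carrier[OF z', of i]
    have "(\<pi> * \<pi>') * z' i = \<pi> * (\<pi>' * z' i)" by (rule assoc_mult_mat) (use 1 2 c in auto)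
    also have "\<dots> = (\<pi> * z i) * \<pi>'" unfolding 1 by (rule assoc_mult_mat[symmetric]) (use 1 2 c in auto)
    also have "\<dots> = x i * (\<pi> * \<pi>')" unfolding 2 by (rule assoc_mult_mat) (use 1 2 c in auto)
    finally show ?thesis .
  qed
  moreover have "mat_act m' (\<pi> * \<pi>') e' a = v a" if "a < n" for a
  proof -
    have "mat_act m' (\<pi> * \<pi>') e' a = mat_act m \<pi> (mat_act m' \<pi>' e') a" by (rule mat_act_mult[OF 2(1) 1(1) that])
    also have "\<dots> = mat_act m \<pi> e a" by (rule mat_act_cong) (rule 1(3))
    finally show ?thesis using 2(3) that by simp
  qed
  ultimately show ?thesis unfolding compresses_def using mult_carrier_mat[OF 2(1) 1(1)] by blast
qed

text \<open>Direct sums absorb the members of \<open>F\<close> one after another. The pair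
  \<open>(x0, v0)\<close> starts the process, so it survives for every \<open>F\<close>, the empty
  one included.\<close>

lemma common_dilation:
  assumes "finite F" "F \<subseteq> {(n, x, v). 1 \<le> n \<and> x \<in> mat_tuples n \<and> x \<in> contraction_ball S d}"
    and start: "1 \<le> n0" "x0 \<in> mat_tuples n0" "x0 \<in> contraction_ball S d"
  shows "\<exists>m z e. 1 \<le> m \<and> z \<in> mat_tuples m \<and> z \<in> contraction_ball S d \<and> compresses m z e n0 x0 v0 \<and>
    (\<forall>(n, x, v)\<in>F. compresses m z e n x v)"
  using assms(1,2)
proof (induction F rule: finite_induct)
  case empty
  have "compresses n0 x0 v0 n0 x0 v0"
    unfolding compresses_def
    by (intro bexI[of _ "1\<^sub>m n0"])
      (simp_all add: mat_act_one left_mult_one_mat[OF mat_tuples_carrier[OF start(2)]]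
        right_mult_one_mat[OF mat_tuples_carrier[OF start(2)]])
  then show ?case using start by blast
next
  case (insert t F)
  obtain n x v where t: "t = (n, x, v)" by (cases t)
  with insert.prems have n: "1 \<le> n" and x: "x \<in> mat_tuples n" and xb: "x \<in> contraction_ball S d" by auto
  obtain m z e where m: "1 \<le> m" and z: "z \<in> mat_tuples m" and zb: "z \<in> contraction_ball S d"
    and c0: "compresses m z e n0 x0 v0" and cF: "\<forall>(n, x, v)\<in>F. compresses m z e n x v"
    using insert.IH insert.prems by blast
  obtain q1 where q1: "0 \<le> q1" "q1 < 1" "block_contraction S d m z q1"
    using zb level_eq[OF z] level_eq unfolding contraction_ball_def by blast
  obtain q2 where q2: "0 \<le> q2" "q2 < 1" "block_contraction S d n x q2"
    using xb level_eq[OF x] level_eq unfolding contraction_ball_def by blast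
  let ?z = "tuple_sum m n z x"
  define e' where "e' = (\<lambda>a. if a < m then e a else v (a - m))"
  have z': "?z \<in> mat_tuples (m + n)" by (rule tuple_sum_mat_tuples[OF z x])
  have "block_contraction S d (m + n) ?z (max q1 q2)"
    using q1 q2 by (intro block_contraction_tuple_sum z x) (auto intro: block_contraction_mono)
  moreover have "0 \<le> max q1 q2" "max q1 q2 < 1" using q1 q2 by auto
  ultimately have zb': "?z \<in> contraction_ball S d"
    unfolding contraction_ball_def mem_Collect_eq using m z'
    by (intro exI[of _ "m + n"] exI[of _ "max q1 q2"] conjI) auto
  have cz: "compresses (m + n) ?z e' m z e"
    unfolding compresses_def using proj_carrier(1) first_proj_intertwine[OF z x]
    by (intro bexI[of _ "first_proj m n"]) (auto simp: mat_act_first_proj e'_def)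
  have cx: "compresses (m + n) ?z e' n x v"
    unfolding compresses_def using proj_carrier(2) second_proj_intertwine[OF z x]
    by (intro bexI[of _ "second_proj m n"]) (auto simp: mat_act_second_proj e'_def)
  have "compresses (m + n) ?z e' n' x' v'" if "(n', x', v') \<in> F" for n' x' v'
    by (rule compresses_trans[OF _ z z' cz]) (use that insert.prems cF in auto)
  moreover have "compresses (m + n) ?z e' n0 x0 v0"
    by (rule compresses_trans[OF start(2) z z' cz c0])
  ultimately show ?case using m z' zb' cx unfolding t
    by (intro exI[of _ "m + n"] exI[of _ ?z] exI[of _ e']) auto
qed

text \<open>Every single condition here and in \<open>coeff_matching\<close> involves finitely many
  coefficients, which makes both sets closed in the product topology.\<close>

definition coeff_positive :: "nat \<Rightarrow> (nat \<Rightarrow> nat \<Rightarrow> 'd free_poly) \<Rightarrow> ((nat \<times> nat) list \<Rightarrow> complex) set" where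
  "coeff_positive S d = {c. c [] = 1 \<and> (\<forall>n x N v. x \<in> mat_tuples n \<longrightarrow> block_contraction S d n x 1 \<longrightarrow>
     0 \<le> Re (inner_on {..<n} (poly_act (fejer_poly S d c N) x n v) v))}"

text \<open>Agreement with \<open>h\<close> is stated by bounds on all partial sums: mere
  convergence, without a rate, would not give a closed condition on \<open>c\<close>.\<close>

definition coeff_matching :: "nat \<Rightarrow> (nat \<Rightarrow> nat \<Rightarrow> 'd free_poly) \<Rightarrow> ('d mat_tuple \<Rightarrow> complex mat) \<Rightarrow>
    nat \<times> 'd mat_tuple \<times> (nat \<Rightarrow> complex) \<Rightarrow> ((nat \<times> nat) list \<Rightarrow> complex) set" where
  "coeff_matching S d h = (\<lambda>(n, x, v). {c. \<forall>r M. 0 \<le> r \<longrightarrow> r < 1 \<longrightarrow> block_contraction S d n x r \<longrightarrow>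
     sqrt (norm2_on {..<n} (\<lambda>a. mat_act n (h x) v a - poly_act (partial_poly S d c (Suc M)) x n v a))
       \<le> 2 * r ^ Suc M / (1 - r) * sqrt (norm2_on {..<n} v)})"

lemma poly_act_partial_poly:
  assumes "x \<in> mat_tuples n" "a < n"
  shows "poly_act (partial_poly S d c M) x n v a =
    (\<Sum>l<M. \<Sum>w\<in>words_of_length S l. c w * poly_act (word_poly d w) x n v a)"
  using assms by (simp add: partial_poly_def poly_act_sum poly_act_hom_poly)

lemma closed_Collect_const_imp: "(P \<Longrightarrow> closed {c. Q c}) \<Longrightarrow> closed {c. P \<longrightarrow> Q c}"
  by (cases P) auto

lemma closed_coeff_positive: "closed (coeff_positive S d)"
proof -
  have "closed {c. 0 \<le> Re (inner_on {..<n} (poly_act (fejer_poly S d c N) x n v) v)}"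
    if x: "x \<in> mat_tuples n" for n x N v
  proof -
    have "inner_on {..<n} (poly_act (fejer_poly S d c N) x n v) v =
      (\<Sum>a<n. 1 / of_nat N * (\<Sum>M<N. \<Sum>l<Suc M. \<Sum>w\<in>words_of_length S l. c w * poly_act (word_poly d w) x n v a) * cnj (v a))" for c
      unfolding inner_on_def by (rule sum.cong) (simp_all add: poly_act_fejer_poly[OF x] poly_act_partial_poly[OF x] del: sum.lessThan_Suc)
    then show ?thesis
      by (simp only:) (intro closed_Collect_le continuous_intros continuous_on_product_coordinates)
  qed
  moreover have "closed {c :: (nat \<times> nat) list \<Rightarrow> complex. c [] = 1}"
    by (intro closed_Collect_eq continuous_intros continuous_on_product_coordinates)
  ultimately show ?thesis
    unfolding coeff_positive_def by (intro closed_Collect_conj closed_Collect_all closed_Collect_const_imp)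
qed

lemma closed_coeff_matching: "x \<in> mat_tuples n \<Longrightarrow> closed (coeff_matching S d h (n, x, v))"
proof -
  assume x: "x \<in> mat_tuples n"
  have "closed {c. sqrt (norm2_on {..<n} (\<lambda>a. mat_act n (h x) v a - poly_act (partial_poly S d c (Suc M)) x n v a)) \<le> b}" for M b
  proof -
    have "norm2_on {..<n} (\<lambda>a. mat_act n (h x) v a - poly_act (partial_poly S d c (Suc M)) x n v a) =
      (\<Sum>a<n. (cmod (mat_act n (h x) v a - (\<Sum>l<Suc M. \<Sum>w\<in>words_of_length S l. c w * poly_act (word_poly d w) x n v a)))\<^sup>2)" for c
      unfolding norm2_on_def by (rule sum.cong) (simp_all add: poly_act_partial_poly[OF x] del: sum.lessThan_Suc)
    then show ?thesis
      by (simp only:) (intro closed_Collect_le continuous_intros continuous_on_product_coordinates)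
  qed
  then show ?thesis
    unfolding coeff_matching_def split_conv by (intro closed_Collect_all closed_Collect_const_imp)
qed

text \<open>Finite intersection property: finitely many pairs \<open>(x, v)\<close> are compressed
  from one pair \<open>(z, e)\<close>, whose interpolating coefficients serve all of them. The bound
  2 gives compactness.\<close>

lemma herglotz_coefficients_exist:
  fixes d :: "nat \<Rightarrow> nat \<Rightarrow> 'd free_poly"
  assumes S: "1 \<le> S"
    and nc: "nc_function_on (contraction_ball S d) h"
    and pos: "\<forall>x\<in>contraction_ball S d. mat_psd (mat_Re (h x))"
    and d_zero: "\<forall>i<S. \<forall>j<S. free_eval (d i j) (zero_tuple 1) = 0\<^sub>m 1 1"
    and h_zero: "h (zero_tuple 1) = 1\<^sub>m 1"
    and zero_ball: "zero_tuple 1 \<in> contraction_ball S d"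
  shows "\<exists>c\<in>coeff_positive S d. \<forall>n x v. 1 \<le> n \<longrightarrow> x \<in> mat_tuples n \<longrightarrow> x \<in> contraction_ball S d \<longrightarrow>
    c \<in> coeff_matching S d h (n, x, v)"
proof -
  let ?T = "{(n, x, v). 1 \<le> n \<and> x \<in> mat_tuples n \<and> x \<in> contraction_ball S d}"
  let ?K = "{c :: (nat \<times> nat) list \<Rightarrow> complex. \<forall>w. cmod (c w) \<le> 2} \<inter> coeff_positive S d"
  have zero1: "zero_tuple 1 \<in> mat_tuples 1" by (simp add: zero_tuple_def mat_tuples_def)
  have "?K \<inter> \<Inter> (coeff_matching S d h ` ?T) \<noteq> {}"
  proof (rule compact_imp_fip)
    show "compact ?K"
      using compact_bounded_functions closed_coeff_positive by (rule compact_Int_closed)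
    show "closed T" if "T \<in> coeff_matching S d h ` ?T" for T
      using that closed_coeff_matching by auto
    fix F' assume F': "finite F'" "F' \<subseteq> coeff_matching S d h ` ?T"
    obtain F where F: "finite F" "F \<subseteq> ?T" "F' = coeff_matching S d h ` F"
      using finite_subset_image[OF F'] by blast
    \<comment> \<open>The origin with vector 1 is the starting pair; it supplies the intertwiner
      \<open>\<rho>\<close> required for interpolation.\<close>
    obtain m z e where m: "1 \<le> m" and z: "z \<in> mat_tuples m" and zb: "z \<in> contraction_ball S d"
      and c0: "compresses m z e 1 (zero_tuple 1) (\<lambda>_. 1)" and cF: "\<And>n x v. (n, x, v) \<in> F \<Longrightarrow> compresses m z e n x v"
      using common_dilation[OF F(1,2) order_refl zero1 zero_ball, of "\<lambda>_. 1"] by blast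
    obtain q where q: "0 \<le> q" "q < 1" "block_contraction S d m z q"
      using zb level_eq[OF z] level_eq unfolding contraction_ball_def by blast
    obtain \<rho> where "\<rho> \<in> carrier_mat 1 m" "\<forall>i. \<rho> * z i = zero_tuple 1 i * \<rho>" "\<forall>a<1. mat_act m \<rho> e a = 1"
      using c0 unfolding compresses_def by blast
    then have \<rho>: "\<rho> \<in> carrier_mat 1 m" "\<And>i. \<rho> * z i = zero_tuple 1 i * \<rho>" "mat_act m \<rho> e 0 = 1" by auto
    from herglotz_interpolation[OF S nc pos d_zero h_zero z m q \<rho>]
    obtain c where c: "c [] = 1" "\<forall>w. cmod (c w) \<le> 2"
      "\<forall>n x N v. x \<in> mat_tuples n \<longrightarrow> block_contraction S d n x 1 \<longrightarrow>
         0 \<le> Re (inner_on {..<n} (poly_act (fejer_poly S d c N) x n v) v)"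
      "\<And>n x r \<pi> v M. 1 \<le> n \<Longrightarrow> x \<in> mat_tuples n \<Longrightarrow> 0 \<le> r \<Longrightarrow> r < 1 \<Longrightarrow> block_contraction S d n x r \<Longrightarrow>
       \<pi> \<in> carrier_mat n m \<Longrightarrow> (\<forall>i. \<pi> * z i = x i * \<pi>) \<Longrightarrow> (\<forall>a<n. mat_act m \<pi> e a = v a) \<Longrightarrow>
       sqrt (norm2_on {..<n} (\<lambda>a. mat_act n (h x) v a - poly_act (partial_poly S d c (Suc M)) x n v a))
         \<le> 2 * r ^ Suc M / (1 - r) * sqrt (norm2_on {..<n} v)"
      by (elim exE conjE) (rule that, auto)
    have "c \<in> ?K" using c(1-3) by (simp add: coeff_positive_def)
    moreover have "c \<in> coeff_matching S d h t" if t: "t \<in> F" for t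
    proof -
      obtain n x v where nxv: "t = (n, x, v)" by (cases t)
      then have nx: "1 \<le> n" "x \<in> mat_tuples n" using t F(2) by auto
      obtain \<pi> where \<pi>: "\<pi> \<in> carrier_mat n m" "\<forall>i. \<pi> * z i = x i * \<pi>" "\<forall>a<n. mat_act m \<pi> e a = v a"
        using cF[of n x v] t unfolding nxv compresses_def by blast
      show ?thesis unfolding nxv coeff_matching_def split_conv using c(4)[OF nx _ _ _ \<pi>] by simp
    qed
    ultimately show "?K \<inter> \<Inter> F' \<noteq> {}" unfolding F(3) by blast
  qed
  then obtain c where "c \<in> coeff_positive S d" "c \<in> \<Inter> (coeff_matching S d h ` ?T)" by blast
  then show ?thesis by (intro bexI[of _ c]) auto
qed

text \<open>A nonempty word begins with an entry of \<open>d\<close>, which vanishes at the origin,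
  so every partial sum there is the constant term 1, and so is the mean.\<close>

lemma fejer_poly_at_zero:
  assumes d_zero: "\<And>i j. i < S \<Longrightarrow> j < S \<Longrightarrow> free_eval (d i j) (zero_tuple n) = 0\<^sub>m n n"
    and c: "c [] = 1" and N: "1 \<le> N"
  shows "free_eval (fejer_poly S d c N) (zero_tuple n) = 1\<^sub>m n"
proof (rule eq_matI)
  have z: "zero_tuple n \<in> mat_tuples n" by (simp add: zero_tuple_def mat_tuples_def)
  have hom: "poly_act (hom_poly S d c l) (zero_tuple n) n v a = (if l = 0 then v a else 0)" if a: "a < n" for l v a
  proof (cases l)
    case 0
    then show ?thesis
      using a c by (simp add: poly_act_hom_poly[OF z] words_of_length_0 poly_act_one[OF z])
  next
    case (Suc k)
    have "poly_act (word_poly d w) (zero_tuple n) n v a = 0" if w: "w \<in> words_of_length S l" for w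
    proof -
      obtain e w' where e: "w = e # w'" "fst e < S" "snd e < S"
        using w Suc unfolding words_of_length_def by (cases w) auto
      show ?thesis
        using a unfolding e(1) by (simp add: poly_act_mult[OF z]) (simp add: poly_act_def kapply_def d_zero[OF e(2,3)])
    qed
    then show ?thesis using a Suc by (simp add: poly_act_hom_poly[OF z])
  qed
  have act: "poly_act (fejer_poly S d c N) (zero_tuple n) n v a = v a" if a: "a < n" for v a
  proof -
    have "poly_act (partial_poly S d c (Suc M)) (zero_tuple n) n v a = v a" for M
      unfolding partial_poly_def poly_act_sum[OF z a]
      using a by (simp add: hom sum.lessThan_Suc_shift del: sum.lessThan_Suc)
    then show ?thesis using a N by (simp add: poly_act_fejer_poly[OF z])
  qed
  fix a b assume "a < dim_row (1\<^sub>m n :: complex mat)" "b < dim_col (1\<^sub>m n :: complex mat)"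
  then have ab: "a < n" "b < n" by auto
  have "poly_act p x n (\<lambda>k. if k = b then 1 else 0) a = free_eval p x $$ (a, b)" for p and x :: "'a mat_tuple"
    using ab by (simp add: poly_act_def kapply_def if_distrib[of "\<lambda>z. _ * z"] cong: if_cong)
  then show "free_eval (fejer_poly S d c N) (zero_tuple n) $$ (a, b) = 1\<^sub>m n $$ (a, b)"
    using act[OF ab(1), of "\<lambda>k. if k = b then 1 else 0"] ab by simp
qed (use free_eval_carrier[of "zero_tuple n" n] in \<open>auto simp: zero_tuple_def mat_tuples_def\<close>)

lemma sqrt_norm2_on_sum_le:
  "sqrt (norm2_on I (\<lambda>i. \<Sum>k<N. f k i)) \<le> (\<Sum>k<N. sqrt (norm2_on I (f k)))" for N :: nat
proof (induction N)
  case (Suc N)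
  then show ?case
    using sqrt_norm2_on_triangle[of I "\<lambda>i. \<Sum>k<N. f k i" "f N"] by simp
qed (simp add: norm2_on_def)

text \<open>The error of the mean is the mean of the errors of the partial sums. These are bounded
  by a geometric sequence with sum at most \<open>2 / (1 - r)\<^sup>2\<close> times the norm of the
  vector, and dividing by \<open>N\<close> gives the rate.\<close>

lemma fejer_poly_error:
  assumes x: "x \<in> mat_tuples n" and hx: "h x \<in> carrier_mat n n"
    and r: "0 \<le> r" "r < 1" "block_contraction S d n x r"
    and c: "\<And>v. c \<in> coeff_matching S d h (n, x, v)" and N: "1 \<le> N"
  shows "op_norm (free_eval (fejer_poly S d c N) x - h x) \<le> 2 / (1 - r)\<^sup>2 / real N"
proof -
  let ?A = "free_eval (fejer_poly S d c N) x - h x"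
  have A: "?A \<in> carrier_mat n n" using free_eval_carrier[OF x] hx by auto
  have b0: "0 \<le> 2 / (1 - r)\<^sup>2 / real N" by simp
  have "sqrt (norm2_on {..<n} (kapply {..<n} (\<lambda>i j. ?A $$ (i, j)) v)) \<le> 2 / (1 - r)\<^sup>2 / real N * sqrt (norm2_on {..<n} v)" for v
  proof -
    let ?e = "\<lambda>M a. mat_act n (h x) v a - poly_act (partial_poly S d c (Suc M)) x n v a"
    have "kapply {..<n} (\<lambda>i j. ?A $$ (i, j)) v a = - (1 / of_nat N) * (\<Sum>M<N. ?e M a)" if a: "a < n" for a
    proof -
      have "kapply {..<n} (\<lambda>i j. ?A $$ (i, j)) v a = poly_act (fejer_poly S d c N) x n v a - mat_act n (h x) v a"
        using a hx free_eval_carrier[OF x]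
        by (simp add: kapply_def poly_act_def mat_act_def sum_subtractf left_diff_distrib)
      also have "\<dots> = - (1 / of_nat N) * (\<Sum>M<N. ?e M a)"
        using N a by (simp add: poly_act_fejer_poly[OF x] sum_subtractf field_simps)
      finally show ?thesis .
    qed
    then have "norm2_on {..<n} (kapply {..<n} (\<lambda>i j. ?A $$ (i, j)) v) = norm2_on {..<n} (\<lambda>a. - (1 / of_nat N) * (\<Sum>M<N. ?e M a))"
      by (intro norm2_on_cong) auto
    also have "\<dots> = (1 / real N)\<^sup>2 * norm2_on {..<n} (\<lambda>a. \<Sum>M<N. ?e M a)"
      unfolding norm2_on_scale by (simp add: norm_divide)
    finally have "sqrt (norm2_on {..<n} (kapply {..<n} (\<lambda>i j. ?A $$ (i, j)) v)) = 1 / real N * sqrt (norm2_on {..<n} (\<lambda>a. \<Sum>M<N. ?e M a))"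
      by (simp add: real_sqrt_mult)
    also have "\<dots> \<le> 1 / real N * (\<Sum>M<N. sqrt (norm2_on {..<n} (?e M)))"
      by (intro mult_left_mono sqrt_norm2_on_sum_le) simp
    also have "\<dots> \<le> 1 / real N * (\<Sum>M<N. r ^ M * (2 / (1 - r) * sqrt (norm2_on {..<n} v)))"
    proof (intro mult_left_mono sum_mono)
      fix M
      have "sqrt (norm2_on {..<n} (?e M)) \<le> 2 * r ^ Suc M / (1 - r) * sqrt (norm2_on {..<n} v)"
        using c[of v] r unfolding coeff_matching_def by blast
      also have "\<dots> = r * (r ^ M * (2 / (1 - r) * sqrt (norm2_on {..<n} v)))" by simp
      \<comment> \<open>A factor \<open>r\<close> is given up here, so that the sum over
        \<open>M\<close> is the plain geometric one.\<close>
      also have "\<dots> \<le> 1 * (r ^ M * (2 / (1 - r) * sqrt (norm2_on {..<n} v)))"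
        using r by (intro mult_right_mono mult_nonneg_nonneg) (auto simp: norm2_on_nonneg)
      finally show "sqrt (norm2_on {..<n} (?e M)) \<le> r ^ M * (2 / (1 - r) * sqrt (norm2_on {..<n} v))" by simp
    qed simp
    also have "\<dots> = 1 / real N * ((\<Sum>M<N. r ^ M) * (2 / (1 - r) * sqrt (norm2_on {..<n} v)))"
      by (simp only: sum_distrib_right)
    also have "\<dots> \<le> 1 / real N * (1 / (1 - r) * (2 / (1 - r) * sqrt (norm2_on {..<n} v)))"
    proof (intro mult_left_mono mult_right_mono)
      have "(\<Sum>M<N. r ^ M) = (1 - r ^ N) / (1 - r)" using r by (simp add: sum_gp_strict)
      also have "\<dots> \<le> 1 / (1 - r)" using r by (intro divide_right_mono) auto
      finally show "(\<Sum>M<N. r ^ M) \<le> 1 / (1 - r)" .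
    qed (use r in \<open>auto simp: norm2_on_nonneg\<close>)
    finally show ?thesis by (simp add: power2_eq_square mult_ac)
  qed
  then have "norm2_on {..<n} (kapply {..<n} (\<lambda>i j. ?A $$ (i, j)) v) \<le> (2 / (1 - r)\<^sup>2 / real N)\<^sup>2 * norm2_on {..<n} v" for v
  proof -
    assume *: "\<And>v. sqrt (norm2_on {..<n} (kapply {..<n} (\<lambda>i j. ?A $$ (i, j)) v)) \<le> 2 / (1 - r)\<^sup>2 / real N * sqrt (norm2_on {..<n} v)"
    have "(sqrt (norm2_on {..<n} (kapply {..<n} (\<lambda>i j. ?A $$ (i, j)) v)))\<^sup>2 \<le> (2 / (1 - r)\<^sup>2 / real N * sqrt (norm2_on {..<n} v))\<^sup>2"
      by (intro power_mono * real_sqrt_ge_zero norm2_on_nonneg)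
    then show ?thesis by (simp add: power_mult_distrib power_divide norm2_on_nonneg)
  qed
  then show ?thesis using op_norm_le_iff[OF A b0] by blast
qed

text \<open>At fixed points each condition concerns finitely many matrix entries and is closed, so
  entrywise convergence suffices. Gradedness is assumed because convergence of entries says nothing
  about dimensions.\<close>

lemma RHA_limit:
  assumes graded: "graded_on \<Omega> h" and f: "\<And>k. f k \<in> RHA \<Omega>" and \<Omega>: "\<Omega> \<subseteq> nc_universe"
    and zero: "\<And>n. 1 \<le> n \<Longrightarrow> zero_tuple n \<in> \<Omega>"
    and lim: "\<And>n x a b. 1 \<le> n \<Longrightarrow> x \<in> \<Omega> \<Longrightarrow> x \<in> mat_tuples n \<Longrightarrow> a < n \<Longrightarrow> b < n \<Longrightarrow>
      (\<lambda>k. f k x $$ (a, b)) \<longlonglongrightarrow> h x $$ (a, b)"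
  shows "h \<in> RHA \<Omega>"
proof -
  have hc: "h x \<in> carrier_mat n n" if "1 \<le> n" "x \<in> \<Omega>" "x \<in> mat_tuples n" for n x
    using graded that unfolding graded_on_def by blast
  have fc: "f k x \<in> carrier_mat n n" if "1 \<le> n" "x \<in> \<Omega>" "x \<in> mat_tuples n" for n x k
    using f[of k] that unfolding RHA_def nc_function_on_def graded_on_def by blast
  have "\<alpha> * h x = h y * \<alpha>"
    if n: "1 \<le> n" and m: "1 \<le> m" and x: "x \<in> \<Omega> \<inter> mat_tuples n" and y: "y \<in> \<Omega> \<inter> mat_tuples m"
      and \<alpha>: "\<alpha> \<in> carrier_mat m n" and int: "\<forall>i. \<alpha> * x i = y i * \<alpha>" for n m x y \<alpha>
  proof (rule eq_matI)
    note hx = hc[of n x] and hy = hc[of m y]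
    fix a b assume "a < dim_row (h y * \<alpha>)" "b < dim_col (h y * \<alpha>)"
    then have ab: "a < m" "b < n" using hy m y \<alpha> by auto
    have eq: "(\<Sum>k<n. \<alpha> $$ (a, k) * f l x $$ (k, b)) = (\<Sum>k<m. f l y $$ (a, k) * \<alpha> $$ (k, b))" for l
    proof -
      have "\<alpha> * f l x = f l y * \<alpha>"
        using f[of l] n m x y \<alpha> int unfolding RHA_def nc_function_on_def by blast
      then have "(\<alpha> * f l x) $$ (a, b) = (f l y * \<alpha>) $$ (a, b)" by simp
      then show ?thesis using ab fc[of n x l] fc[of m y l] n m x y \<alpha>
        by (simp add: scalar_prod_def lessThan_atLeast0)
    qed
    have "(\<lambda>l. \<Sum>k<n. \<alpha> $$ (a, k) * f l x $$ (k, b)) \<longlonglongrightarrow> (\<Sum>k<n. \<alpha> $$ (a, k) * h x $$ (k, b))"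
      by (intro tendsto_sum tendsto_mult tendsto_const lim) (use n x ab in auto)
    moreover have "(\<lambda>l. \<Sum>k<m. f l y $$ (a, k) * \<alpha> $$ (k, b)) \<longlonglongrightarrow> (\<Sum>k<m. h y $$ (a, k) * \<alpha> $$ (k, b))"
      by (intro tendsto_sum tendsto_mult tendsto_const lim) (use m y ab in auto)
    ultimately have "(\<Sum>k<n. \<alpha> $$ (a, k) * h x $$ (k, b)) = (\<Sum>k<m. h y $$ (a, k) * \<alpha> $$ (k, b))"
      unfolding eq by (rule LIMSEQ_unique)
    then show "(\<alpha> * h x) $$ (a, b) = (h y * \<alpha>) $$ (a, b)"
      using ab hx hy n m x y \<alpha> by (simp add: scalar_prod_def lessThan_atLeast0)
  qed (use hc[of n x] hc[of m y] that in auto)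
  then have "nc_function_on \<Omega> h" unfolding nc_function_on_def using graded by blast
  moreover have "mat_psd (mat_Re (h x))" if x: "x \<in> \<Omega>" for x
  proof -
    obtain n where n: "1 \<le> n" "x \<in> mat_tuples n" using \<Omega> x unfolding nc_universe_def by auto
    have "0 \<le> Re (inner_on {..<n} (mat_act n (h x) v) v)" for v
    proof (rule LIMSEQ_le_const)
      show "(\<lambda>k. Re (inner_on {..<n} (mat_act n (f k x) v) v)) \<longlonglongrightarrow> Re (inner_on {..<n} (mat_act n (h x) v) v)"
        unfolding inner_on_def mat_act_def kapply_def
        by (intro tendsto_Re tendsto_sum tendsto_mult tendsto_const lim) (use n x in auto)
      show "\<exists>N. \<forall>k\<ge>N. 0 \<le> Re (inner_on {..<n} (mat_act n (f k x) v) v)"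
        using f x mat_psd_mat_Re_iff[OF fc[OF n(1) x n(2)]] unfolding RHA_def by blast
    qed
    then show ?thesis using mat_psd_mat_Re_iff[OF hc[OF n(1) x n(2)]] by blast
  qed
  moreover have "h (zero_tuple n) = 1\<^sub>m n" if n: "1 \<le> n" for n
  proof (rule eq_matI)
    have z: "zero_tuple n \<in> mat_tuples n" by (simp add: zero_tuple_def mat_tuples_def)
    note hcz = hc[OF n zero[OF n] z]
    fix a b assume "a < dim_row (1\<^sub>m n :: complex mat)" "b < dim_col (1\<^sub>m n :: complex mat)"
    then have "(\<lambda>k. f k (zero_tuple n) $$ (a, b)) \<longlonglongrightarrow> h (zero_tuple n) $$ (a, b)"
      by (intro lim[OF n zero[OF n] z]) auto
    moreover have "f k (zero_tuple n) = 1\<^sub>m n" for k using f[of k] n unfolding RHA_def by blast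
    ultimately show "h (zero_tuple n) $$ (a, b) = 1\<^sub>m n $$ (a, b)" by (simp add: LIMSEQ_const_iff)
  qed (use hc[OF n zero[OF n]] in \<open>auto simp: zero_tuple_def mat_tuples_def\<close>)
  ultimately show ?thesis unfolding RHA_def by blast
qed

text \<open>For a point of the ball the operator norm itself serves as the witness
  \<open>q\<close>.\<close>

lemma nc_ball_eq_contraction_ball:
  assumes S: "dim_row \<delta> \<le> S" "dim_col \<delta> \<le> S"
  shows "nc_ball \<delta> = contraction_ball S (padded \<delta>)"
proof (intro equalityI subsetI)
  fix x assume "x \<in> nc_ball \<delta>"
  then obtain n where n: "1 \<le> n" "x \<in> mat_tuples n" "op_norm (free_mat_eval \<delta> x) < 1"
    unfolding nc_ball_def nc_universe_def by auto
  then have "block_contraction S (padded \<delta>) n x (op_norm (free_mat_eval \<delta> x))"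
    using op_norm_free_mat_eval_le_iff[OF n(2) op_norm_nonneg S] by blast
  then show "x \<in> contraction_ball S (padded \<delta>)"
    unfolding contraction_ball_def using n op_norm_nonneg by blast
next
  fix x assume "x \<in> contraction_ball S (padded \<delta>)"
  then obtain n q where n: "1 \<le> n" "x \<in> mat_tuples n" and q: "0 \<le> q" "q < 1" "block_contraction S (padded \<delta>) n x q"
    unfolding contraction_ball_def by blast
  then have "op_norm (free_mat_eval \<delta> x) \<le> q"
    using op_norm_free_mat_eval_le_iff[OF n(2) q(1) S] by blast
  then show "x \<in> nc_ball \<delta>" unfolding nc_ball_def nc_universe_def using n q by auto
qed

lemma padded_at_zero:
  assumes z: "free_mat_eval \<delta> (zero_tuple n) = 0\<^sub>m (dim_row \<delta> * n) (dim_col \<delta> * n)"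
  shows "free_eval (padded \<delta> i j) (zero_tuple n) = 0\<^sub>m n n"
proof (rule eq_matI)
  have zn: "zero_tuple n \<in> mat_tuples n" by (simp add: zero_tuple_def mat_tuples_def)
  note fc = free_eval_carrier[OF zn, of "padded \<delta> i j"]
  show "dim_row (free_eval (padded \<delta> i j) (zero_tuple n)) = dim_row (0\<^sub>m n n)"
    "dim_col (free_eval (padded \<delta> i j) (zero_tuple n)) = dim_col (0\<^sub>m n n)" using fc by auto
  fix a b assume "a < dim_row (0\<^sub>m n n :: complex mat)" "b < dim_col (0\<^sub>m n n :: complex mat)"
  then have ab: "a < n" "b < n" by auto
  show "free_eval (padded \<delta> i j) (zero_tuple n) $$ (a, b) = 0\<^sub>m n n $$ (a, b)"
  proof (cases "i < dim_row \<delta> \<and> j < dim_col \<delta>")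
    case True
    have "i * n + a < (i + 1) * n" "j * n + b < (j + 1) * n" using ab by auto
    moreover have "(i + 1) * n \<le> dim_row \<delta> * n" "(j + 1) * n \<le> dim_col \<delta> * n"
      using True by (auto intro!: mult_right_mono simp del: mult_Suc)
    ultimately have ij: "i * n + a < dim_row \<delta> * n" "j * n + b < dim_col \<delta> * n" by linarith+
    have "free_mat_eval \<delta> (zero_tuple n) $$ (i * n + a, j * n + b) = free_eval (padded \<delta> i j) (zero_tuple n) $$ (a, b)"
      using True ab ij by (simp add: free_mat_eval_def level_eq[OF zn] Let_def padded_def)
    then show ?thesis unfolding z using ij ab by simp
  next
    case False
    then show ?thesis using ab by (auto simp: padded_def free_eval_zero_index[OF zn])
  qed
qed

theorem theorem4p4:
  fixes \<delta> :: "('d::finite) free_poly mat" and h :: "'d mat_tuple \<Rightarrow> complex mat"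
  assumes delta_zero: "\<forall>n\<ge>1. free_mat_eval \<delta> (zero_tuple n) = 0\<^sub>m (dim_row \<delta> * n) (dim_col \<delta> * n)"
    and graded: "graded_on (nc_ball \<delta>) h"
  shows "h \<in> RHA (nc_ball \<delta>) \<longleftrightarrow>
    (\<exists>p :: nat \<Rightarrow> 'd free_poly.
       (\<forall>k. free_eval (p k) \<in> RHA (nc_ball \<delta>)) \<and>
       (\<forall>r. 0 < r \<and> r < 1 \<longrightarrow>
          (\<forall>\<epsilon>>0. \<exists>N. \<forall>k\<ge>N. \<forall>x\<in>nc_subball \<delta> r. op_norm (free_eval (p k) x - h x) < \<epsilon>)))"
proof -
  \<comment> \<open>The summand 1 keeps \<open>S\<close> positive even if \<open>\<delta>\<close>
    has no rows and no columns.\<close>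
  define S where "S = dim_row \<delta> + dim_col \<delta> + 1"
  have S: "dim_row \<delta> \<le> S" "dim_col \<delta> \<le> S" "1 \<le> S" by (auto simp: S_def)
  let ?d = "padded \<delta>"
  note ball = nc_ball_eq_contraction_ball[OF S(1,2)]
  have d_zero: "free_eval (?d i j) (zero_tuple n) = 0\<^sub>m n n" if "1 \<le> n" for n i j
    using padded_at_zero delta_zero that by blast
  have zero_ball: "zero_tuple n \<in> nc_ball \<delta>" if n: "1 \<le> n" for n
  proof -
    have z: "zero_tuple n \<in> mat_tuples n" by (simp add: zero_tuple_def mat_tuples_def)
    have "kapply ({..<S} \<times> {..<n}) (block_kernel ?d (zero_tuple n)) u p = 0" if "p \<in> {..<S} \<times> {..<n}" for u p
      unfolding kapply_def by (rule sum.neutral) (use that d_zero[OF n] in \<open>auto simp: block_kernel_def\<close>)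
    then have "block_contraction S ?d n (zero_tuple n) 0" by (simp add: block_contraction_def norm2_on_def)
    then show ?thesis unfolding ball contraction_ball_def using n z by force
  qed
  show ?thesis
  proof
    assume h: "h \<in> RHA (nc_ball \<delta>)"
    have "\<exists>c\<in>coeff_positive S ?d. \<forall>n x v. 1 \<le> n \<longrightarrow> x \<in> mat_tuples n \<longrightarrow> x \<in> contraction_ball S ?d \<longrightarrow>
        c \<in> coeff_matching S ?d h (n, x, v)"
      by (rule herglotz_coefficients_exist[OF S(3)])
        (use h zero_ball[OF order_refl] d_zero[OF order_refl] in \<open>simp_all add: RHA_def ball\<close>)
    then obtain c where c: "c \<in> coeff_positive S ?d"
      and match: "\<And>n x v. 1 \<le> n \<Longrightarrow> x \<in> mat_tuples n \<Longrightarrow> x \<in> nc_ball \<delta> \<Longrightarrow> c \<in> coeff_matching S ?d h (n, x, v)"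
      unfolding ball by blast
    \<comment> \<open>\<open>Suc k\<close> avoids the empty mean, which is 0 and not the identity at
      the origin.\<close>
    define p where "p = (\<lambda>k. fejer_poly S ?d c (Suc k))"
    have "free_eval (p k) \<in> RHA (nc_ball \<delta>)" for k
    proof -
      have "mat_psd (mat_Re (free_eval (p k) x))" if x: "x \<in> nc_ball \<delta>" for x
      proof -
        obtain n q where n: "x \<in> mat_tuples n" and q: "0 \<le> q" "q < 1" "block_contraction S ?d n x q"
          using x unfolding ball contraction_ball_def by blast
        have "block_contraction S ?d n x 1" by (rule block_contraction_mono[OF q(3,1)]) (use q in simp)
        then have "0 \<le> Re (inner_on {..<n} (poly_act (p k) x n v) v)" for v
          using c n unfolding coeff_positive_def p_def by blast
        then show ?thesis using mat_psd_mat_Re_iff[OF free_eval_carrier[OF n]] by (simp add: poly_act_eq_mat_act)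
      qed
      moreover have "free_eval (p k) (zero_tuple n) = 1\<^sub>m n" if "1 \<le> n" for n
        unfolding p_def by (rule fejer_poly_at_zero) (use c d_zero[OF that] in \<open>auto simp: coeff_positive_def\<close>)
      ultimately show ?thesis unfolding RHA_def using nc_function_on_free_eval by blast
    qed
    moreover have "\<exists>N. \<forall>k\<ge>N. \<forall>x\<in>nc_subball \<delta> r. op_norm (free_eval (p k) x - h x) < \<epsilon>"
      if r: "0 < r \<and> r < 1" and \<epsilon>: "0 < \<epsilon>" for r \<epsilon> :: real
    proof -
      have "(\<lambda>k. 2 / (1 - r)\<^sup>2 / real (Suc k)) \<longlonglongrightarrow> 0"
        by (rule LIMSEQ_Suc) (rule lim_const_over_n)
      then have "\<forall>\<^sub>F k in sequentially. 2 / (1 - r)\<^sup>2 / real (Suc k) < \<epsilon>"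
        using \<epsilon> by (rule order_tendstoD(2))
      then obtain N where N: "\<And>k. N \<le> k \<Longrightarrow> 2 / (1 - r)\<^sup>2 / real (Suc k) < \<epsilon>"
        unfolding eventually_sequentially by blast
      have "op_norm (free_eval (p k) x - h x) < \<epsilon>" if k: "N \<le> k" and x: "x \<in> nc_subball \<delta> r" for k x
      proof -
        have xb: "x \<in> nc_ball \<delta>" and le: "op_norm (free_mat_eval \<delta> x) \<le> r" using x by (auto simp: nc_subball_def)
        obtain n where n: "1 \<le> n" "x \<in> mat_tuples n" using xb unfolding ball contraction_ball_def by blast
        have "block_contraction S ?d n x r"
          using op_norm_free_mat_eval_le_iff[OF n(2) _ S(1,2), of r] le r by simp
        moreover have "h x \<in> carrier_mat n n" using graded n xb unfolding graded_on_def by blast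
        ultimately have "op_norm (free_eval (p k) x - h x) \<le> 2 / (1 - r)\<^sup>2 / real (Suc k)"
          unfolding p_def using r match[OF n xb] by (intro fejer_poly_error[OF n(2)]) auto
        then show ?thesis using N[OF k] by linarith
      qed
      then show ?thesis by blast
    qed
    ultimately show "\<exists>p :: nat \<Rightarrow> 'd free_poly. (\<forall>k. free_eval (p k) \<in> RHA (nc_ball \<delta>)) \<and>
       (\<forall>r. 0 < r \<and> r < 1 \<longrightarrow>
          (\<forall>\<epsilon>>0. \<exists>N. \<forall>k\<ge>N. \<forall>x\<in>nc_subball \<delta> r. op_norm (free_eval (p k) x - h x) < \<epsilon>))"
      by blast
  next
    assume "\<exists>p :: nat \<Rightarrow> 'd free_poly. (\<forall>k. free_eval (p k) \<in> RHA (nc_ball \<delta>)) \<and>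
       (\<forall>r. 0 < r \<and> r < 1 \<longrightarrow>
          (\<forall>\<epsilon>>0. \<exists>N. \<forall>k\<ge>N. \<forall>x\<in>nc_subball \<delta> r. op_norm (free_eval (p k) x - h x) < \<epsilon>))"
    then obtain p :: "nat \<Rightarrow> 'd free_poly" where p: "\<And>k. free_eval (p k) \<in> RHA (nc_ball \<delta>)"
      and lim: "\<And>r \<epsilon>. 0 < r \<Longrightarrow> r < 1 \<Longrightarrow> 0 < \<epsilon> \<Longrightarrow>
        \<exists>N. \<forall>k\<ge>N. \<forall>x\<in>nc_subball \<delta> r. op_norm (free_eval (p k) x - h x) < \<epsilon>" by blast
    show "h \<in> RHA (nc_ball \<delta>)"
    proof (rule RHA_limit[OF graded p])
      show "nc_ball \<delta> \<subseteq> nc_universe" by (auto simp: nc_ball_def)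
      show "zero_tuple n \<in> nc_ball \<delta>" if "1 \<le> n" for n by (rule zero_ball[OF that])
      fix n x a b
      assume n: "1 \<le> n" and x: "x \<in> nc_ball \<delta>" "x \<in> mat_tuples n" and ab: "a < n" "b < n"
      \<comment> \<open>The maximum with \<open>1 / 2\<close> keeps \<open>r\<close> positive when
        \<open>\<delta>(x) = 0\<close>, so that every point of the ball lies in an admissible
        subball.\<close>
      define r where "r = max (1 / 2) (op_norm (free_mat_eval \<delta> x))"
      have r: "0 < r" "r < 1" and xr: "x \<in> nc_subball \<delta> r"
        using x by (auto simp: r_def nc_subball_def nc_ball_def)
      have hx: "h x \<in> carrier_mat n n" using graded n x unfolding graded_on_def by blast
      show "(\<lambda>k. free_eval (p k) x $$ (a, b)) \<longlonglongrightarrow> h x $$ (a, b)"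
      proof (rule LIMSEQ_I)
        fix \<epsilon> :: real assume "0 < \<epsilon>"
        then obtain N where N: "\<And>k. N \<le> k \<Longrightarrow> op_norm (free_eval (p k) x - h x) < \<epsilon>"
          using lim[OF r] xr by blast
        have "cmod (free_eval (p k) x $$ (a, b) - h x $$ (a, b)) < \<epsilon>" if "N \<le> k" for k
        proof -
          have "free_eval (p k) x - h x \<in> carrier_mat n n" using free_eval_carrier[OF x(2)] hx by auto
          from cmod_index_le_op_norm[OF this ab] N[OF that] show ?thesis
            using free_eval_carrier[OF x(2), of "p k"] hx ab by simp
        qed
        then show "\<exists>N. \<forall>k\<ge>N. norm (free_eval (p k) x $$ (a, b) - h x $$ (a, b)) < \<epsilon>" by blast
      qed
    qed
  qed
qed

end
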